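(* Let $W\subseteq \mathfrak g(\!(x)\!)$ be a regular subalgebra of type $0$. Then there exist a regular partition $\Delta=\bigsqcup_{i=1}^n\Delta_i$, constants $a_1,\dots,a_n\in F$, and a linear map $\phi\colon\mathfrak h\to\mathfrak h$ satisfying $$(\phi-a_i)(\phi-a_j)H_\alpha=0\quad\text{for all }i,j\text{ and all }\alpha\in\Delta_i\text{ with }-\alpha\in\Delta_j,$$ such that $$W=W_\phi\oplus\bigoplus_{i=1}^n\bigoplus_{\alpha\in\Delta_i}(x^{-1}-a_i)\,\mathfrak g_\alpha[x^{-1}],\qquad (\ast)$$ where $W_\phi:=\mathrm{span}_F\{x^{-k}(x^{-1}h-\phi(h))\mid h\in\mathfrak h,\ k\in\mathbb Z_{\ge0}\}$. Conversely, for every regular partition $\Delta=\bigsqcup_{i=1}^n\Delta_i$, all constants $a_1,\dots,a_n\in F$ and every linear map $\phi\colon\mathfrak h\to\mathfrak h$ satisfying the displayed condition, formula $(\ast)$ defines a regular subalgebra of $\mathfrak g(\!(x)\!)$ of type $0$. Moreover, the solution of the generalized classical Yang–Baxter equation associated to $W$ in $(\ast)$ is $$r(x,y)=\frac{\Omega}{x-y}+\Big(\frac{\phi}{y\phi-1}\otimes1\Big)\Omega_{\mathfrak h}+\sum_{i=1}^n\frac{a_i\,\Omega_i}{a_iy-1},$$ where $\Omega_i=\sum_{\alpha\in\Delta_i}E_\alpha\otimes E_{-\alpha}$.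
   Context: $F$ is an algebraically closed field of characteristic $0$; $\mathfrak g$ is a finite-dimensional simple Lie algebra over $F$ with Cartan subalgebra $\mathfrak h$, root system $\Delta$ and root spaces $\mathfrak g_\alpha$; $\kappa$ is the Killing form. Root vectors $E_\alpha\in\mathfrak g_\alpha$ are chosen with $\kappa(E_\alpha,E_{-\alpha})=1$, and $H_\alpha:=[E_\alpha,E_{-\alpha}]$, so $\kappa(H_\alpha,H)=\alpha(H)$ for $H\in\mathfrak h$. $\Omega\in\mathfrak g\otimes\mathfrak g$ is the quadratic Casimir element (i.e. $\Omega=\sum_j b_j\otimes b_j$ for a $\kappa$-orthonormal basis $\{b_j\}$ of $\mathfrak g$) and $\Omega_{\mathfrak h}$ is its component in $\mathfrak h\otimes\mathfrak h$. A subset $S\subseteq\Delta$ is closed if $\alpha,\beta\in S$ and $\alpha+\beta\in\Delta$ imply $\alpha+\beta\in S$. A regular partition of $\Delta$ is a partition $\Delta=\bigsqcup_{i=1}^n\Delta_i$ such that all $\Delta_i$ and all $\Delta_i\sqcup\Delta_j$ are closed; the trivial partition $n=1$ is allowed. $\mathfrak g(\!(x)\!)$ and $\mathfrak g[\![x]\!]$ denote formal Laurent and Taylor series with coefficients in $\mathfrak g$, with the $F(\!(x)\!)$-bilinear bracket. A regular subalgebra of $\mathfrak g(\!(x)\!)$ of type $0$ is a Lie subalgebra $W$ with: $\mathfrak g(\!(x)\!)=\mathfrak g[\![x]\!]\oplus W$ (as vector spaces); $x^{-1}W\subseteq W$; $[\mathfrak h,W]\subseteq W$; $W\subseteq\mathfrak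 g[x^{-1}]$. The generalized classical Yang–Baxter equation for $r(x,y)$ is $[r^{12}(x_1,x_2),r^{13}(x_1,x_3)]+[r^{12}(x_1,x_2),r^{23}(x_2,x_3)]+[r^{32}(x_3,x_2),r^{13}(x_1,x_3)]=0$. For a subalgebra $W$ with $\mathfrak g(\!(x)\!)=\mathfrak g[\![x]\!]\oplus W$, the associated solution is the generating series $r(x,y)=\sum_{k\ge0}\sum_j w_{k,j}(x)\otimes b_j\,y^k$, where $w_{k,j}$ is the unique element of $W\cap(x^{-k-1}b_j+\mathfrak g[\![x]\!])$. Rational expressions are expanded as power series in $y$; in particular $\frac1{x-y}=\sum_{k\ge0}x^{-k-1}y^k$ and $\frac{\phi}{y\phi-1}=-\sum_{k\ge0}\phi^{k+1}y^k$. *)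

theory Defs
  imports
    "HOL-Computational_Algebra.Formal_Laurent_Series"
    "HOL-Computational_Algebra.Fraction_Field"
    "HOL-Library.Function_Algebras"
    "HOL-Library.Disjoint_Sets"
begin

unbundle fps_syntax
notation fls_nth (infixl \<open>$$\<close> 75)

section \<open>Internal direct sums\<close>

definition family_sum :: "'i set \<Rightarrow> ('i \<Rightarrow> 'v::ab_group_add set) \<Rightarrow> 'v set" where
  "family_sum I A = {\<Sum>i\<in>I. s i | s. \<forall>i\<in>I. s i \<in> A i}"

definition direct_family :: "'i set \<Rightarrow> ('i \<Rightarrow> 'v::ab_group_add set) \<Rightarrow> bool" where
  "direct_family I A \<longleftrightarrow>
    (\<forall>s. (\<forall>i\<in>I. s i \<in> A i) \<and> (\<Sum>i\<in>I. s i) = 0 \<longrightarrow> (\<forall>i\<in>I. s i = 0))"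

definition complementary :: "'v::ab_group_add set \<Rightarrow> 'v set \<Rightarrow> bool" where
  "complementary U V \<longleftrightarrow> {u + v | u v. u \<in> U \<and> v \<in> V} = UNIV \<and> U \<inter> V = {0}"


section \<open>Laurent series with vector coefficients\<close>

text \<open>
  Laurent series with coefficients in a vector space \<open>V\<close> are the elements of the library type of
  formal Laurent series over \<open>V\<close>, which only needs the additive structure. Multiplication by
  \<open>x\<^sup>-\<^sup>1\<close> is \<^term>\<open>fls_shift 1\<close>, and \<open>x\<^sup>-\<^sup>m v\<close> is \<^term>\<open>fls_shift m (fls_const v)\<close>.
\<close>

text \<open>Coefficientwise application; meant for maps that send zero to zero.\<close>

definition fls_map :: "('a::zero \<Rightarrow> 'b::zero) \<Rightarrow> 'a fls \<Rightarrow> 'b fls" where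
  "fls_map h f = Abs_fls (\<lambda>n. h (f $$ n))"

lemma fls_map_nth:
  assumes "h 0 = 0"
  shows "fls_map h f $$ n = h (f $$ n)"
proof -
  obtain N where "\<forall>n<N. f $$ n = 0" by (rule fls_nth_vanishes_belowE)
  hence "\<forall>n<N. h (f $$ n) = 0" using assms by simp
  thus ?thesis unfolding fls_map_def by (rule nth_Abs_fls_lower_bound)
qed

definition power_series :: "'a::zero fls set" where
  "power_series = range fps_to_fls"

text \<open>The set \<open>A[x\<^sup>-\<^sup>1]\<close>; only finitely many negative exponents occur in any Laurent series.\<close>

definition inverse_polys :: "'a::zero set \<Rightarrow> 'a fls set" where
  "inverse_polys A = {f. (\<forall>n>0. f $$ n = 0) \<and> (\<forall>n. f $$ n \<in> A)}"


section \<open>Lie algebras\<close>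

locale lie_algebra = vector_space scale
  for scale :: "'f::field \<Rightarrow> 'g::ab_group_add \<Rightarrow> 'g" (infixr \<open>*s\<close> 75) +
  fixes bracket :: "'g \<Rightarrow> 'g \<Rightarrow> 'g"
  assumes bracket_add_left: "bracket (x + y) z = bracket x z + bracket y z"
    and bracket_add_right: "bracket x (y + z) = bracket x y + bracket x z"
    and bracket_scale_left: "bracket (c *s x) y = c *s bracket x y"
    and bracket_scale_right: "bracket x (c *s y) = c *s bracket x y"
    and bracket_self: "bracket x x = 0"
    and jacobi: "bracket x (bracket y z) + bracket y (bracket z x) + bracket z (bracket x y) = 0"
begin

definition lie_ideal :: "'g set \<Rightarrow> bool" where
  "lie_ideal I \<longleftrightarrow> subspace I \<and> (\<forall>x. \<forall>y\<in>I. bracket x y \<in> I)"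

definition simple_lie :: bool where
  "simple_lie \<longleftrightarrow> (\<exists>x y. bracket x y \<noteq> 0) \<and> (\<forall>I. lie_ideal I \<longrightarrow> I = {0} \<or> I = UNIV)"

definition lie_subalgebra :: "'g set \<Rightarrow> bool" where
  "lie_subalgebra S \<longleftrightarrow> subspace S \<and> (\<forall>x\<in>S. \<forall>y\<in>S. bracket x y \<in> S)"

primrec lower_central :: "'g set \<Rightarrow> nat \<Rightarrow> 'g set" where
  "lower_central S 0 = S"
| "lower_central S (Suc n) = span {bracket x y | x y. x \<in> S \<and> y \<in> lower_central S n}"

definition cartan_subalgebra :: "'g set \<Rightarrow> bool" where
  "cartan_subalgebra H \<longleftrightarrow>
     lie_subalgebra H \<and> (\<exists>n. lower_central H n = {0}) \<and> {x. \<forall>h\<in>H. bracket x h \<in> H} = H"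


subsection \<open>Roots\<close>

text \<open>
  A linear functional on \<open>H\<close> is represented by the function on the whole Lie algebra that is zero
  outside \<open>H\<close>. This makes the representation unique and compatible with pointwise sums and negatives.
\<close>

definition dual_on :: "'g set \<Rightarrow> ('g \<Rightarrow> 'f) set" where
  "dual_on H = {\<alpha>. (\<forall>x\<in>H. \<forall>y\<in>H. \<alpha> (x + y) = \<alpha> x + \<alpha> y) \<and> (\<forall>c. \<forall>x\<in>H. \<alpha> (c *s x) = c * \<alpha> x)
                  \<and> (\<forall>x. x \<notin> H \<longrightarrow> \<alpha> x = 0)}"

definition root_space :: "'g set \<Rightarrow> ('g \<Rightarrow> 'f) \<Rightarrow> 'g set" where
  "root_space H \<alpha> = {x. \<forall>h\<in>H. bracket h x = \<alpha> h *s x}"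

definition roots :: "'g set \<Rightarrow> ('g \<Rightarrow> 'f) set" where
  "roots H = {\<alpha> \<in> dual_on H. \<alpha> \<noteq> 0 \<and> root_space H \<alpha> \<noteq> {0}}"

definition closed_roots :: "'g set \<Rightarrow> ('g \<Rightarrow> 'f) set \<Rightarrow> bool" where
  "closed_roots H S \<longleftrightarrow> S \<subseteq> roots H \<and> (\<forall>\<alpha>\<in>S. \<forall>\<beta>\<in>S. \<alpha> + \<beta> \<in> roots H \<longrightarrow> \<alpha> + \<beta> \<in> S)"

definition regular_partition :: "'g set \<Rightarrow> nat \<Rightarrow> (nat \<Rightarrow> ('g \<Rightarrow> 'f) set) \<Rightarrow> bool" where
  "regular_partition H n D \<longleftrightarrow>
     (\<Union>i\<in>{1..n}. D i) = roots H \<and> disjoint_family_on D {1..n} \<and> (\<forall>i\<in>{1..n}. D i \<noteq> {})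
     \<and> (\<forall>i\<in>{1..n}. closed_roots H (D i))
     \<and> (\<forall>i\<in>{1..n}. \<forall>j\<in>{1..n}. closed_roots H (D i \<union> D j))"

text \<open>The projection to \<open>H\<close> along the sum of all root spaces.\<close>

definition cartan_proj :: "'g set \<Rightarrow> 'g \<Rightarrow> 'g" where
  "cartan_proj H x = (THE h. h \<in> H \<and> x - h \<in> span (\<Union>\<alpha>\<in>roots H. root_space H \<alpha>))"

text \<open>Linear maps \<open>H \<rightarrow> H\<close>; the values outside \<open>H\<close> are irrelevant.\<close>

definition endo_on :: "'g set \<Rightarrow> ('g \<Rightarrow> 'g) \<Rightarrow> bool" where
  "endo_on H \<phi> \<longleftrightarrow> (\<forall>x\<in>H. \<phi> x \<in> H) \<and> (\<forall>x\<in>H. \<forall>y\<in>H. \<phi> (x + y) = \<phi> x + \<phi> y)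
     \<and> (\<forall>c. \<forall>x\<in>H. \<phi> (c *s x) = c *s \<phi> x)"

definition op_minus :: "('g \<Rightarrow> 'g) \<Rightarrow> 'f \<Rightarrow> 'g \<Rightarrow> 'g" where
  "op_minus \<phi> a v = \<phi> v - a *s v"


subsection \<open>Laurent series in a Lie algebra\<close>

definition fls_scale :: "'f \<Rightarrow> 'g fls \<Rightarrow> 'g fls" where
  "fls_scale c = fls_map (scale c)"

lemma fls_scale_nth [simp]: "fls_scale c f $$ n = c *s (f $$ n)"
  by (simp add: fls_scale_def fls_map_nth)

sublocale fls: vector_space fls_scale
  by unfold_locales (auto intro!: fls_eqI simp: algebra_simps)

definition fls_bracket :: "'g fls \<Rightarrow> 'g fls \<Rightarrow> 'g fls" where
  "fls_bracket f g =
     Abs_fls (\<lambda>n. \<Sum>i = fls_subdegree f..n - fls_subdegree g. bracket (f $$ i) (g $$ (n - i)))"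

lemma fls_bracket_nth:
  "fls_bracket f g $$ n =
     (\<Sum>i = fls_subdegree f..n - fls_subdegree g. bracket (f $$ i) (g $$ (n - i)))"
  unfolding fls_bracket_def
  by (rule nth_Abs_fls_lower_bound[of "fls_subdegree f + fls_subdegree g"]) auto

definition regular_type0 :: "'g set \<Rightarrow> 'g fls set \<Rightarrow> bool" where
  "regular_type0 H W \<longleftrightarrow>
     fls.subspace W \<and> (\<forall>u\<in>W. \<forall>v\<in>W. fls_bracket u v \<in> W)
     \<and> complementary power_series W
     \<and> (\<forall>w\<in>W. fls_shift 1 w \<in> W)
     \<and> (\<forall>h\<in>H. \<forall>w\<in>W. fls_bracket (fls_const h) w \<in> W)
     \<and> W \<subseteq> inverse_polys UNIV"

definition W_cartan :: "'g set \<Rightarrow> ('g \<Rightarrow> 'g) \<Rightarrow> 'g fls set" where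
  "W_cartan H \<phi> =
     fls.span {fls_shift (int k) (fls_shift 1 (fls_const h) - fls_const (\<phi> h)) | h k. h \<in> H}"

definition W_root :: "'g set \<Rightarrow> 'f \<Rightarrow> ('g \<Rightarrow> 'f) \<Rightarrow> 'g fls set" where
  "W_root H a \<alpha> = {fls_shift 1 f - fls_scale a f | f. f \<in> inverse_polys (root_space H \<alpha>)}"

text \<open>
  The summands of \<open>W\<^sub>\<phi> \<oplus> \<Oplus>\<^sub>i \<Oplus>\<^sub>\<alpha> (x\<^sup>-\<^sup>1 - a\<^sub>i) g\<^sub>\<alpha>[x\<^sup>-\<^sup>1]\<close>: the index \<^const>\<open>None\<close> stands for \<open>W\<^sub>\<phi>\<close>,
  and \<open>Some (i, \<alpha>)\<close> for the summand of \<open>\<alpha>\<close> in the \<open>i\<close>-th part.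
\<close>

definition summand_index :: "nat \<Rightarrow> (nat \<Rightarrow> ('g \<Rightarrow> 'f) set) \<Rightarrow> (nat \<times> ('g \<Rightarrow> 'f)) option set" where
  "summand_index n D = insert None (Some ` (SIGMA i:{1..n}. D i))"

definition summand ::
  "'g set \<Rightarrow> (nat \<Rightarrow> 'f) \<Rightarrow> ('g \<Rightarrow> 'g) \<Rightarrow> (nat \<times> ('g \<Rightarrow> 'f)) option \<Rightarrow> 'g fls set" where
  "summand H a \<phi> s = (case s of None \<Rightarrow> W_cartan H \<phi> | Some (i, \<alpha>) \<Rightarrow> W_root H (a i) \<alpha>)"

definition W_sum ::
  "'g set \<Rightarrow> nat \<Rightarrow> (nat \<Rightarrow> ('g \<Rightarrow> 'f) set) \<Rightarrow> (nat \<Rightarrow> 'f) \<Rightarrow> ('g \<Rightarrow> 'g) \<Rightarrow> 'g fls set" where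
  "W_sum H n D a \<phi> = family_sum (summand_index n D) (summand H a \<phi>)"

definition W_sum_direct ::
  "'g set \<Rightarrow> nat \<Rightarrow> (nat \<Rightarrow> ('g \<Rightarrow> 'f) set) \<Rightarrow> (nat \<Rightarrow> 'f) \<Rightarrow> ('g \<Rightarrow> 'g) \<Rightarrow> bool" where
  "W_sum_direct H n D a \<phi> \<longleftrightarrow> direct_family (summand_index n D) (summand H a \<phi>)"

end


section \<open>Tensors\<close>

text \<open>
  For a finite-dimensional space \<open>V\<close>, the tensor square \<open>V \<otimes> V\<close> is realised as the space of bilinear
  forms on the dual of \<open>V\<close>, with \<open>u \<otimes> v\<close> sent to the form \<open>(\<xi>, \<eta>) \<mapsto> \<xi>(u) \<eta>(v)\<close>. Forms are set to
  zero on arguments that are not linear, so that equality of functions is equality of tensors.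
\<close>

type_synonym ('f, 'v) tensor2 = "('v \<Rightarrow> 'f) \<Rightarrow> ('v \<Rightarrow> 'f) \<Rightarrow> 'f"

definition tensor_scale :: "'f::field \<Rightarrow> ('f, 'v) tensor2 \<Rightarrow> ('f, 'v) tensor2" where
  "tensor_scale c t = (\<lambda>\<xi> \<eta>. c * t \<xi> \<eta>)"

abbreviation functional :: "('f::field \<Rightarrow> 'v::ab_group_add \<Rightarrow> 'v) \<Rightarrow> ('v \<Rightarrow> 'f) \<Rightarrow> bool" where
  "functional scale \<equiv> Vector_Spaces.linear scale (*)"

definition tensor ::
  "('f::field \<Rightarrow> 'v::ab_group_add \<Rightarrow> 'v) \<Rightarrow> 'v \<Rightarrow> 'v \<Rightarrow> ('f, 'v) tensor2" where
  "tensor scale u v =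
     (\<lambda>\<xi> \<eta>. if functional scale \<xi> \<and> functional scale \<eta> then \<xi> u * \<eta> v else 0)"

text \<open>The map \<open>S \<otimes> T\<close>, for linear endomorphisms \<open>S\<close> and \<open>T\<close>.\<close>

definition tensor_map ::
  "('f::field \<Rightarrow> 'v::ab_group_add \<Rightarrow> 'v) \<Rightarrow> ('v \<Rightarrow> 'v) \<Rightarrow> ('v \<Rightarrow> 'v)
     \<Rightarrow> ('f, 'v) tensor2 \<Rightarrow> ('f, 'v) tensor2" where
  "tensor_map scale S T t =
     (\<lambda>\<xi> \<eta>. if functional scale \<xi> \<and> functional scale \<eta> then t (\<xi> \<circ> S) (\<eta> \<circ> T) else 0)"

context vector_space
begin

lemma tensor_add_left: "tensor scale (u + u') v = tensor scale u v + tensor scale u' v"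
  and tensor_add_right: "tensor scale u (v + v') = tensor scale u v + tensor scale u v'"
  and tensor_scale_left: "tensor scale (c *s u) v = tensor_scale c (tensor scale u v)"
  and tensor_scale_right: "tensor scale u (c *s v) = tensor_scale c (tensor scale u v)"
  by (auto simp: tensor_def tensor_scale_def fun_eq_iff linear_iff_module_hom
      module_hom.add module_hom.scale algebra_simps)

lemma tensor_map_tensor:
  assumes "Vector_Spaces.linear scale scale S" "Vector_Spaces.linear scale scale T"
  shows "tensor_map scale S T (tensor scale u v) = tensor scale (S u) (T v)"
  using Vector_Spaces.linear_compose[OF assms(1)] Vector_Spaces.linear_compose[OF assms(2)]
  by (auto simp: tensor_map_def tensor_def fun_eq_iff)

text \<open>Pure tensors of basis vectors are linearly independent.\<close>

lemma tensor_basis_independent: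
  assumes B: "independent B" "span B = UNIV" "finite B"
    and zero: "(\<Sum>u\<in>B. \<Sum>v\<in>B. tensor_scale (c u v) (tensor scale u v)) = 0"
    and uv: "u \<in> B" "v \<in> B"
  shows "c u v = 0"
proof -
  let ?r = "\<lambda>b x. representation B x b"
  have lin: "functional scale (?r b)" for b
    using B by (intro linear_representation)
  have sum_app: "(\<Sum>i\<in>A. h i) x = (\<Sum>i\<in>A. h i x)" for A x
    and h :: "'b \<Rightarrow> 'x \<Rightarrow> 'y::comm_monoid_add"
    by (induction A rule: infinite_finite_induct) auto
  have "0 = (\<Sum>u'\<in>B. \<Sum>v'\<in>B. c u' v' * (?r u u' * ?r v v'))"
    using fun_cong[OF fun_cong[OF zero], of "?r u" "?r v"] lin
    by (simp add: sum_app tensor_scale_def tensor_def)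
  also have "\<dots> = (\<Sum>u'\<in>B. if u' = u then \<Sum>v'\<in>B. if v' = v then c u' v' else 0 else 0)"
    using B(1) by (intro sum.cong refl) (auto simp: representation_basis intro!: sum.cong)
  also have "\<dots> = c u v"
    using B(3) uv by simp
  finally show ?thesis by simp
qed

end


section \<open>Series in two variables\<close>

text \<open>
  The ring of series in \<open>y\<close> whose coefficients are Laurent series in \<open>x\<close> is the iterated type with
  \<^const>\<open>fps_X\<close> in the role of \<open>y\<close> and \<^term>\<open>fps_const fls_X\<close> in the role of \<open>x\<close>; rational functions
  of \<open>x\<close> and \<open>y\<close> are then automatically expanded as power series in \<open>y\<close>.
\<close>

definition x_minus_y :: "'f::field fls fps" where
  "x_minus_y = fps_const fls_X - fps_X"

definition inv_x_minus_y :: "'f::field fls fps" where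
  "inv_x_minus_y = inverse x_minus_y"

definition geom_frac :: "'f::field \<Rightarrow> 'f fls fps" where
  "geom_frac a = fps_const (fls_const a) * inverse (fps_const (fls_const a) * fps_X - 1)"

lemma inv_x_minus_y_nth: "inv_x_minus_y $ k = fls_X_intpow (- int k - 1)"
proof -
  have "(fps_const fls_X - fps_X) * Abs_fps (\<lambda>k. fls_X_intpow (- int k - 1)) = (1 :: 'a::field fls fps)"
    by (rule fps_ext)
      (auto simp: left_diff_distrib fls_X_times_conv_shift fls_eq_iff of_nat_diff)
  from fps_inverse_unique[OF this] show ?thesis
    by (simp add: inv_x_minus_y_def x_minus_y_def)
qed

lemma geom_frac_nth: "geom_frac a $ k = - fls_const (a ^ Suc k)"
proof -
  have "(fps_const (fls_const a) * fps_X - 1) * Abs_fps (\<lambda>k. - fls_const (a ^ k)) = 1"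
    by (rule fps_ext)
      (auto simp: left_diff_distrib mult.assoc fls_eq_iff fls_const_mult_const power_eq_if)
  from fps_inverse_unique[OF this] show ?thesis
    by (simp add: geom_frac_def fls_const_mult_const)
qed

text \<open>The product \<open>u \<cdot> t\<close> of a scalar series \<open>u\<close> with a constant tensor \<open>t\<close>.\<close>

definition series_times :: "'f::field fls fps \<Rightarrow> ('f, 'v) tensor2 \<Rightarrow> ('f, 'v) tensor2 fls fps" where
  "series_times u t = Abs_fps (\<lambda>k. fls_map (\<lambda>c. tensor_scale c t) (u $ k))"

text \<open>The operator series \<open>\<phi> / (y \<phi> - 1) = - \<Sum>\<^sub>k \<phi>\<^bsup>k+1\<^esup> y\<^sup>k\<close>.\<close>

definition op_geom_frac :: "('v \<Rightarrow> 'v::ab_group_add) \<Rightarrow> ('v \<Rightarrow> 'v) fps" where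
  "op_geom_frac \<phi> = Abs_fps (\<lambda>k v. - (\<phi> ^^ Suc k) v)"


section \<open>Scalar functions of three variables\<close>

text \<open>
  Power series in \<open>x\<^sub>1, x\<^sub>2, x\<^sub>3\<close> form an iterated type, the coefficient of \<open>x\<^sub>1\<^sup>l x\<^sub>2\<^sup>m x\<^sub>3\<^sup>n\<close> in \<open>f\<close> being
  \<open>f $ n $ m $ l\<close>. The terms of the Yang--Baxter equation have denominators \<open>x\<^sub>i - x\<^sub>j\<close> and are compared
  in the fraction field, because their expansions in different regions have no common domain.
\<close>

type_synonym 'f series3 = "'f fps fps fps"

definition coord :: "nat \<Rightarrow> 'f::field series3" where
  "coord i = (if i = 1 then fps_const (fps_const fps_X) else if i = 2 then fps_const fps_X else fps_X)"

definition const3 :: "'f::field \<Rightarrow> 'f series3 fract" where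
  "const3 c = Fract (fps_const (fps_const (fps_const c))) 1"

text \<open>
  The substitution \<open>p(x\<^sub>i, x\<^sub>j)\<close> for distinct \<open>i\<close>, \<open>j\<close> in \<open>{1, 2, 3}\<close>, where \<open>p\<close> has no negative powers
  of \<open>x\<close>. The remaining variable is number \<open>6 - i - j\<close>.
\<close>

definition place :: "nat \<Rightarrow> nat \<Rightarrow> 'f::field fls fps \<Rightarrow> 'f series3" where
  "place i j p = Abs_fps (\<lambda>n. Abs_fps (\<lambda>m. Abs_fps (\<lambda>l.
     let e = (\<lambda>v. if v = 1 then l else if v = 2 then m else n)
     in if e (6 - i - j) = 0 then p $ (e j) $$ int (e i) else 0)))"

text \<open>
  The value \<open>q(x\<^sub>i, x\<^sub>j)\<close> in the fraction field of a series \<open>q\<close> for which \<open>(x - y) q(x, y)\<close> is a power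
  series in \<open>x\<close> and \<open>y\<close>.
\<close>

definition eval3 :: "nat \<Rightarrow> nat \<Rightarrow> 'f::field fls fps \<Rightarrow> 'f series3 fract" where
  "eval3 i j q = Fract (place i j (x_minus_y * q)) (coord i - coord j)"


section \<open>Killing form, Casimir element and the associated solution\<close>

locale fd_lie_algebra = lie_algebra scale bracket + finite_dimensional_vector_space scale Basis
  for scale :: "'f::field \<Rightarrow> 'g::ab_group_add \<Rightarrow> 'g" (infixr \<open>*s\<close> 75)
    and bracket :: "'g \<Rightarrow> 'g \<Rightarrow> 'g"
    and Basis :: "'g set"
begin

definition trace_op :: "('g \<Rightarrow> 'g) \<Rightarrow> 'f" where
  "trace_op T = (\<Sum>b\<in>Basis. representation Basis (T b) b)"

definition killing :: "'g \<Rightarrow> 'g \<Rightarrow> 'f" where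
  "killing x y = trace_op (bracket x \<circ> bracket y)"

definition root_vectors :: "'g set \<Rightarrow> (('g \<Rightarrow> 'f) \<Rightarrow> 'g) \<Rightarrow> bool" where
  "root_vectors H E \<longleftrightarrow>
     (\<forall>\<alpha>\<in>roots H. E \<alpha> \<in> root_space H \<alpha> \<and> killing (E \<alpha>) (E (- \<alpha>)) = 1)"

definition orthonormal_basis :: "'g set \<Rightarrow> bool" where
  "orthonormal_basis B \<longleftrightarrow> finite B \<and> independent B \<and> span B = UNIV
     \<and> (\<forall>b\<in>B. \<forall>c\<in>B. killing b c = (if b = c then 1 else 0))"

definition casimir :: "'g set \<Rightarrow> ('f, 'g) tensor2" where
  "casimir B = (\<Sum>b\<in>B. tensor scale b b)"

text \<open>The component of the Casimir element in \<open>H \<otimes> H\<close>.\<close>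

definition casimir_cartan :: "'g set \<Rightarrow> 'g set \<Rightarrow> ('f, 'g) tensor2" where
  "casimir_cartan H B = tensor_map scale (cartan_proj H) (cartan_proj H) (casimir B)"

definition casimir_part :: "(('g \<Rightarrow> 'f) \<Rightarrow> 'g) \<Rightarrow> ('g \<Rightarrow> 'f) set \<Rightarrow> ('f, 'g) tensor2" where
  "casimir_part E S = (\<Sum>\<alpha>\<in>S. tensor scale (E \<alpha>) (E (- \<alpha>)))"

text \<open>The element of \<open>W \<inter> (x\<^bsup>-k-1\<^esup> b + g[[x]])\<close>.\<close>

definition assoc_elem :: "'g fls set \<Rightarrow> nat \<Rightarrow> 'g \<Rightarrow> 'g fls" where
  "assoc_elem W k b =
     (THE w. w \<in> W \<and> w - fls_shift (int k + 1) (fls_const b) \<in> power_series)"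

definition assoc_solution :: "'g set \<Rightarrow> 'g fls set \<Rightarrow> ('f, 'g) tensor2 fls fps" where
  "assoc_solution B W = Abs_fps (\<lambda>k. \<Sum>b\<in>B. fls_map (\<lambda>v. tensor scale v b) (assoc_elem W k b))"

definition component ::
  "('f, 'g) tensor2 fls fps \<Rightarrow> ('g \<Rightarrow> 'f) \<Rightarrow> ('g \<Rightarrow> 'f) \<Rightarrow> 'f fls fps" where
  "component r \<xi> \<eta> = Abs_fps (\<lambda>k. fls_map (\<lambda>t. t \<xi> \<eta>) (r $ k))"

abbreviation dual_basis :: "'g \<Rightarrow> 'g \<Rightarrow> 'f" where
  "dual_basis b \<equiv> (\<lambda>v. representation Basis v b)"

text \<open>
  The generalized classical Yang--Baxter equation
  \<open>[r\<^sup>1\<^sup>2(x\<^sub>1,x\<^sub>2), r\<^sup>1\<^sup>3(x\<^sub>1,x\<^sub>3)] + [r\<^sup>1\<^sup>2(x\<^sub>1,x\<^sub>2), r\<^sup>2\<^sup>3(x\<^sub>2,x\<^sub>3)] + [r\<^sup>3\<^sup>2(x\<^sub>3,x\<^sub>2), r\<^sup>1\<^sup>3(x\<^sub>1,x\<^sub>3)] = 0\<close>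
  for a series with at most a simple pole along \<open>x = y\<close>, tested against all \<open>\<xi> \<otimes> \<eta> \<otimes> \<zeta>\<close>. The two legs
  that share a tensor slot are expanded in the basis \<^term>\<open>Basis\<close> and then bracketed.
\<close>

definition gcybe :: "('f, 'g) tensor2 fls fps \<Rightarrow> bool" where
  "gcybe r \<longleftrightarrow>
     (\<forall>\<xi> \<eta> k. functional scale \<xi> \<and> functional scale \<eta> \<longrightarrow>
        (x_minus_y * component r \<xi> \<eta>) $ k \<in> power_series)
     \<and> (\<forall>\<xi> \<eta> \<zeta>. functional scale \<xi> \<and> functional scale \<eta> \<and> functional scale \<zeta> \<longrightarrow>
        (\<Sum>b\<in>Basis. \<Sum>c\<in>Basis. const3 (\<xi> (bracket b c))
            * eval3 1 2 (component r (dual_basis b) \<eta>) * eval3 1 3 (component r (dual_basis c) \<zeta>))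
      + (\<Sum>b\<in>Basis. \<Sum>c\<in>Basis. const3 (\<eta> (bracket b c))
            * eval3 1 2 (component r \<xi> (dual_basis b)) * eval3 2 3 (component r (dual_basis c) \<zeta>))
      + (\<Sum>b\<in>Basis. \<Sum>c\<in>Basis. const3 (\<zeta> (bracket b c))
            * eval3 3 2 (component r (dual_basis b) \<eta>) * eval3 1 3 (component r \<xi> (dual_basis c)))
      = 0)"

text \<open>
  The operator \<open>\<phi>\<close> lives on \<open>H\<close> only; precomposition with the projection to \<open>H\<close> turns its powers
  into linear maps on the whole space without affecting the result on \<open>H \<otimes> H\<close>.
\<close>

definition cartan_term :: "'g set \<Rightarrow> 'g set \<Rightarrow> ('g \<Rightarrow> 'g) \<Rightarrow> ('f, 'g) tensor2 fls fps" where
  "cartan_term H B \<phi> =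
     Abs_fps (\<lambda>k. fls_const
       (tensor_map scale (op_geom_frac \<phi> $ k \<circ> cartan_proj H) id (casimir_cartan H B)))"

definition r_formula ::
  "'g set \<Rightarrow> (('g \<Rightarrow> 'f) \<Rightarrow> 'g) \<Rightarrow> 'g set \<Rightarrow> nat \<Rightarrow> (nat \<Rightarrow> ('g \<Rightarrow> 'f) set) \<Rightarrow> (nat \<Rightarrow> 'f)
     \<Rightarrow> ('g \<Rightarrow> 'g) \<Rightarrow> ('f, 'g) tensor2 fls fps" where
  "r_formula H E B n D a \<phi> =
     series_times inv_x_minus_y (casimir B)
     + cartan_term H B \<phi>
     + (\<Sum>i\<in>{1..n}. series_times (geom_frac (a i)) (casimir_part E (D i)))"

text \<open>
  The condition \<open>(\<phi> - a\<^sub>i) (\<phi> - a\<^sub>j) H\<^sub>\<alpha> = 0\<close>, with \<open>H\<^sub>\<alpha> = [E\<^sub>\<alpha>, E\<^sub>-\<^sub>\<alpha>]\<close>.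
\<close>

definition compatible ::
  "(('g \<Rightarrow> 'f) \<Rightarrow> 'g) \<Rightarrow> nat \<Rightarrow> (nat \<Rightarrow> ('g \<Rightarrow> 'f) set) \<Rightarrow> (nat \<Rightarrow> 'f) \<Rightarrow> ('g \<Rightarrow> 'g) \<Rightarrow> bool" where
  "compatible E n D a \<phi> \<longleftrightarrow>
     (\<forall>i\<in>{1..n}. \<forall>j\<in>{1..n}. \<forall>\<alpha>\<in>D i. - \<alpha> \<in> D j \<longrightarrow>
        op_minus \<phi> (a i) (op_minus \<phi> (a j) (bracket (E \<alpha>) (E (- \<alpha>)))) = 0)"

end

locale simple_lie_algebra_data = fd_lie_algebra scale bracket Basis
  for scale :: "'f::{alg_closed_field, field_char_0} \<Rightarrow> 'g::ab_group_add \<Rightarrow> 'g" (infixr \<open>*s\<close> 75)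
    and bracket :: "'g \<Rightarrow> 'g \<Rightarrow> 'g"
    and Basis :: "'g set" +
  fixes H :: "'g set" and E :: "('g \<Rightarrow> 'f) \<Rightarrow> 'g"
  assumes simple: "simple_lie"
    and cartan: "cartan_subalgebra H"
    and root_vectors: "root_vectors H E"

end

theory Submission
  imports Defs
begin

text \<open>
  Let \<open>W\<close> be complementary to \<open>g[[x]]\<close>, contained in \<open>g[x\<^sup>-\<^sup>1]\<close> and stable under \<open>x\<^sup>-\<^sup>1\<close>. For
  every \<open>b\<close> it contains exactly one element of the form \<open>x\<^sup>-\<^sup>1 b - \<Phi> b\<close>, and \<open>W\<close> is the image of
  \<open>x\<^sup>-\<^sup>1 - \<Phi>\<close> on \<open>g[x\<^sup>-\<^sup>1]\<close>. Such an image is closed under the bracket if and only if the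
  Nijenhuis torsion of \<open>\<Phi>\<close> vanishes, and stable under \<open>ad H\<close> if and only if \<open>\<Phi>\<close> commutes with \<open>ad
  H\<close>. In the latter case \<open>\<Phi>\<close> preserves \<open>H\<close> and is multiplication by some \<open>a\<^sub>\<alpha>\<close> on \<open>g\<^sub>\<alpha>\<close>. The
  torsion at \<open>(E\<^sub>\<alpha>, E\<^sub>\<beta>)\<close> is \<open>(\<Phi> - a\<^sub>\<alpha>) (\<Phi> - a\<^sub>\<beta>) [E\<^sub>\<alpha>, E\<^sub>\<beta>]\<close>, and \<open>[E\<^sub>\<alpha>, E\<^sub>\<beta>] \<noteq> 0\<close> if \<open>\<alpha> + \<beta>\<close> is
  a root; so the level sets of \<open>\<alpha> \<mapsto> a\<^sub>\<alpha>\<close> are the parts of a regular partition, and \<open>\<beta> = -\<alpha>\<close> gives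
  the condition on \<open>\<Phi>\<close>. The associated solution is \<open>\<Omega> / (x - y) + (\<Phi> / (y \<Phi> - 1) \<otimes> 1) \<Omega>\<close>, and by
  invariance of \<open>\<Omega>\<close> the Yang--Baxter equation becomes the vanishing of the torsion for all pairs
  of powers of \<open>\<Phi>\<close>.

  The structure of \<open>g\<close> that is needed follows from traces alone. A weight of the nilpotent algebra
  \<open>H\<close> is linear because it is a normalised trace. Since \<open>g\<close> is not nilpotent there is a root, so
  the normalisation \<open>\<kappa>(E\<^sub>\<alpha>, E\<^sub>-\<^sub>\<alpha>) = 1\<close> already shows \<open>\<kappa> \<noteq> 0\<close>, and simplicity makes \<open>\<kappa>\<close>
  nondegenerate without Cartan's criterion. That root spaces are lines, and that \<open>[E\<^sub>\<alpha>, E\<^sub>\<beta>] \<noteq> 0\<close>,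
  is read off from the vanishing of the trace of \<open>ad [E\<^sub>\<alpha>, E\<^sub>-\<^sub>\<alpha>]\<close> on suitable sums of weight
  spaces.
\<close>

section \<open>Traces on invariant subspaces\<close>

text \<open>The hypotheses only make H nilpotent and self-normalising, so neither commutativity of H
  nor diagonalisability of ad H is available at the start. This forces generalised weight spaces of
  arbitrary functions on H as the initial objects; linearity of the weights,
  \<open>wsp 0 = H\<close>, commutativity and one-dimensional root spaces have to be extracted from
  each other. On the line of \<alpha> + \<beta> the operator (\<Phi> - a)(\<Phi> - b) is a product
  of two scalars, so a vanishing torsion says that the value at \<alpha> + \<beta> is one of the
  values at \<alpha> and \<beta>. This is why closedness is demanded of unions of two parts. In the
  Yang--Baxter equation every factor is a simple pole minus a power series in x2 or x3 alone. With
  all brackets moved to the first slot, the poles along x1 - x2 and x1 - x3 cancel. With s(p) the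
  contraction of \<Phi>^p [u,v], the pole along x2 - x3 leaves a divided difference, the double
  series of s(m + n + 2), and the torsion identity for powers yields its negative from the products
  of the power series.\<close>

lemma family_sumI: "(\<And>i. i \<in> I \<Longrightarrow> s i \<in> A i) \<Longrightarrow> (\<Sum>i\<in>I. s i) \<in> family_sum I A"
  by (auto simp: family_sum_def)

lemma family_sumE:
  assumes "x \<in> family_sum I A"
  obtains s where "\<And>i. i \<in> I \<Longrightarrow> s i \<in> A i" "x = (\<Sum>i\<in>I. s i)"
  using assms by (auto simp: family_sum_def)

lemma family_sum_mem:
  assumes "finite I" "i \<in> I" "x \<in> A i" "\<And>j. j \<in> I \<Longrightarrow> 0 \<in> A j"
  shows "x \<in> family_sum I A"
proof -
  have "x = (\<Sum>j\<in>I. if j = i then x else 0)" using assms by simp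
  also have "\<dots> \<in> family_sum I A" using assms by (intro family_sumI) auto
  finally show ?thesis .
qed

lemma direct_familyD:
  assumes "direct_family I V" "\<And>i. i \<in> I \<Longrightarrow> s i \<in> V i" "(\<Sum>i\<in>I. s i) = 0" "i \<in> I"
  shows "s i = 0"
  using assms unfolding direct_family_def by blast

lemma (in vector_space) subspace_family_sum:
  assumes "\<And>i. i \<in> I \<Longrightarrow> subspace (V i)"
  shows "subspace (family_sum I V)"
proof (rule subspaceI)
  show "0 \<in> family_sum I V"
    using family_sumI[of I "\<lambda>_. 0" V] assms by (simp add: subspace_0)
next
  fix x y assume "x \<in> family_sum I V" "y \<in> family_sum I V"
  then show "x + y \<in> family_sum I V"
    by (elim family_sumE) (use assms in \<open>auto simp: subspace_add simp flip: sum.distrib intro!: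
        family_sumI\<close>)
next
  fix c x assume "x \<in> family_sum I V"
  then show "c *s x \<in> family_sum I V"
    by (elim family_sumE) (use assms in \<open>auto simp: subspace_scale scale_sum_right intro!:
        family_sumI\<close>)
qed

context finite_dimensional_vector_space
begin

abbreviation lin :: "('b \<Rightarrow> 'b) \<Rightarrow> bool" where
  "lin \<equiv> Vector_Spaces.linear scale scale"

lemma lin_hom: "lin T \<Longrightarrow> module_hom scale scale T"
  by (simp add: linear_iff_module_hom)

lemmas lin_add = module_hom.add [OF lin_hom]
  and lin_scale = module_hom.scale [OF lin_hom]
  and lin_zero = module_hom.zero [OF lin_hom]
  and lin_neg = module_hom.neg [OF lin_hom]
  and lin_diff = module_hom.diff [OF lin_hom]
  and lin_sum = module_hom.sum [OF lin_hom]

lemma linI: "(\<And>x y. T (x + y) = T x + T y) \<Longrightarrow> (\<And>c x. T (c *s x) = c *s T x) \<Longrightarrow> lin T"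
  by (simp add: linear_iff_module_hom module_hom_iff module_axioms)

lemma lin_funpow: "lin T \<Longrightarrow> lin (T ^^ n)"
  by (induction n) (auto intro!: linI simp: lin_add lin_scale)

lemma funpow_mem: "(\<And>x. x \<in> V \<Longrightarrow> T x \<in> V) \<Longrightarrow> x \<in> V \<Longrightarrow> (T ^^ n) x \<in> V"
  by (induction n) auto

lemma lin_span_mem:
  assumes "lin T" "\<And>c. c \<in> C \<Longrightarrow> T c \<in> V" "subspace V" "x \<in> span C"
  shows "T x \<in> V"
  using assms(4)
proof (induction rule: span_induct_alt)
  case base
  then show ?case using assms by (simp add: lin_zero subspace_0)
next
  case (step c x y)
  then show ?case
    using assms by (simp add: lin_add lin_scale subspace_add subspace_scale)
qed

text \<open>Matrix-vector multiplication between possibly different bases C and D. With T the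
  identity it is a change of basis, with C = D a product of matrices.\<close>

lemma representation_linear_image:
  assumes "independent C" "finite C" "independent D" "lin T"
    and "\<And>c. c \<in> C \<Longrightarrow> T c \<in> span D" and v: "v \<in> span C"
  shows "representation D (T v) b
    = (\<Sum>c\<in>C. representation C v c * representation D (T c) b)"
proof -
  have "T v = T (\<Sum>c\<in>C. representation C v c *s c)"
    using assms sum_representation_eq[of C v C] by simp
  also have "\<dots> = (\<Sum>c\<in>C. representation C v c *s T c)"
    using assms by (simp add: lin_sum lin_scale)
  finally have "representation D (T v)
      = (\<lambda>b. \<Sum>c\<in>C. representation D (representation C v c *s T c) b)"
    using assms by (simp add: representation_sum span_scale)
  then show ?thesis
    using assms by (simp add: representation_scale)
qed

definition trace_wrt :: "'b set \<Rightarrow> ('b \<Rightarrow> 'b) \<Rightarrow> 'a" where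
  "trace_wrt C T = (\<Sum>c\<in>C. representation C (T c) c)"

lemma trace_wrt_commute:
  assumes "independent C" "finite C" "lin A" "lin B"
    and "\<And>c. c \<in> C \<Longrightarrow> A c \<in> span C" "\<And>c. c \<in> C \<Longrightarrow> B c \<in> span C"
  shows "trace_wrt C (\<lambda>x. A (B x)) = trace_wrt C (\<lambda>x. B (A x))"
proof -
  have "trace_wrt C (\<lambda>x. A (B x))
      = (\<Sum>c\<in>C. \<Sum>d\<in>C. representation C (B c) d * representation C (A d) c)"
    using assms unfolding trace_wrt_def
    by (intro sum.cong refl representation_linear_image) auto
  also have "\<dots> = (\<Sum>d\<in>C. \<Sum>c\<in>C. representation C (A d) c * representation C (B c) d)"
    by (subst sum.swap) (simp add: mult.commute)
  also have "\<dots> = trace_wrt C (\<lambda>x. B (A x))"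
    using assms unfolding trace_wrt_def
    by (intro sum.cong refl representation_linear_image[symmetric]) auto
  finally show ?thesis .
qed

text \<open>Expanding T c in D and every d back in C turns both traces into the same double
  sum.\<close>

lemma trace_wrt_basis_change:
  assumes C: "independent C" "finite C" and D: "independent D" "finite D"
    and CD: "span C = span D" and T: "lin T" "\<And>c. c \<in> C \<Longrightarrow> T c \<in> span C"
  shows "trace_wrt C T = trace_wrt D T"
proof -
  have TD: "T x \<in> span C" if "x \<in> span C" for x
    using T that by (intro lin_span_mem[OF T(1) T(2)]) auto
  have "trace_wrt C T = (\<Sum>c\<in>C. \<Sum>d\<in>D. representation D (T c) d * representation C d c)"
    unfolding trace_wrt_def
    using representation_linear_image[OF D C(1), of "\<lambda>x. x"] CD T
    by (intro sum.cong refl) (auto simp: linI span_base)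
  also have "\<dots> = (\<Sum>d\<in>D. \<Sum>c\<in>C. representation C d c * representation D (T c) d)"
    by (subst sum.swap) (simp add: mult.commute)
  also have "\<dots> = trace_wrt D T"
    using T CD C D unfolding trace_wrt_def
    by (intro sum.cong refl representation_linear_image[symmetric]) (auto simp: span_base)
  finally show ?thesis .
qed

text \<open>The operators live on the whole space and are restricted to varying subspaces, so the
  trace refers to some basis of V. By \<open>trace_on_eq\<close> the choice is immaterial as soon as
  T is linear and preserves V.\<close>

definition trace_on :: "'b set \<Rightarrow> ('b \<Rightarrow> 'b) \<Rightarrow> 'a" where
  "trace_on V T = trace_wrt (SOME C. independent C \<and> span C = V) T"

lemma subspace_basis:
  assumes "subspace V"
  obtains C where "independent C" "span C = V" "\<And>c. c \<in> C \<Longrightarrow> c \<in> V"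
  using assms basis_exists[of V] by (metis span_base span_eq_iff span_mono subset_antisym)

lemma trace_on_eq:
  assumes C: "independent C" "span C = V" and T: "lin T" "\<And>x. x \<in> V \<Longrightarrow> T x \<in> V"
  shows "trace_on V T = trace_wrt C T"
proof -
  let ?D = "SOME C. independent C \<and> span C = V"
  have D: "independent ?D \<and> span ?D = V" by (rule someI[of _ C]) (use C in auto)
  show ?thesis unfolding trace_on_def
    by (rule trace_wrt_basis_change)
      (use C D T in \<open>auto simp: finiteI_independent intro: span_base\<close>)
qed

lemma trace_on_commute:
  assumes "subspace V" "lin A" "lin B"
    and "\<And>x. x \<in> V \<Longrightarrow> A x \<in> V" "\<And>x. x \<in> V \<Longrightarrow> B x \<in> V"
  shows "trace_on V (\<lambda>x. A (B x)) = trace_on V (\<lambda>x. B (A x))"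
proof -
  obtain C where C: "independent C" "span C = V" and CV: "\<And>c. c \<in> C \<Longrightarrow> c \<in> V"
    using subspace_basis assms by blast
  have "lin (\<lambda>x. A (B x))" "lin (\<lambda>x. B (A x))"
    using assms by (auto intro!: linI simp: lin_add lin_scale)
  then show ?thesis
    using assms C
    by (simp add: trace_on_eq[OF C] finiteI_independent CV trace_wrt_commute)
qed

lemma trace_on_add:
  assumes "subspace V" "lin A" "lin B"
    and "\<And>x. x \<in> V \<Longrightarrow> A x \<in> V" "\<And>x. x \<in> V \<Longrightarrow> B x \<in> V"
  shows "trace_on V (\<lambda>x. A x + B x) = trace_on V A + trace_on V B"
proof -
  obtain C where C: "independent C" "span C = V" and CV: "\<And>c. c \<in> C \<Longrightarrow> c \<in> V"
    using subspace_basis assms by blast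
  have "lin (\<lambda>x. A x + B x)"
    using assms by (auto intro!: linI simp: lin_add lin_scale algebra_simps)
  then show ?thesis
    using assms C by (simp add: trace_on_eq[OF C] trace_wrt_def representation_add
        sum.distrib subspace_add CV)
qed

lemma trace_on_scale:
  assumes "subspace V" "lin A" "\<And>x. x \<in> V \<Longrightarrow> A x \<in> V"
  shows "trace_on V (\<lambda>x. c *s A x) = c * trace_on V A"
proof -
  obtain C where C: "independent C" "span C = V" and CV: "\<And>c. c \<in> C \<Longrightarrow> c \<in> V"
    using subspace_basis assms by blast
  have "lin (\<lambda>x. c *s A x)"
    using assms by (auto intro!: linI simp: lin_add lin_scale algebra_simps)
  then show ?thesis
    using assms C by (simp add: trace_on_eq[OF C] trace_wrt_def representation_scale
        sum_distrib_left subspace_scale CV)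
qed

lemma trace_on_id:
  assumes "subspace V"
  shows "trace_on V (\<lambda>x. x) = of_nat (dim V)"
proof -
  obtain C where C: "independent C" "span C = V" and CV: "\<And>c. c \<in> C \<Longrightarrow> c \<in> V"
    using subspace_basis assms by blast
  have "trace_wrt C (\<lambda>x. x) = of_nat (card C)"
    using C by (simp add: trace_wrt_def representation_basis)
  then show ?thesis
    using C by (simp add: trace_on_eq[OF C] linI dim_span_eq_card_independent[symmetric])
qed

text \<open>If N mapped V onto itself, all powers would do so too, although one of them vanishes on
  V.\<close>

lemma nilpotent_image_psubset:
  assumes V: "subspace V" "V \<noteq> {0}" and N: "lin N" "\<And>x. x \<in> V \<Longrightarrow> N x \<in> V"
    and nil: "\<And>x. x \<in> V \<Longrightarrow> \<exists>n. (N ^^ n) x = 0"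
  shows "N ` V \<subset> V"
proof (rule ccontr)
  assume "\<not> N ` V \<subset> V"
  then have surj: "N ` V = V" using N by auto
  obtain C where C: "independent C" "span C = V" by (rule subspace_basis[OF V(1)])
  obtain m where m: "\<And>c. c \<in> C \<Longrightarrow> (N ^^ m c) c = 0" using nil C span_base by metis
  have fin: "finite C" using C by (simp add: finiteI_independent)
  \<comment> \<open>Nilpotency is given vector by vector; the maximum over a finite basis is an
    exponent valid on all of V.\<close>
  define n where "n = Max (insert (0::nat) (m ` C))"
  have "(N ^^ n) c = 0" if "c \<in> C" for c
  proof -
    have "m c \<le> n" using fin that by (auto simp: n_def intro!: Max_ge)
    then have "(N ^^ n) c = (N ^^ (n - m c)) ((N ^^ m c) c)"
      by (simp flip: funpow_add comp_apply[of "N ^^ (n - m c)"])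
    then show ?thesis using m that N by (simp add: lin_funpow lin_zero)
  qed
  then have zero: "(N ^^ n) x = 0" if "x \<in> V" for x
    using lin_span_mem[OF lin_funpow[OF N(1)], where C = C and V = "{0}"] C that by auto
  have "(N ^^ k) ` V = V" for k
  proof (induction k)
    case (Suc k)
    have "(N ^^ Suc k) ` V = N ` (N ^^ k) ` V" by (simp add: image_comp)
    then show ?case using Suc surj by simp
  qed simp
  then have "V \<subseteq> {0}" using zero by (metis image_subset_iff singletonI order_refl)
  then show False using V subspace_0 by blast
qed

text \<open>In a basis of V extending one of N V, the diagonal entries at the added vectors vanish
  because N maps into the span of the old ones. The trace is therefore that on N V, which has
  smaller dimension.\<close>

lemma trace_on_nilpotent:
  assumes "subspace V" and "lin N" "\<And>x. x \<in> V \<Longrightarrow> N x \<in> V"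
    and "\<And>x. x \<in> V \<Longrightarrow> \<exists>n. (N ^^ n) x = 0"
  shows "trace_on V N = 0"
  using assms
proof (induction "dim V" arbitrary: V rule: less_induct)
  case less
  show ?case
  proof (cases "V = {0}")
    case True
    then show ?thesis
      using less.prems trace_on_eq[of "{}" V N] by (auto simp: trace_wrt_def independent_empty)
  next
    case False
    note V = less.prems
    have ps: "N ` V \<subset> V" by (rule nilpotent_image_psubset) (use False V in auto)
    have sub: "subspace (N ` V)"
      using V(1,2) by (simp add: linear_iff_module_hom module_hom.subspace_image)
    have lt: "dim (N ` V) < dim V"
      using ps sub V(1) by (metis dim_psubset span_eq_iff)
    obtain D where D: "independent D" "span D = N ` V" by (rule subspace_basis[OF sub])
    have DV: "D \<subseteq> V" using D ps span_superset by blast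
    obtain D' where D': "D \<subseteq> D'" "D' \<subseteq> V" "independent D'" "V \<subseteq> span D'"
      using maximal_independent_subset_extend[OF DV D(1)] by metis
    have spD': "span D' = V" using D' V(1) by (simp add: span_minimal subset_antisym)
    have fin: "finite D'" using D' by (simp add: finiteI_independent)
    have rep: "representation D' (N d) = representation D (N d)" if "d \<in> D'" for d
      using D' D that V by (intro representation_extend) auto
    have "trace_on V N = (\<Sum>d\<in>D'. representation D (N d) d)"
      using D' V spD' rep by (simp add: trace_on_eq trace_wrt_def)
    also have "\<dots> = (\<Sum>d\<in>D. representation D (N d) d)"
      using D' fin by (intro sum.mono_neutral_right) (auto dest: representation_ne_zero)
    also have "\<dots> = trace_on (N ` V) N"
      using D V ps by (subst trace_on_eq[OF D]) (auto simp: trace_wrt_def)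
    also have "\<dots> = 0" using less.hyps[OF lt sub] V ps by blast
    finally show ?thesis .
  qed
qed

text \<open>T - c is nilpotent on V and contributes no trace. On a weight space this recovers the
  weight from a trace.\<close>

lemma trace_on_single_eigenvalue:
  assumes "subspace V" and "lin T" "\<And>x. x \<in> V \<Longrightarrow> T x \<in> V"
    and "\<And>x. x \<in> V \<Longrightarrow> \<exists>n. ((\<lambda>x. T x - c *s x) ^^ n) x = 0"
  shows "trace_on V T = c * of_nat (dim V)"
proof -
  let ?N = "\<lambda>x. T x - c *s x"
  have N: "lin ?N" "\<And>x. x \<in> V \<Longrightarrow> ?N x \<in> V"
    using assms by (auto intro!: linI simp: lin_add lin_scale algebra_simps subspace_diff
        subspace_scale)
  have "trace_on V T = trace_on V (\<lambda>x. ?N x + c *s x)" by simp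
  also have "\<dots> = trace_on V ?N + trace_on V (\<lambda>x. c *s x)"
    using assms N by (intro trace_on_add) (auto intro!: linI simp: algebra_simps subspace_scale)
  also have "trace_on V ?N = 0" using assms N by (intro trace_on_nilpotent) auto
  also have "trace_on V (\<lambda>x. c *s x) = c * trace_on V (\<lambda>x. x)"
    using assms by (intro trace_on_scale) (auto intro!: linI)
  finally show ?thesis using assms by (simp add: trace_on_id)
qed

text \<open>Bases of the summands unite to a basis of the sum in which T is block diagonal.\<close>

lemma trace_on_family_sum:
  assumes I: "finite I" and V: "\<And>i. i \<in> I \<Longrightarrow> subspace (V i)" and dir: "direct_family I V"
    and T: "lin T" "\<And>i x. i \<in> I \<Longrightarrow> x \<in> V i \<Longrightarrow> T x \<in> V i"
  shows "trace_on (family_sum I V) T = (\<Sum>i\<in>I. trace_on (V i) T)"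
proof -
  have "\<forall>i\<in>I. \<exists>C. independent C \<and> span C = V i" using V subspace_basis by metis
  then obtain C where C: "\<And>i. i \<in> I \<Longrightarrow> independent (C i)" "\<And>i. i \<in> I \<Longrightarrow> span (C i) = V i"
    by metis
  have fin: "finite (C i)" if "i \<in> I" for i using C that by (simp add: finiteI_independent)
  have CV: "c \<in> V i" if "i \<in> I" "c \<in> C i" for i c using C that span_base by blast
  have V0: "0 \<in> V i" if "i \<in> I" for i using V that subspace_0 by blast
  have disj: "C i \<inter> C j = {}" if ij: "i \<in> I" "j \<in> I" "i \<noteq> j" for i j
  proof (rule ccontr)
    assume "C i \<inter> C j \<noteq> {}"
    then obtain c where c: "c \<in> C i" "c \<in> C j" by auto
    \<comment> \<open>A basis vector common to two summands, taken once with each sign, would be a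
      nontrivial relation.\<close>
    let ?s = "\<lambda>k. if k = i then c else if k = j then - c else 0"
    have "(\<Sum>k\<in>I. ?s k) = (\<Sum>k\<in>{i,j}. ?s k)"
      using ij I by (intro sum.mono_neutral_right) auto
    also have "\<dots> = 0" using ij by simp
    finally have "?s i = 0"
      using ij c CV V V0 by (intro direct_familyD[OF dir, where s = ?s]) (auto simp: subspace_neg)
    then have "c = 0" by simp
    then show False using c C ij dependent_zero by blast
  qed
  let ?U = "\<Union>i\<in>I. C i"
  have sumU: "(\<Sum>c\<in>?U. f c) = (\<Sum>i\<in>I. \<Sum>c\<in>C i. f c)" for f :: "'b \<Rightarrow> 'z::comm_monoid_add"
    using I fin disj by (intro sum.UNION_disjoint) auto
  have ind: "independent ?U"
  proof (rule independent_if_scalars_zero)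
    fix f c assume z: "(\<Sum>x\<in>?U. f x *s x) = 0" and "c \<in> ?U"
    then obtain i where i: "i \<in> I" "c \<in> C i" by auto
    have "(\<Sum>i\<in>I. \<Sum>c\<in>C i. f c *s c) = 0" using z by (simp add: sumU)
    moreover have "(\<Sum>c\<in>C i. f c *s c) \<in> V i" if "i \<in> I" for i
      using that V CV by (intro subspace_sum subspace_scale) auto
    ultimately have "(\<Sum>c\<in>C i. f c *s c) = 0"
      using i direct_familyD[OF dir, of "\<lambda>i. \<Sum>c\<in>C i. f c *s c"] by blast
    then show "f c = 0" using C i fin independentD by blast
  qed (use fin I in auto)
  have spn: "span ?U = family_sum I V"
  proof
    show "span ?U \<subseteq> family_sum I V"
      using V I V0 CV by (intro span_minimal subspace_family_sum) (auto intro: family_sum_mem)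
    show "family_sum I V \<subseteq> span ?U"
    proof
      fix x assume "x \<in> family_sum I V"
      then obtain s where s: "\<And>i. i \<in> I \<Longrightarrow> s i \<in> V i" "x = (\<Sum>i\<in>I. s i)"
        by (auto elim!: family_sumE)
      have "s i \<in> span ?U" if "i \<in> I" for i
        using s C that span_mono[of "C i" ?U] by auto
      then show "x \<in> span ?U" unfolding s(2) by (intro span_sum) auto
    qed
  qed
  have stab: "T x \<in> family_sum I V" if x: "x \<in> family_sum I V" for x
  proof -
    obtain s where s: "\<And>i. i \<in> I \<Longrightarrow> s i \<in> V i" "x = (\<Sum>i\<in>I. s i)"
      using x by (auto elim!: family_sumE)
    then show ?thesis using T by (auto simp: lin_sum intro!: family_sumI)
  qed
  have "trace_on (family_sum I V) T = (\<Sum>i\<in>I. \<Sum>c\<in>C i. representation ?U (T c) c)"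
    using trace_on_eq[OF ind spn T(1) stab] by (simp add: trace_wrt_def sumU)
  also have "\<dots> = (\<Sum>i\<in>I. \<Sum>c\<in>C i. representation (C i) (T c) c)"
  proof (intro sum.cong refl)
    fix i c assume ic: "i \<in> I" "c \<in> C i"
    have "T c \<in> span (C i)" using C CV T ic by auto
    then have "representation ?U (T c) = representation (C i) (T c)"
      using ic ind by (intro representation_extend) auto
    then show "representation ?U (T c) c = representation (C i) (T c) c" by simp
  qed
  also have "\<dots> = (\<Sum>i\<in>I. trace_on (V i) T)"
    using C T by (intro sum.cong refl) (simp add: trace_on_eq[OF C] trace_wrt_def)
  finally show ?thesis .
qed

end

section \<open>Generalised eigenspaces\<close>

context finite_dimensional_vector_space
begin

definition gen_eig :: "('b \<Rightarrow> 'b) \<Rightarrow> 'a \<Rightarrow> 'b set" where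
  "gen_eig T c = {x. \<exists>n. ((\<lambda>x. T x - c *s x) ^^ n) x = 0}"

lemma lin_shift: "lin T \<Longrightarrow> lin (\<lambda>x. T x - c *s x)"
  by (auto intro!: linI simp: lin_add lin_scale algebra_simps)

lemma funpow_zero_mono:
  assumes "lin T" "(T ^^ n) x = 0" "n \<le> m"
  shows "(T ^^ m) x = 0"
proof -
  have "(T ^^ m) x = (T ^^ (m - n)) ((T ^^ n) x)"
    using assms(3) by (simp flip: funpow_add comp_apply[of "T ^^ (m - n)"])
  then show ?thesis using assms by (simp add: lin_funpow lin_zero)
qed

lemma subspace_gen_eig:
  assumes "lin T"
  shows "subspace (gen_eig T c)"
proof (rule subspaceI)
  let ?N = "\<lambda>x. T x - c *s x"
  note N = lin_shift[OF assms, of c]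
  show "0 \<in> gen_eig T c" by (auto simp: gen_eig_def intro!: exI[of _ 0])
  fix x y assume "x \<in> gen_eig T c" "y \<in> gen_eig T c"
  then obtain n m where "(?N ^^ n) x = 0" "(?N ^^ m) y = 0" by (auto simp: gen_eig_def)
  then have "(?N ^^ (max n m)) (x + y) = 0"
    using N by (simp add: lin_funpow lin_add funpow_zero_mono[OF N, where m = "max n m"])
  then show "x + y \<in> gen_eig T c" by (auto simp: gen_eig_def)
next
  fix a x assume "x \<in> gen_eig T c"
  then obtain n where "((\<lambda>x. T x - c *s x) ^^ n) x = 0" by (auto simp: gen_eig_def)
  then have "((\<lambda>x. T x - c *s x) ^^ n) (a *s x) = 0"
    using lin_shift[OF assms] by (simp add: lin_funpow lin_scale)
  then show "a *s x \<in> gen_eig T c" by (auto simp: gen_eig_def)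
qed

lemma gen_eig_shift: "T x - c *s x \<in> gen_eig T c \<longleftrightarrow> x \<in> gen_eig T c" if "lin T"
proof
  assume "T x - c *s x \<in> gen_eig T c"
  then obtain n where "((\<lambda>x. T x - c *s x) ^^ Suc n) x = 0"
    by (auto simp: gen_eig_def funpow_Suc_right simp del: funpow.simps)
  then show "x \<in> gen_eig T c" unfolding gen_eig_def by blast
next
  assume "x \<in> gen_eig T c"
  then obtain n where "((\<lambda>x. T x - c *s x) ^^ n) x = 0" by (auto simp: gen_eig_def)
  then have "((\<lambda>x. T x - c *s x) ^^ Suc n) x = 0"
    using that by (simp add: lin_zero)
  then show "T x - c *s x \<in> gen_eig T c"
    by (auto simp: gen_eig_def funpow_Suc_right simp del: funpow.simps)
qed

lemma gen_eig_stable: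
  assumes "lin T" "x \<in> gen_eig T c"
  shows "T x \<in> gen_eig T c"
proof -
  have "(T x - c *s x) + c *s x \<in> gen_eig T c"
    using assms gen_eig_shift subspace_gen_eig by (intro subspace_add subspace_scale) auto
  then show ?thesis by simp
qed

text \<open>T - c is invertible on a generalised eigenspace for another eigenvalue. The induction
  runs over the power of T - d that kills u, so the result stays inside the T-stable subspace
  V.\<close>

lemma gen_eig_solve:
  assumes T: "lin T" and V: "subspace V" "\<And>x. x \<in> V \<Longrightarrow> T x \<in> V"
    and dc: "d \<noteq> c" and u: "u \<in> gen_eig T d" "u \<in> V"
  shows "\<exists>w. w \<in> gen_eig T d \<and> w \<in> V \<and> T w - c *s w = u"
proof -
  obtain n where "((\<lambda>x. T x - d *s x) ^^ n) u = 0" using u by (auto simp: gen_eig_def)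
  then show ?thesis using u(2)
  proof (induction n arbitrary: u)
    case 0
    then show ?case
      using subspace_0[OF V(1)] subspace_0[OF subspace_gen_eig[OF T, of d]] lin_zero[OF T]
      by (intro exI[of _ 0]) auto
  next
    case (Suc n)
    let ?u' = "T u - d *s u"
    have "?u' \<in> V" using Suc V by (auto intro: subspace_diff subspace_scale)
    moreover have "((\<lambda>x. T x - d *s x) ^^ n) ?u' = 0"
      using Suc.prems by (simp add: funpow_Suc_right del: funpow.simps)
    ultimately obtain w where w: "w \<in> gen_eig T d" "w \<in> V" "T w - c *s w = ?u'"
      using Suc.IH by blast
    have ud: "u \<in> gen_eig T d" using Suc.prems unfolding gen_eig_def by blast
    \<comment> \<open>Applying T - c to u - w gives (T - c) u - (T - d) u = (d - c) u, whence the
      normalising factor.\<close>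
    let ?w = "inverse (d - c) *s (u - w)"
    have "T ?w - c *s ?w = inverse (d - c) *s ((T u - T w) - c *s (u - w))"
      using T by (simp add: lin_scale lin_diff scale_right_diff_distrib) (simp add: mult.commute)
    also have "(T u - T w) - c *s (u - w) = (T u - c *s u) - ?u'"
      using w(3) by (simp add: algebra_simps)
    also have "\<dots> = (d - c) *s u" by (simp add: algebra_simps)
    also have "inverse (d - c) *s \<dots> = u" using dc by simp
    finally have "T ?w - c *s ?w = u" .
    moreover have "?w \<in> gen_eig T d" "?w \<in> V"
      using w ud Suc.prems V subspace_gen_eig[OF T, of d]
      by (auto intro!: subspace_scale subspace_diff)
    ultimately show ?case by blast
  qed
qed

text \<open>Induction on n reduces to a genuine eigenvector for d, on which (T - c)^m is
  multiplication by (d - c)^m.\<close>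

lemma gen_eig_inter:
  assumes "lin T" "c \<noteq> d" "x \<in> gen_eig T c" "((\<lambda>x. T x - d *s x) ^^ n) x = 0"
  shows "x = 0"
  using assms(3,4)
proof (induction n arbitrary: x)
  case (Suc n)
  let ?y = "T x - d *s x"
  have "?y = 0"
  proof (rule Suc.IH)
    show "?y \<in> gen_eig T c"
      using Suc.prems gen_eig_stable subspace_gen_eig assms(1)
      by (intro subspace_diff subspace_scale) auto
    show "((\<lambda>x. T x - d *s x) ^^ n) ?y = 0"
      using Suc.prems by (simp add: funpow_Suc_right del: funpow.simps)
  qed
  then have Tx: "T x = d *s x" by simp
  obtain m where m: "((\<lambda>x. T x - c *s x) ^^ m) x = 0" using Suc.prems by (auto simp: gen_eig_def)
  have "((\<lambda>x. T x - c *s x) ^^ m) x = (d - c) ^ m *s x"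
  proof (induction m)
    case (Suc m)
    then show ?case using Tx assms(1) by (simp add: lin_scale algebra_simps)
  qed simp
  then show ?case using m assms(2) by simp
qed simp

subsection \<open>Decomposition into generalised eigenvectors\<close>

definition poly_op :: "'a poly \<Rightarrow> ('b \<Rightarrow> 'b) \<Rightarrow> 'b \<Rightarrow> 'b" where
  "poly_op p T v = (\<Sum>i\<le>degree p. coeff p i *s (T ^^ i) v)"

lemma poly_op_bound: "degree p \<le> n \<Longrightarrow> poly_op p T v = (\<Sum>i\<le>n. coeff p i *s (T ^^ i) v)"
  unfolding poly_op_def by (rule sum.mono_neutral_left) (auto simp: coeff_eq_0)

text \<open>The linear factor acts on the vector, so removing a root of an annihilating polynomial
  replaces v by (T - c) v and lowers the degree.\<close>

lemma poly_op_linear_factor: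
  assumes "lin T"
  shows "poly_op ([:- c, 1:] * q) T v = poly_op q T (T v - c *s v)"
proof -
  let ?n = "degree q"
  have "degree ([:- c, 1:] * q) \<le> Suc ?n" by (rule order.trans[OF degree_mult_le]) simp
  then have "poly_op ([:- c, 1:] * q) T v
      = (\<Sum>i\<le>Suc ?n. coeff ([:- c, 1:] * q) i *s (T ^^ i) v)"
    by (rule poly_op_bound)
  also have "\<dots> = (\<Sum>i\<le>Suc ?n. coeff (pCons 0 q) i *s (T ^^ i) v)
      - (\<Sum>i\<le>Suc ?n. (c * coeff q i) *s (T ^^ i) v)"
    by (simp add: algebra_simps sum.distrib sum_subtractf del: sum.atMost_Suc)
  also have "(\<Sum>i\<le>Suc ?n. coeff (pCons 0 q) i *s (T ^^ i) v)
      = (\<Sum>i\<le>?n. coeff q i *s (T ^^ i) (T v))"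
    by (subst sum.atMost_Suc_shift) (simp add: funpow_swap1)
  also have "(\<Sum>i\<le>Suc ?n. (c * coeff q i) *s (T ^^ i) v)
      = (\<Sum>i\<le>?n. (c * coeff q i) *s (T ^^ i) v)"
    by (simp add: coeff_eq_0)
  also have "(\<Sum>i\<le>?n. coeff q i *s (T ^^ i) (T v)) - (\<Sum>i\<le>?n. (c * coeff q i) *s (T ^^ i) v)
      = poly_op q T (T v - c *s v)"
    using assms unfolding poly_op_def
    by (simp add: lin_diff lin_funpow lin_scale scale_right_diff_distrib sum_subtractf mult.commute)
  finally show ?thesis .
qed

text \<open>Among the first dim + 1 iterates of v there is a linear relation. Dependence is a notion
  for sets, so coinciding iterates are treated apart, with a difference of two monomials as the
  annihilating polynomial.\<close>

lemma annihilating_poly_exists: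
  assumes "lin T"
  shows "\<exists>p. p \<noteq> 0 \<and> poly_op p T v = 0"
proof -
  let ?N = "card Basis" and ?f = "\<lambda>i. (T ^^ i) v"
  show ?thesis
  proof (cases "inj_on ?f {..?N}")
    case False
    then obtain i j where ij: "i \<noteq> j" "?f i = ?f j" by (auto simp: inj_on_def)
    let ?p = "monom 1 i - monom 1 j :: 'a poly"
    have "coeff ?p i = 1" using ij by simp
    then have "?p \<noteq> 0" by (metis coeff_0 zero_neq_one)
    moreover have "poly_op ?p T v = 0"
    proof -
      have "degree ?p \<le> i + j" by (intro degree_diff_le order.trans[OF degree_monom_le]) auto
      then have "poly_op ?p T v = (\<Sum>k\<le>i+j. coeff ?p k *s ?f k)" by (rule poly_op_bound)
      also have "\<dots> = (\<Sum>k\<le>i+j. if k = i then ?f k else 0) - (\<Sum>k\<le>i+j. if k = j then ?f k else 0)"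
        by (simp only: flip: sum_subtractf) (auto intro!: sum.cong simp: algebra_simps)
      also have "\<dots> = 0" using ij by simp
      finally show ?thesis .
    qed
    ultimately show ?thesis by blast
  next
    case True
    then have "card (?f ` {..?N}) = Suc ?N" by (simp add: card_image)
    then have "dependent (?f ` {..?N})"
      using independent_card_le_dim[of "?f ` {..?N}" UNIV] by auto
    then obtain u where u: "\<exists>w\<in>?f ` {..?N}. u w \<noteq> 0" "(\<Sum>w\<in>?f ` {..?N}. u w *s w) = 0"
      by (subst (asm) dependent_finite) auto
    let ?p = "\<Sum>i\<le>?N. monom (u (?f i)) i"
    have c: "coeff ?p i = (if i \<le> ?N then u (?f i) else 0)" for i
      by (simp add: coeff_sum)
    have "?p \<noteq> 0" using u(1) c by (metis (no_types, lifting) atMost_iff coeff_0 imageE)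
    moreover have "poly_op ?p T v = 0"
    proof -
      have "degree ?p \<le> ?N" by (rule degree_le) (simp add: c)
      then have "poly_op ?p T v = (\<Sum>k\<le>?N. coeff ?p k *s ?f k)" by (rule poly_op_bound)
      also have "\<dots> = (\<Sum>k\<le>?N. u (?f k) *s ?f k)" by (intro sum.cong) (auto simp: c)
      also have "\<dots> = 0" using u(2) True by (simp add: sum.reindex)
      finally show ?thesis .
    qed
    ultimately show ?thesis by blast
  qed
qed

text \<open>Induction on the degree of a polynomial annihilating v: after splitting off a root c,
  the vector (T - c) v lies in the span. Solving (T - c) w = (T - c) v there, up to the c-component,
  puts w - v into the generalised eigenspace of c.\<close>

lemma span_gen_eig:
  assumes split: "\<And>p :: 'a poly. degree p > 0 \<Longrightarrow> \<exists>c. poly p c = 0"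
    and T: "lin T" and V: "subspace V" "\<And>x. x \<in> V \<Longrightarrow> T x \<in> V" and v: "v \<in> V"
  shows "v \<in> span (\<Union>c. gen_eig T c \<inter> V)"
proof -
  let ?S = "span (\<Union>c. gen_eig T c \<inter> V)"
  have SV: "?S \<subseteq> V" using V by (intro span_minimal) auto
  have inc: "gen_eig T c \<inter> V \<subseteq> ?S" for c by (auto intro: span_base)
  \<comment> \<open>On the span of generalised eigenvectors T - c is surjective modulo its own
    generalised eigenspace, since it is invertible on all the others.\<close>
  have solve: "\<exists>w\<in>?S. T w - c *s w - u \<in> gen_eig T c \<inter> V" if "u \<in> ?S" for c u
    using that
  proof (induction rule: span_induct_alt)
    case base
    show ?case
      using subspace_0[OF V(1)] subspace_0[OF subspace_gen_eig[OF T]] lin_zero[OF T] span_zero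
      by (intro bexI[of _ 0]) auto
  next
    case (step a x y)
    obtain d where x: "x \<in> gen_eig T d" "x \<in> V" using step by auto
    have "\<exists>w\<in>?S. T w - c *s w - x \<in> gen_eig T c \<inter> V"
    proof (cases "d = c")
      case True
      then have "T 0 - c *s 0 - x \<in> gen_eig T c \<inter> V"
        using x V(1) lin_zero[OF T] by (auto intro!: subspace_neg subspace_gen_eig T)
      then show ?thesis using span_zero by blast
    next
      case False
      then obtain w where "w \<in> gen_eig T d" "w \<in> V" "T w - c *s w = x"
        using gen_eig_solve[OF T V False x] by blast
      then show ?thesis
        using inc subspace_0[OF V(1)] subspace_0[OF subspace_gen_eig[OF T]]
        by (intro bexI[of _ w]) auto
    qed
    then obtain w where w: "w \<in> ?S" "T w - c *s w - x \<in> gen_eig T c \<inter> V" by blast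
    obtain z where z: "z \<in> ?S" "T z - c *s z - y \<in> gen_eig T c \<inter> V" using step by blast
    have "a *s (T w - c *s w - x) + (T z - c *s z - y) \<in> gen_eig T c \<inter> V"
      using w z V(1) subspace_gen_eig[OF T] by (auto intro!: subspace_add subspace_scale)
    also have "a *s (T w - c *s w - x) + (T z - c *s z - y)
        = T (a *s w + z) - c *s (a *s w + z) - (a *s x + y)"
      using T by (simp add: lin_add lin_scale algebra_simps)
    finally show ?case using w z by (intro bexI[of _ "a *s w + z"]) (auto intro: span_add span_scale)
  qed
  obtain p where "p \<noteq> 0" "poly_op p T v = 0" using annihilating_poly_exists[OF T] by blast
  then show ?thesis using v
  proof (induction "degree p" arbitrary: p v rule: less_induct)
    case less
    show ?case
    proof (cases "degree p = 0")
      case True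
      then obtain a where a: "p = [:a:]" by (auto elim: degree_eq_zeroE)
      then have "v = 0" using less.prems by (simp add: poly_op_def)
      then show ?thesis by (simp add: span_zero)
    next
      case False
      then obtain c where "poly p c = 0" using split by blast
      then obtain q where q: "p = [:- c, 1:] * q" unfolding poly_eq_0_iff_dvd by (rule dvdE)
      then have "q \<noteq> 0" using less.prems by auto
      then have "degree p = Suc (degree q)" using q by (subst q, subst degree_mult_eq) auto
      moreover have "poly_op q T (T v - c *s v) = 0"
        using less.prems q poly_op_linear_factor[OF T] by simp
      moreover have "T v - c *s v \<in> V"
        using less.prems V by (auto intro!: subspace_diff subspace_scale)
      ultimately have "T v - c *s v \<in> ?S" using \<open>q \<noteq> 0\<close> by (intro less.hyps[of q]) simp_all
      then obtain w where w: "w \<in> ?S" "T w - c *s w - (T v - c *s v) \<in> gen_eig T c \<inter> V"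
        using solve by blast
      then have "T (w - v) - c *s (w - v) \<in> gen_eig T c"
        using T by (simp add: lin_diff algebra_simps)
      then have "w - v \<in> gen_eig T c" using gen_eig_shift[OF T] by blast
      moreover have "w - v \<in> V" using w SV less.prems V(1) by (auto intro: subspace_diff)
      ultimately have "w - v \<in> ?S" using inc by blast
      then show ?thesis using w(1) span_diff[of w _ "w - v"] by simp
    qed
  qed
qed

end

section \<open>Weights of a Cartan subalgebra\<close>

text \<open>Each term of the binomial expansion of C^(n + m) carries A at least n times or B at
  least m times. Stated for an abstract biadditive pairing because it serves the bracket, where
  eigenvalues add, as well as the Killing form, where it yields orthogonality.\<close>

lemma leibniz_nilpotent:
  fixes f :: "'a::ab_group_add \<Rightarrow> 'b::ab_group_add \<Rightarrow> 'c::ab_group_add"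
  assumes zero: "\<And>y. f 0 y = 0" "\<And>x. f x 0 = 0"
    and C: "C 0 = 0" "\<And>u v. C (u + v) = C u + C v"
    and leibniz: "\<And>x y. C (f x y) = f (A x) y + f x (B y)"
    and nilpotent: "(A ^^ n) x = 0" "(B ^^ m) y = 0"
  shows "(C ^^ (n + m)) (f x y) = 0"
proof -
  have C_pow: "(C ^^ k) 0 = 0" "(C ^^ k) (u + v) = (C ^^ k) u + (C ^^ k) v" for k u v
    by (induction k) (simp_all add: C)
  have "(C ^^ k) (f x y) = 0" if "(A ^^ n) x = 0" "(B ^^ m) y = 0" "n + m = k" for k n m x y
    using that
  proof (induction k arbitrary: n m x y)
    case (Suc k)
    show ?case
    proof (cases "n = 0 \<or> m = 0")
      case True
      then show ?thesis using Suc.prems zero C C_pow by auto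
    next
      case False
      then obtain n' m' where nm: "n = Suc n'" "m = Suc m'" by (metis not0_implies_Suc)
      have "(C ^^ k) (f (A x) y) = 0"
        using Suc.prems nm
        by (intro Suc.IH[of n' _ m]) (simp_all add: funpow_Suc_right del: funpow.simps)
      moreover have "(C ^^ k) (f x (B y)) = 0"
        using Suc.prems nm
        by (intro Suc.IH[of n _ m']) (simp_all add: funpow_Suc_right del: funpow.simps)
      ultimately show ?thesis
        by (simp add: funpow_Suc_right leibniz C_pow del: funpow.simps)
    qed
  qed (use zero in simp)
  then show ?thesis using nilpotent by blast
qed

context lie_algebra
begin

lemma bracket_zero_left [simp]: "bracket 0 y = 0"
  using bracket_scale_left[of 0 0 y] by simp

lemma bracket_zero_right [simp]: "bracket x 0 = 0"
  using bracket_scale_right[of x 0 0] by simp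

lemma bracket_neg_left: "bracket (- x) y = - bracket x y"
  using bracket_scale_left[of "-1" x y] by simp

lemma bracket_neg_right: "bracket x (- y) = - bracket x y"
  using bracket_scale_right[of x "-1" y] by simp

lemma bracket_diff_left: "bracket (x - y) z = bracket x z - bracket y z"
  using bracket_add_left[of x "- y" z] by (simp add: bracket_neg_left)

lemma bracket_diff_right: "bracket x (y - z) = bracket x y - bracket x z"
  using bracket_add_right[of x y "- z"] by (simp add: bracket_neg_right)

lemma bracket_sum_right: "bracket x (\<Sum>i\<in>I. f i) = (\<Sum>i\<in>I. bracket x (f i))"
  by (induction I rule: infinite_finite_induct) (auto simp: bracket_add_right)

lemma bracket_anti: "bracket x y = - bracket y x"
proof -
  have "bracket x y + bracket y x = bracket (x + y) (x + y)"
    unfolding bracket_add_left bracket_add_right by (simp add: bracket_self)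
  then show ?thesis by (simp add: bracket_self eq_neg_iff_add_eq_0)
qed

lemma bracket_derivation:
  "bracket h (bracket x y) = bracket (bracket h x) y + bracket x (bracket h y)"
proof -
  have "bracket h (bracket x y) - bracket x (bracket h y) - bracket (bracket h x) y = 0"
    using jacobi[of h x y] bracket_anti[of y h] bracket_anti[of y "bracket h x"]
    by (simp add: bracket_neg_right)
  then show ?thesis by (simp add: algebra_simps)
qed

end

context fd_lie_algebra
begin

lemma lin_bracket [intro, simp]: "lin (bracket x)"
  by (rule linI) (auto simp: bracket_add_right bracket_scale_right)

lemma gen_eig_bracket:
  assumes "x \<in> gen_eig (bracket h) a" "y \<in> gen_eig (bracket h) b"
  shows "bracket x y \<in> gen_eig (bracket h) (a + b)"
proof -
  obtain n m where "((\<lambda>x. bracket h x - a *s x) ^^ n) x = 0" "((\<lambda>y. bracket h y - b *s y) ^^ m) y = 0"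
    using assms by (auto simp: gen_eig_def)
  then have "((\<lambda>z. bracket h z - (a + b) *s z) ^^ (n + m)) (bracket x y) = 0"
  proof (intro leibniz_nilpotent[where f = bracket])
    show "bracket h (bracket x y) - (a + b) *s bracket x y
        = bracket (bracket h x - a *s x) y + bracket x (bracket h y - b *s y)" for x y
      by (subst bracket_derivation)
        (simp add: bracket_diff_left bracket_diff_right bracket_scale_left bracket_scale_right
          scale_left_distrib)
  qed (simp_all add: bracket_add_right scale_right_distrib)
  then show ?thesis unfolding gen_eig_def by blast
qed

end

locale cartan_lie_algebra = fd_lie_algebra scale bracket Basis
  for scale :: "'f::{alg_closed_field, field_char_0} \<Rightarrow> 'g::ab_group_add \<Rightarrow> 'g" (infixr \<open>*s\<close> 75)
    and bracket :: "'g \<Rightarrow> 'g \<Rightarrow> 'g"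
    and Basis :: "'g set" +
  fixes H :: "'g set"
  assumes cartan: "cartan_subalgebra H"
begin

lemma subspace_H: "subspace H"
  using cartan by (auto simp: cartan_subalgebra_def lie_subalgebra_def)

lemma bracket_H: "x \<in> H \<Longrightarrow> y \<in> H \<Longrightarrow> bracket x y \<in> H"
  using cartan by (auto simp: cartan_subalgebra_def lie_subalgebra_def)

lemma normalizer_H: "(\<And>h. h \<in> H \<Longrightarrow> bracket h x \<in> H) \<Longrightarrow> x \<in> H"
proof -
  assume *: "\<And>h. h \<in> H \<Longrightarrow> bracket h x \<in> H"
  have "bracket x h \<in> H" if "h \<in> H" for h
    using *[OF that] subspace_neg[OF subspace_H] bracket_anti[of x h] by auto
  then show ?thesis using cartan unfolding cartan_subalgebra_def by blast
qed

abbreviation "L \<equiv> lower_central H"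

lemma L_sub: "L k \<subseteq> H" and subspace_L: "subspace (L k)"
proof -
  have "L k \<subseteq> H \<and> subspace (L k)"
  proof (induction k)
    case 0
    then show ?case using subspace_H by simp
  next
    case (Suc k)
    then have "{bracket x y |x y. x \<in> H \<and> y \<in> L k} \<subseteq> H" using bracket_H by auto
    then show ?case using subspace_H by (simp add: span_minimal)
  qed
  then show "L k \<subseteq> H" "subspace (L k)" by auto
qed

lemma bracket_L: "x \<in> H \<Longrightarrow> y \<in> L k \<Longrightarrow> bracket x y \<in> L (Suc k)"
  by (auto intro: span_base)

lemma L_antimono: "L (Suc k) \<subseteq> L k"
proof (induction k)
  case 0
  then show ?case using L_sub[of 1] by simp
next
  case (Suc k)
  have "{bracket x y |x y. x \<in> H \<and> y \<in> L (Suc k)} \<subseteq> {bracket x y |x y. x \<in> H \<and> y \<in> L k}"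
    using Suc by blast
  then show ?case using span_mono by (subst (1 2) lower_central.simps) blast
qed

lemma L_trivial: obtains n where "L n = {0}"
  using cartan by (auto simp: cartan_subalgebra_def)

lemma ad_nilpotent_H:
  assumes "h \<in> H" "x \<in> H"
  shows "x \<in> gen_eig (bracket h) 0"
proof -
  obtain n where n: "L n = {0}" by (rule L_trivial)
  have "(bracket h ^^ k) x \<in> L k" for k
    by (induction k) (use assms bracket_L in auto)
  then show ?thesis using n by (force simp: gen_eig_def)
qed

section \<open>Generalised weight spaces and the decomposition of the Lie algebra\<close>

definition wsp :: "('g \<Rightarrow> 'f) \<Rightarrow> 'g set" where
  "wsp \<mu> = {x. \<forall>h\<in>H. x \<in> gen_eig (bracket h) (\<mu> h)}"

definition weights :: "('g \<Rightarrow> 'f) set" where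
  "weights = {\<mu>. (\<forall>x. x \<notin> H \<longrightarrow> \<mu> x = 0) \<and> wsp \<mu> \<noteq> {0}}"

lemma wspD: "x \<in> wsp \<mu> \<Longrightarrow> h \<in> H \<Longrightarrow> x \<in> gen_eig (bracket h) (\<mu> h)"
  by (auto simp: wsp_def)

lemma subspace_wsp: "subspace (wsp \<mu>)"
proof -
  have "wsp \<mu> = \<Inter> ((\<lambda>h. gen_eig (bracket h) (\<mu> h)) ` H)" by (auto simp: wsp_def)
  then show ?thesis by (auto intro!: subspace_Inter subspace_gen_eig)
qed

lemma zero_wsp [simp]: "0 \<in> wsp \<mu>"
  using subspace_wsp subspace_0 by blast

lemma bracket_wsp: "x \<in> wsp \<mu> \<Longrightarrow> y \<in> wsp \<nu> \<Longrightarrow> bracket x y \<in> wsp (\<mu> + \<nu>)"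
  by (auto simp: wsp_def gen_eig_bracket)

lemma H_wsp: "H \<subseteq> wsp 0"
  by (auto simp: wsp_def ad_nilpotent_H)

lemma H_stable_wsp: "h \<in> H \<Longrightarrow> x \<in> wsp \<mu> \<Longrightarrow> bracket h x \<in> wsp \<mu>"
  using bracket_wsp[of h 0 x \<mu>] H_wsp by auto

lemma wsp_weight: "x \<in> wsp \<mu> \<Longrightarrow> x \<noteq> 0 \<Longrightarrow> (\<And>x. x \<notin> H \<Longrightarrow> \<mu> x = 0) \<Longrightarrow> \<mu> \<in> weights"
  by (auto simp: weights_def)

lemma weight_outside: "\<mu> \<in> weights \<Longrightarrow> x \<notin> H \<Longrightarrow> \<mu> x = 0"
  by (auto simp: weights_def)

lemma weight_nonzero: "\<mu> \<in> weights \<Longrightarrow> \<exists>v. v \<in> wsp \<mu> \<and> v \<noteq> 0"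
  using zero_wsp[of \<mu>] unfolding weights_def by blast

text \<open>Either every ad h has a single generalised eigenvalue on V, and V lies in one weight
  space, or some ad h splits V into proper pieces. These are again H-stable: H lies in the
  0-eigenspace of ad h, so bracketing with H does not move the eigenvalue.\<close>

lemma span_wsp:
  assumes "subspace V" "\<And>h x. h \<in> H \<Longrightarrow> x \<in> V \<Longrightarrow> bracket h x \<in> V"
  shows "V \<subseteq> span (\<Union>\<mu>\<in>weights. wsp \<mu>)"
  using assms
proof (induction "dim V" arbitrary: V rule: less_induct)
  case less
  show ?case
  proof (cases "\<forall>h\<in>H. \<exists>c. V \<subseteq> gen_eig (bracket h) c")
    case True
    then obtain l where l: "\<And>h. h \<in> H \<Longrightarrow> V \<subseteq> gen_eig (bracket h) (l h)" by metis
    let ?l = "\<lambda>x. if x \<in> H then l x else 0"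
    have V: "V \<subseteq> wsp ?l" using l by (auto simp: wsp_def)
    show ?thesis
    proof
      fix x assume x: "x \<in> V"
      show "x \<in> span (\<Union>\<mu>\<in>weights. wsp \<mu>)"
      proof (cases "x = 0")
        case False
        then have "?l \<in> weights" using V x by (intro wsp_weight[of x]) auto
        then show ?thesis using x V by (intro span_base) blast
      qed (simp add: span_zero)
    qed
  next
    case False
    then obtain h where h: "h \<in> H" "\<And>c. \<not> V \<subseteq> gen_eig (bracket h) c" by blast
    have sub: "gen_eig (bracket h) c \<inter> V \<subseteq> span (\<Union>\<mu>\<in>weights. wsp \<mu>)" for c
    proof (rule less.hyps)
      show s: "subspace (gen_eig (bracket h) c \<inter> V)"
        using less.prems by (intro subspace_inter subspace_gen_eig) auto
      have "gen_eig (bracket h) c \<inter> V \<subset> V" using h(2) by blast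
      then show "dim (gen_eig (bracket h) c \<inter> V) < dim V"
        using s less.prems(1) by (metis dim_psubset span_eq_iff)
      fix k x assume "k \<in> H" "x \<in> gen_eig (bracket h) c \<inter> V"
      then show "bracket k x \<in> gen_eig (bracket h) c \<inter> V"
        using gen_eig_bracket[of k h 0 x c] ad_nilpotent_H h less.prems by auto
    qed
    have "V \<subseteq> span (\<Union>c. gen_eig (bracket h) c \<inter> V)"
      using span_gen_eig[OF alg_closed_imp_poly_has_root] h less.prems by (metis lin_bracket subsetI)
    also have "\<dots> \<subseteq> span (\<Union>\<mu>\<in>weights. wsp \<mu>)"
      using sub by (intro span_minimal) auto
    finally show ?thesis .
  qed
qed

text \<open>For weights j and m that differ at h, a power of ad h - m(h) removes the m-component of
  a relation. The shorter relation kills the image of the j-component, on which that power is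
  injective.\<close>

lemma direct_wsp:
  assumes "finite I" "I \<subseteq> weights"
  shows "direct_family I wsp"
  using assms
proof (induction "card I" arbitrary: I rule: less_induct)
  case less
  show ?case unfolding direct_family_def
  proof (intro allI impI, elim conjE)
    fix s assume s: "\<forall>i\<in>I. s i \<in> wsp i" "(\<Sum>i\<in>I. s i) = 0"
    have z: "s j = 0" if j: "j \<in> I" and m: "m \<in> I" and jm: "j \<noteq> m" for j m
    proof -
      obtain h where h: "h \<in> H" "j h \<noteq> m h"
      proof (rule ccontr)
        assume "\<not> thesis"
        then have "j x = m x" for x
          using that weight_outside[OF subsetD[OF less.prems(2) j], of x]
            weight_outside[OF subsetD[OF less.prems(2) m], of x]
          by (cases "x \<in> H") auto
        then show False using jm by auto
      qed
      let ?A = "\<lambda>x. bracket h x - m h *s x"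
      obtain n where n: "(?A ^^ n) (s m) = 0"
        using s(1) m h wspD[of "s m" m h] by (auto simp: gen_eig_def)
      let ?s = "\<lambda>i. (?A ^^ n) (s i)"
      have lin: "lin (?A ^^ n)" by (intro lin_funpow lin_shift) auto
      have "card (I - {m}) < card I" using less.prems(1) m by (rule card_Diff1_less)
      then have dir: "direct_family (I - {m}) wsp"
        using less.prems by (intro less.hyps) auto
      have "?s j = 0"
      proof (rule direct_familyD[OF dir, where s = ?s])
        show "?s i \<in> wsp i" if "i \<in> I - {m}" for i
          using that s(1) h H_stable_wsp subspace_wsp
          by (intro funpow_mem) (auto intro!: subspace_diff subspace_scale)
        have "(\<Sum>i\<in>I. ?s i) = (?A ^^ n) (\<Sum>i\<in>I. s i)" using lin by (simp add: lin_sum)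
        also have "\<dots> = 0" using lin s(2) by (simp add: lin_zero)
        finally show "(\<Sum>i\<in>I - {m}. ?s i) = 0"
          using n m less.prems by (simp add: sum.remove[of I m])
        show "j \<in> I - {m}" using j jm by auto
      qed
      moreover have "s j \<in> gen_eig (bracket h) (j h)" using s(1) j h wspD by blast
      ultimately show ?thesis using gen_eig_inter[of "bracket h" "j h" "m h"] h by auto
    qed
    show "\<forall>i\<in>I. s i = 0"
    proof
      fix i assume i: "i \<in> I"
      show "s i = 0"
      proof (cases "I = {i}")
        case True
        then show ?thesis using s(2) by simp
      next
        case False
        then show ?thesis using z[of i] i by blast
      qed
    qed
  qed
qed

lemma finite_weights: "finite weights"
proof (rule ccontr)
  assume "infinite weights"
  then obtain I where I: "finite I" "card I = Suc (card Basis)" "I \<subseteq> weights"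
    using infinite_arbitrarily_large by metis
  note dir = direct_wsp[OF I(1,3)]
  have "\<forall>i\<in>I. \<exists>v. v \<in> wsp i \<and> v \<noteq> 0" using I(3) weight_nonzero by blast
  then obtain v where v: "\<And>i. i \<in> I \<Longrightarrow> v i \<in> wsp i" "\<And>i. i \<in> I \<Longrightarrow> v i \<noteq> 0" by metis
  have scal: "c i = 0" if c: "(\<Sum>i\<in>I. c i *s v i) = 0" "i \<in> I" for c i
  proof -
    have "c i *s v i = 0"
      by (rule direct_familyD[OF dir, where s = "\<lambda>i. c i *s v i"])
        (use c v subspace_scale[OF subspace_wsp] in auto)
    then show ?thesis using v c by simp
  qed
  have inj: "inj_on v I"
  proof (rule inj_onI, rule ccontr)
    fix i j assume ij: "i \<in> I" "j \<in> I" "v i = v j" "i \<noteq> j"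
    \<comment> \<open>If two chosen vectors coincide, their difference is a relation with
      coefficient 1 at i.\<close>
    let ?c = "\<lambda>k. (if k = i then 1 else 0) - (if k = j then 1 else 0) :: 'f"
    have "(\<Sum>k\<in>I. ?c k *s v k)
        = (\<Sum>k\<in>I. if k = i then v k else 0) - (\<Sum>k\<in>I. if k = j then v k else 0)"
      by (simp only: flip: sum_subtractf) (auto intro!: sum.cong simp: algebra_simps)
    also have "\<dots> = 0" using ij I by simp
    finally show False using scal[of ?c i] ij by simp
  qed
  have "independent (v ` I)"
  proof (rule independent_if_scalars_zero)
    fix f x assume "(\<Sum>x\<in>v ` I. f x *s x) = 0" "x \<in> v ` I"
    then show "f x = 0" using scal[of "\<lambda>i. f (v i)"] inj by (auto simp: sum.reindex)
  qed (use I in simp)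
  then have "card (v ` I) \<le> card Basis"
    using independent_card_le_dim[of "v ` I" UNIV] by simp
  then show False using inj I by (simp add: card_image)
qed

lemma sum_wsp: "family_sum weights wsp = UNIV"
proof -
  have "span (\<Union>\<mu>\<in>weights. wsp \<mu>) \<subseteq> family_sum weights wsp"
    by (intro span_minimal subspace_family_sum subspace_wsp)
      (auto intro: family_sum_mem finite_weights)
  then show ?thesis using span_wsp[of UNIV] by auto
qed

lemma weight_induct:
  assumes "subspace U" "\<And>\<mu>. \<mu> \<in> weights \<Longrightarrow> wsp \<mu> \<subseteq> U"
  shows "x \<in> U"
proof -
  have "x \<in> family_sum weights wsp" by (simp add: sum_wsp)
  then show ?thesis using assms by (elim family_sumE) (auto intro: subspace_sum)
qed

lemma direct_weights: "I \<subseteq> weights \<Longrightarrow> direct_family I wsp"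
  using direct_wsp finite_weights finite_subset by blast

section \<open>Weights as normalised traces\<close>

lemma trace_on_wsp: "h \<in> H \<Longrightarrow> trace_on (wsp \<mu>) (bracket h) = \<mu> h * of_nat (dim (wsp \<mu>))"
  using wspD H_stable_wsp by (intro trace_on_single_eigenvalue) (auto simp: subspace_wsp gen_eig_def)

lemma trace_on_sum_wsp:
  assumes "h \<in> H" "I \<subseteq> weights"
  shows "trace_on (family_sum I wsp) (bracket h) = (\<Sum>\<mu>\<in>I. \<mu> h * of_nat (dim (wsp \<mu>)))"
  using assms finite_subset[OF _ finite_weights] H_stable_wsp
  by (subst trace_on_family_sum) (auto simp: subspace_wsp trace_on_wsp direct_weights)

lemma trace_on_bracket:
  assumes "subspace V" "\<And>v. v \<in> V \<Longrightarrow> bracket x v \<in> V" "\<And>v. v \<in> V \<Longrightarrow> bracket y v \<in> V"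
  shows "trace_on V (bracket (bracket x y)) = 0"
proof -
  let ?A = "\<lambda>v. bracket x (bracket y v)" and ?B = "\<lambda>v. (-1) *s bracket y (bracket x v)"
  have lin: "lin ?A" "lin (\<lambda>v. bracket y (bracket x v))" "lin ?B"
    by (auto intro!: linI simp: bracket_add_right bracket_scale_right algebra_simps)
  have "bracket (bracket x y) = (\<lambda>v. ?A v + ?B v)"
    using bracket_derivation[of x y] by (auto simp: fun_eq_iff algebra_simps)
  then have "trace_on V (bracket (bracket x y)) = trace_on V ?A + trace_on V ?B"
    using assms lin by (simp only:) (intro trace_on_add, auto intro: subspace_neg)
  also have "trace_on V ?B = - trace_on V (\<lambda>v. bracket y (bracket x v))"
    using assms lin by (subst trace_on_scale) auto
  also have "trace_on V ?A = trace_on V (\<lambda>v. bracket y (bracket x v))"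
    using assms by (intro trace_on_commute) auto
  finally show ?thesis by simp
qed

lemma dim_wsp: "\<mu> \<in> weights \<Longrightarrow> dim (wsp \<mu>) > 0"
  using subspace_wsp[of \<mu>] by (auto simp: weights_def subspace_0)

text \<open>Traces are additive, homogeneous and zero on commutators, and characteristic 0 permits
  division by the dimension of the weight space.\<close>

lemma weight_linear:
  assumes "\<mu> \<in> weights"
  shows weight_add: "x \<in> H \<Longrightarrow> y \<in> H \<Longrightarrow> \<mu> (x + y) = \<mu> x + \<mu> y"
    and weight_scale: "x \<in> H \<Longrightarrow> \<mu> (c *s x) = c * \<mu> x"
    and weight_bracket: "x \<in> H \<Longrightarrow> y \<in> H \<Longrightarrow> \<mu> (bracket x y) = 0"
proof -
  let ?d = "of_nat (dim (wsp \<mu>)) :: 'f"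
  have d: "?d \<noteq> 0" using dim_wsp[OF assms] by (metis less_irrefl of_nat_eq_0_iff)
  have tr: "\<mu> h = trace_on (wsp \<mu>) (bracket h) / ?d" if "h \<in> H" for h
    using trace_on_wsp[OF that, of \<mu>] d by simp
  have st: "\<And>h x. h \<in> H \<Longrightarrow> x \<in> wsp \<mu> \<Longrightarrow> bracket h x \<in> wsp \<mu>" by (rule H_stable_wsp)
  {
    assume xy: "x \<in> H" "y \<in> H"
    have "bracket (x + y) = (\<lambda>v. bracket x v + bracket y v)"
      by (simp add: fun_eq_iff bracket_add_left)
    then have "trace_on (wsp \<mu>) (bracket (x + y))
        = trace_on (wsp \<mu>) (bracket x) + trace_on (wsp \<mu>) (bracket y)"
      using xy st by (simp add: trace_on_add subspace_wsp)
    then show "\<mu> (x + y) = \<mu> x + \<mu> y"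
      using xy subspace_add[OF subspace_H] by (simp add: tr add_divide_distrib)
    have "trace_on (wsp \<mu>) (bracket (bracket x y)) = 0"
      using xy st by (intro trace_on_bracket subspace_wsp)
    then show "\<mu> (bracket x y) = 0"
      using xy bracket_H by (simp add: tr)
  }
  assume x: "x \<in> H"
  have "bracket (c *s x) = (\<lambda>v. c *s bracket x v)" by (simp add: fun_eq_iff bracket_scale_left)
  then have "trace_on (wsp \<mu>) (bracket (c *s x)) = c * trace_on (wsp \<mu>) (bracket x)"
    using x st by (simp add: trace_on_scale subspace_wsp)
  then show "\<mu> (c *s x) = c * \<mu> x" using x subspace_scale[OF subspace_H] by (simp add: tr)
qed

lemma weight_zero: "\<mu> \<in> weights \<Longrightarrow> \<mu> 0 = 0"
  using weight_scale[of \<mu> 0 0] subspace_0[OF subspace_H] by simp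

lemma weight_L: "\<mu> \<in> weights \<Longrightarrow> h \<in> L (Suc k) \<Longrightarrow> \<mu> h = 0"
proof -
  assume l: "\<mu> \<in> weights" and "h \<in> L (Suc k)"
  then have "h \<in> span {bracket x y |x y. x \<in> H \<and> y \<in> L k}" by simp
  also have "\<dots> \<subseteq> {h \<in> H. \<mu> h = 0}"
  proof (rule span_minimal)
    show "{bracket x y |x y. x \<in> H \<and> y \<in> L k} \<subseteq> {h \<in> H. \<mu> h = 0}"
      using L_sub[of k] bracket_H weight_bracket[OF l] by auto
    show "subspace {h \<in> H. \<mu> h = 0}"
      using subspace_H l by (intro subspaceI)
        (auto simp: subspace_0 subspace_add subspace_scale weight_add weight_scale weight_zero)
  qed
  finally show ?thesis by simp
qed

text \<open>Descends the lower central series of \<open>H\<close>: modulo \<open>U\<close>, the elements of \<open>L k\<close> act on the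
  vectors already annihilated by \<open>ad h - \<mu> h\<close> for \<open>h \<in> L (k + 1)\<close> as commuting operators.\<close>

lemma common_eigenvector:
  assumes l: "\<mu> \<in> weights" and U: "subspace U" "\<And>h x. h \<in> H \<Longrightarrow> x \<in> U \<Longrightarrow> bracket h x \<in> U"
    and V: "subspace V" "\<And>h x. h \<in> H \<Longrightarrow> x \<in> V \<Longrightarrow> bracket h x \<in> V"
    and VU: "V \<subseteq> wsp \<mu>" "\<not> V \<subseteq> U"
  shows "\<exists>v\<in>V. v \<notin> U \<and> (\<forall>h\<in>H. bracket h v - \<mu> h *s v \<in> U)"
proof -
  let ?A = "\<lambda>h v. bracket h v - \<mu> h *s v"
  \<comment> \<open>Everything is taken modulo U so that one argument serves two ends: U = {0}
    yields genuine root vectors, U = H a vector normalising H.\<close>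
  define Vk where "Vk X = {v \<in> V. \<forall>h\<in>X. ?A h v \<in> U}" for X
  \<comment> \<open>Commuting x past h costs the term [[h,x],v]. Since \<mu> vanishes at [h,x], that
    term is the defect of v at [h,x], which lies in U by assumption.\<close>
  have stable: "bracket x v \<in> Vk X"
    if x: "x \<in> H" and v: "v \<in> Vk X" and X: "X \<subseteq> H"
      and xX: "\<And>h. h \<in> X \<Longrightarrow> \<mu> (bracket h x) = 0 \<and> ?A (bracket h x) v \<in> U" for x v X
  proof -
    have "?A h (bracket x v) \<in> U" if h: "h \<in> X" for h
    proof -
      have "?A h (bracket x v) = bracket x (?A h v) + bracket (bracket h x) v"
        using bracket_derivation[of h x v]
        by (simp add: bracket_diff_right bracket_scale_right algebra_simps)
      moreover have "bracket x (?A h v) \<in> U" using h v x U by (auto simp: Vk_def)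
      moreover have "bracket (bracket h x) v \<in> U" using xX[OF h] by (metis diff_zero scale_zero_left)
      ultimately show ?thesis using U by (simp add: subspace_add)
    qed
    then show ?thesis using v x V by (auto simp: Vk_def)
  qed
  obtain N where N: "L N = {0}" by (rule L_trivial)
  \<comment> \<open>At the last step of the series the condition is void, so \<open>Vk\<close> is
    all of V; the descent ends at \<open>L 0 = H\<close>.\<close>
  have "k \<le> N \<Longrightarrow> \<not> Vk (L k) \<subseteq> U" for k
  proof (induction rule: inc_induct)
    case base
    have "Vk (L N) = V" using N U by (auto simp: Vk_def weight_zero[OF l] subspace_0)
    then show ?case using VU by simp
  next
    case (step k)
    have LL: "bracket x h \<in> L (Suc k)" if "h \<in> L k" "x \<in> H" for x h
      using that bracket_L by simp
    have LL': "bracket h x \<in> L (Suc k)" if "h \<in> L k" "x \<in> H" for x h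
      using LL[OF that] subspace_neg[OF subspace_L[of "Suc k"]] bracket_anti[of h x] by auto
    obtain C where C: "independent C" "span C = L k" "\<And>c. c \<in> C \<Longrightarrow> c \<in> L k"
      by (rule subspace_basis[OF subspace_L[of k]]) blast
    \<comment> \<open>The passage from \<open>L (Suc k)\<close> to \<open>L k\<close> adjoins one
      basis vector of \<open>L k\<close> at a time.\<close>
    have "finite C" using C by (simp add: finiteI_independent)
    then have "\<not> Vk (L (Suc k) \<union> C) \<subseteq> U" using C(3)
    proof (induction C rule: finite_induct)
      case empty
      then show ?case using step by simp
    next
      case (insert h C)
      let ?X = "L (Suc k) \<union> C"
      have X: "?X \<subseteq> L k" "h \<in> L k" "h \<in> H"
        using insert.prems L_antimono[of k] L_sub[of k] by auto
      obtain v where v: "v \<in> Vk ?X" "v \<notin> U" using insert.IH insert.prems by blast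
      have st: "bracket h w \<in> Vk ?X" if "w \<in> Vk ?X" for w
      proof (rule stable[OF X(3) that])
        show "?X \<subseteq> H" using X L_sub by blast
        fix g assume g: "g \<in> ?X"
        then have "bracket g h \<in> L (Suc k)" using X LL' by blast
        then show "\<mu> (bracket g h) = 0 \<and> ?A (bracket g h) w \<in> U"
          using weight_L[OF l] that unfolding Vk_def by blast
      qed
      have subX: "subspace (Vk ?X)"
      proof (rule subspaceI)
        show "0 \<in> Vk ?X" using U V by (auto simp: Vk_def subspace_0)
      next
        fix x y assume "x \<in> Vk ?X" "y \<in> Vk ?X"
        moreover have "?A h (x + y) = ?A h x + ?A h y" for h
          by (simp add: bracket_add_right algebra_simps)
        ultimately show "x + y \<in> Vk ?X" using U V by (auto simp: Vk_def subspace_add)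
      next
        fix c x assume "x \<in> Vk ?X"
        moreover have "?A h (c *s x) = c *s ?A h x" for h
          by (simp add: bracket_scale_right algebra_simps)
        ultimately show "c *s x \<in> Vk ?X" using U V by (auto simp: Vk_def subspace_scale)
      qed
      have "v \<in> gen_eig (bracket h) (\<mu> h)"
        using v VU X by (intro wspD) (auto simp: Vk_def)
      then obtain n where "(?A h ^^ n) v = 0" by (auto simp: gen_eig_def)
      then have ex: "\<exists>n. (?A h ^^ n) v \<in> U" using U subspace_0 by metis
      \<comment> \<open>The last iterate of ad h - \<mu>(h) on v outside U is an eigenvector of ad h
        modulo U. Stability of \<open>Vk\<close> keeps the conditions already achieved.\<close>
      define n where "n = (LEAST n. (?A h ^^ n) v \<in> U)"
      have nU: "(?A h ^^ n) v \<in> U" unfolding n_def using ex by (rule LeastI_ex)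
      then obtain m where m: "n = Suc m" using v by (cases n) auto
      let ?w = "(?A h ^^ m) v"
      have "?w \<notin> U" using not_less_Least[of m "\<lambda>n. (?A h ^^ n) v \<in> U"] m n_def by auto
      moreover have "?w \<in> Vk ?X"
        using v st subX by (intro funpow_mem) (auto intro: subspace_diff subspace_scale)
      moreover have "?A h ?w \<in> U" using nU m by simp
      ultimately have "?w \<in> Vk (L (Suc k) \<union> insert h C)" unfolding Vk_def by blast
      then show ?case using \<open>?w \<notin> U\<close> by blast
    qed
    then obtain v where v: "v \<in> Vk (L (Suc k) \<union> C)" "v \<notin> U" by blast
    have "C \<subseteq> {h \<in> H. ?A h v \<in> U}" using v C(3) L_sub[of k] unfolding Vk_def by blast
    moreover have "subspace {h \<in> H. ?A h v \<in> U}"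
    proof (rule subspaceI)
      show "0 \<in> {h \<in> H. ?A h v \<in> U}"
        using subspace_H U weight_zero[OF l] by (auto simp: subspace_0)
    next
      fix x y assume xy: "x \<in> {h \<in> H. ?A h v \<in> U}" "y \<in> {h \<in> H. ?A h v \<in> U}"
      then have "?A (x + y) v = ?A x v + ?A y v"
        using weight_add[OF l] by (simp add: bracket_add_left algebra_simps)
      then show "x + y \<in> {h \<in> H. ?A h v \<in> U}" using xy subspace_H U by (auto simp: subspace_add)
    next
      fix c x assume x: "x \<in> {h \<in> H. ?A h v \<in> U}"
      then have "?A (c *s x) v = c *s ?A x v"
        using weight_scale[OF l] by (simp add: bracket_scale_left algebra_simps)
      then show "c *s x \<in> {h \<in> H. ?A h v \<in> U}" using x subspace_H U by (auto simp: subspace_scale)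
    qed
    ultimately have "span C \<subseteq> {h \<in> H. ?A h v \<in> U}" by (rule span_minimal)
    then have "v \<in> Vk (L k)" using v C(2) unfolding Vk_def by blast
    then show ?case using v by blast
  qed
  from this[of 0] show ?thesis by (auto simp: Vk_def)
qed

text \<open>Otherwise the common eigenvector for the weight 0 modulo U = H is a vector outside H
  that H brackets into H, contrary to self-normalisation.\<close>

lemma wsp_zero: "wsp 0 = H"
proof (rule ccontr)
  assume "wsp 0 \<noteq> H"
  then have not: "\<not> wsp 0 \<subseteq> H" using H_wsp by auto
  then have "0 \<in> weights" using subspace_0[OF subspace_H] by (auto simp: weights_def)
  then obtain v where "v \<notin> H" "\<forall>h\<in>H. bracket h v - 0 h *s v \<in> H"
    using common_eigenvector[OF _ subspace_H bracket_H subspace_wsp H_stable_wsp, of 0 0] not by blast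
  then show False using normalizer_H[of v] by auto
qed

lemma root_space_wsp: "root_space H \<mu> \<subseteq> wsp \<mu>"
proof
  fix x assume x: "x \<in> root_space H \<mu>"
  have "((\<lambda>x. bracket h x - \<mu> h *s x) ^^ 1) x = 0" if "h \<in> H" for h
    using x that by (auto simp: root_space_def)
  then show "x \<in> wsp \<mu>" unfolding wsp_def gen_eig_def by blast
qed

lemma weight_root_vector:
  assumes "\<mu> \<in> weights"
  shows "\<exists>v \<in> root_space H \<mu>. v \<noteq> 0"
proof -
  have "\<not> wsp \<mu> \<subseteq> {0}" using assms by (auto simp: weights_def)
  then show ?thesis
    using common_eigenvector[OF assms _ _ subspace_wsp H_stable_wsp, of "{0}" \<mu>]
    by (auto simp: root_space_def)
qed

text \<open>Roots are defined by genuine eigenvectors and weights by generalised ones; the common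
  eigenvector closes the gap, and linearity puts the weights into \<open>dual_on\<close>.\<close>

lemma roots_eq: "roots H = weights - {0}"
proof (intro set_eqI iffI)
  fix \<alpha> assume "\<alpha> \<in> roots H"
  then show "\<alpha> \<in> weights - {0}"
    using root_space_wsp[of \<alpha>] by (auto simp: roots_def dual_on_def weights_def root_space_def)
next
  fix \<alpha> assume \<alpha>: "\<alpha> \<in> weights - {0}"
  then show "\<alpha> \<in> roots H"
    using weight_root_vector[of \<alpha>] weight_outside[of \<alpha>]
    by (auto simp: roots_def dual_on_def weight_add weight_scale)
qed

end

section \<open>The Killing form\<close>

context fd_lie_algebra
begin

lemma killing_trace: "killing x y = trace_on UNIV (\<lambda>v. bracket x (bracket y v))"
proof -
  have "lin (\<lambda>v. bracket x (bracket y v))"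
    by (auto intro!: linI simp: bracket_add_right bracket_scale_right)
  from trace_on_eq[OF independent_Basis span_Basis this] show ?thesis
    by (simp add: killing_def trace_op_def trace_wrt_def)
qed

lemma killing_commute: "killing x y = killing y x"
  unfolding killing_trace by (rule trace_on_commute) auto

lemma lin_bracket2: "lin (\<lambda>v. bracket x (bracket y v))"
  by (auto intro!: linI simp: bracket_add_right bracket_scale_right)

lemma killing_add_left: "killing (x + x') y = killing x y + killing x' y"
  unfolding killing_trace by (simp add: bracket_add_left trace_on_add lin_bracket2)

lemma killing_scale_left: "killing (c *s x) y = c * killing x y"
  unfolding killing_trace by (simp add: bracket_scale_left trace_on_scale lin_bracket2)

lemma killing_add_right: "killing x (y + y') = killing x y + killing x y'"
  using killing_add_left[of y y' x] by (simp add: killing_commute)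

lemma killing_scale_right: "killing x (c *s y) = c * killing x y"
  using killing_scale_left[of c y x] by (simp add: killing_commute)

lemma killing_zero [simp]: "killing 0 y = 0" "killing x 0 = 0"
  using killing_scale_left[of 0 0 y] killing_scale_right[of x 0 0] by simp_all

lemma killing_neg: "killing (- x) y = - killing x y" "killing x (- y) = - killing x y"
  using killing_scale_left[of "-1" x y] killing_scale_right[of x "-1" y] by simp_all

lemma killing_diff:
  "killing (x - x') y = killing x y - killing x' y" "killing x (y - y') = killing x y - killing x y'"
  using killing_add_left[of x "- x'" y] killing_add_right[of x y "- y'"]
    by (simp_all add: killing_neg)

lemma killing_sum: "killing (\<Sum>i\<in>I. f i) y = (\<Sum>i\<in>I. killing (f i) y)"
  "killing x (\<Sum>i\<in>I. f i) = (\<Sum>i\<in>I. killing x (f i))"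
  by (induction I rule: infinite_finite_induct) (auto simp: killing_add_left killing_add_right)

lemma killing_invariant: "killing (bracket x y) z = killing x (bracket y z)"
proof -
  let ?XYZ = "\<lambda>v. bracket x (bracket y (bracket z v))"
  let ?YXZ = "\<lambda>v. bracket y (bracket x (bracket z v))"
  let ?XZY = "\<lambda>v. bracket x (bracket z (bracket y v))"
  have lin: "lin ?XYZ" "lin ?YXZ" "lin ?XZY"
    "lin (\<lambda>v. (-1) *s ?YXZ v)" "lin (\<lambda>v. (-1) *s ?XZY v)"
    by (auto intro!: linI simp: bracket_add_right bracket_scale_right algebra_simps)
  have "(\<lambda>v. bracket (bracket x y) (bracket z v)) = (\<lambda>v. ?XYZ v + (-1) *s ?YXZ v)"
    using bracket_derivation[of x y] by (auto simp: fun_eq_iff algebra_simps)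
  then have "killing (bracket x y) z = trace_on UNIV ?XYZ - trace_on UNIV ?YXZ"
    unfolding killing_trace using lin
      by (simp only: trace_on_add subspace_UNIV UNIV_I trace_on_scale) simp
  \<comment> \<open>Cyclicity of the trace, moving Y to the end; the common term XYZ is left
    untouched.\<close>
  also have "trace_on UNIV ?YXZ = trace_on UNIV ?XZY"
    by (rule trace_on_commute[of _ "bracket y"]) (auto simp: lin_bracket2)
  also have "(\<lambda>v. bracket x (bracket (bracket y z) v)) = (\<lambda>v. ?XYZ v + (-1) *s ?XZY v)"
    using bracket_derivation[of y z]
      by (auto simp: fun_eq_iff algebra_simps bracket_add_right bracket_diff_right)
  then have "trace_on UNIV ?XYZ - trace_on UNIV ?XZY = killing x (bracket y z)"
    unfolding killing_trace using lin
      by (simp only: trace_on_add subspace_UNIV UNIV_I trace_on_scale) simp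
  finally show ?thesis .
qed

lemma killing_ad: "killing (bracket h x) y = - killing x (bracket h y)"
  using killing_invariant[of x h y] bracket_anti[of h x] by (simp add: killing_neg)

text \<open>By invariance, ad h - a on x and ad h - b on y together multiply \<kappa>(x,y) by -(a +
  b). The Leibniz argument makes a power of this scalar kill \<kappa>(x,y).\<close>

lemma killing_gen_eig:
  assumes "x \<in> gen_eig (bracket h) a" "y \<in> gen_eig (bracket h) b" "a + b \<noteq> 0"
  shows "killing x y = 0"
proof -
  obtain n m where "((\<lambda>x. bracket h x - a *s x) ^^ n) x = 0" "((\<lambda>y. bracket h y - b *s y) ^^ m) y = 0"
    using assms by (auto simp: gen_eig_def)
  then have "(((*) (- (a + b))) ^^ (n + m)) (killing x y) = 0"
    by (intro leibniz_nilpotent[where f = killing])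
      (simp_all add: killing_diff killing_scale_left killing_scale_right killing_ad algebra_simps)
  moreover have "(((*) (- (a + b))) ^^ k) z = (- (a + b)) ^ k * z" for k z
    by (induction k) simp_all
  ultimately have "(- (a + b)) ^ (n + m) * killing x y = 0" by simp
  then show ?thesis
    using assms(3) unfolding mult_eq_0_iff power_eq_0_iff neg_equal_0_iff_equal by blast
qed

text \<open>ad z and ad h commute, so their product inherits nilpotency from ad z and has trace
  0.\<close>

lemma killing_nilpotent:
  assumes "\<And>v. \<exists>n. (bracket z ^^ n) v = 0" "bracket z h = 0"
  shows "killing z h = 0"
proof -
  have comm: "bracket z (bracket h v) = bracket h (bracket z v)" for v
    using bracket_derivation[of z h v] assms(2) by simp
  have comm_pow: "bracket z ((bracket h ^^ n) v) = (bracket h ^^ n) (bracket z v)" for n v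
    by (induction n) (auto simp: comm)
  have pow: "((\<lambda>v. bracket z (bracket h v)) ^^ n) v = (bracket h ^^ n) ((bracket z ^^ n) v)" for n v
    by (induction n) (auto simp: comm_pow comm)
  show ?thesis unfolding killing_trace
  proof (rule trace_on_nilpotent)
    fix v
    obtain n where "(bracket z ^^ n) v = 0" using assms(1) by blast
    then show "\<exists>n. ((\<lambda>v. bracket z (bracket h v)) ^^ n) v = 0"
      unfolding pow by (metis lin_bracket lin_funpow lin_zero)
  qed (auto simp: lin_bracket2)
qed

lemma killing_radical_ideal: "lie_ideal {x. \<forall>y. killing x y = 0}"
  by (auto simp: lie_ideal_def killing_add_left killing_scale_left killing_ad intro!: subspaceI)

end

context cartan_lie_algebra
begin

lemma killing_wsp:
  assumes "x \<in> wsp \<mu>" "y \<in> wsp \<nu>" "h \<in> H" "\<mu> h + \<nu> h \<noteq> 0"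
  shows "killing x y = 0"
  using assms by (intro killing_gen_eig[of x h "\<mu> h" y "\<nu> h"]) (auto dest: wspD)

lemma sum_wsp_stable:
  assumes S: "S \<subseteq> weights" and x: "x \<in> wsp \<alpha>"
    and closed: "\<And>\<mu> v. \<mu> \<in> S \<Longrightarrow> v \<in> wsp \<mu> \<Longrightarrow> bracket x v \<noteq> 0 \<Longrightarrow> \<alpha> + \<mu> \<in> S"
    and v: "v \<in> family_sum S wsp"
  shows "bracket x v \<in> family_sum S wsp"
proof -
  obtain s where s: "\<And>i. i \<in> S \<Longrightarrow> s i \<in> wsp i" "v = (\<Sum>i\<in>S. s i)"
    using v by (rule family_sumE) blast
  have "bracket x (s i) \<in> family_sum S wsp" if "i \<in> S" for i
  proof (cases "bracket x (s i) = 0")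
    case True
    then show ?thesis using subspace_family_sum[of S wsp] subspace_wsp subspace_0 by metis
  next
    case False
    then have "\<alpha> + i \<in> S" using closed s that by blast
    then show ?thesis
      using finite_subset[OF S finite_weights] bracket_wsp[OF x] s that
      by (intro family_sum_mem[of _ "\<alpha> + i"]) auto
  qed
  then show ?thesis unfolding s(2) bracket_sum_right
    by (intro subspace_sum subspace_family_sum subspace_wsp)
qed

text \<open>[x,y] lies in H, and its trace on the sum over S is both that of a commutator and the
  sum of the weights with multiplicity. Closedness of S is asked only where the bracket is nonzero,
  which allows S to be cut off where x or y acts as zero.\<close>

lemma trace_string:
  assumes S: "S \<subseteq> weights" and x: "x \<in> wsp \<alpha>" and y: "y \<in> wsp (- \<alpha>)"
    and cx: "\<And>\<mu> v. \<mu> \<in> S \<Longrightarrow> v \<in> wsp \<mu> \<Longrightarrow> bracket x v \<noteq> 0 \<Longrightarrow> \<alpha> + \<mu> \<in> S"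
    and cy: "\<And>\<mu> v. \<mu> \<in> S \<Longrightarrow> v \<in> wsp \<mu> \<Longrightarrow> bracket y v \<noteq> 0 \<Longrightarrow> - \<alpha> + \<mu> \<in> S"
  shows "(\<Sum>\<mu>\<in>S. \<mu> (bracket x y) * of_nat (dim (wsp \<mu>))) = 0"
proof -
  have "bracket x y \<in> wsp (\<alpha> + - \<alpha>)" using bracket_wsp[OF x y] .
  then have t: "bracket x y \<in> H" by (simp add: wsp_zero)
  have "trace_on (family_sum S wsp) (bracket (bracket x y)) = 0"
    using sum_wsp_stable[OF S x cx] sum_wsp_stable[OF S y cy]
    by (intro trace_on_bracket subspace_family_sum subspace_wsp)
  then show ?thesis using trace_on_sum_wsp[OF t S] by simp
qed

lemma weight_bracket_mem:
  assumes "\<mu> \<in> weights" "\<alpha> \<in> weights" "x \<in> wsp \<alpha>" "v \<in> wsp \<mu>" "bracket x v \<noteq> 0"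
  shows "\<alpha> + \<mu> \<in> weights"
  using assms weight_outside[OF assms(1)] weight_outside[OF assms(2)]
  by (intro wsp_weight[OF bracket_wsp]) auto

end

section \<open>Root spaces of a simple Lie algebra\<close>

sublocale simple_lie_algebra_data \<subseteq> cartan_lie_algebra scale bracket Basis H
  by unfold_locales (rule cartan)

context simple_lie_algebra_data
begin

text \<open>Without roots the whole algebra would be H, hence nilpotent, whereas a simple algebra
  equals its derived ideal.\<close>

lemma roots_nonempty: "roots H \<noteq> {}"
proof
  assume "roots H = {}"
  then have w: "weights \<subseteq> {0}" using roots_eq by auto
  have "x \<in> H" for x
    using weight_induct[OF subspace_H] w wsp_zero by blast
  then have H: "H = UNIV" by auto
  obtain x y where xy: "bracket x y \<noteq> 0" using simple unfolding simple_lie_def by blast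
  let ?D = "span {bracket x y |x y. True}"
  have "lie_ideal ?D" unfolding lie_ideal_def by (auto intro: span_base)
  moreover have "bracket x y \<in> ?D" by (auto intro: span_base)
  ultimately have D: "?D = UNIV" using simple xy unfolding simple_lie_def by blast
  have "L k = UNIV" for k by (induction k) (use H D in auto)
  then show False using L_trivial xy by (metis UNIV_I singletonD)
qed

lemma killing_nondegenerate: "(\<And>y. killing x y = 0) \<Longrightarrow> x = 0"
proof -
  obtain \<alpha> where "\<alpha> \<in> roots H" using roots_nonempty by blast
  then have "killing (E \<alpha>) (E (- \<alpha>)) = 1" using root_vectors by (auto simp: root_vectors_def)
  then have "E \<alpha> \<notin> {x. \<forall>y. killing x y = 0}" by force
  then have "{x. \<forall>y. killing x y = 0} \<noteq> UNIV" by blast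
  then have "{x. \<forall>y. killing x y = 0} = {0}"
    using simple killing_radical_ideal unfolding simple_lie_def by blast
  then show "(\<And>y. killing x y = 0) \<Longrightarrow> x = 0" by blast
qed

lemma killing_eq_zero_weights:
  assumes "\<And>\<mu> y. \<mu> \<in> weights \<Longrightarrow> y \<in> wsp \<mu> \<Longrightarrow> killing x y = 0"
  shows "x = 0"
proof (rule killing_nondegenerate)
  fix y
  have "y \<in> {y. killing x y = 0}"
  proof (rule weight_induct)
    show "subspace {y. killing x y = 0}"
      by (rule subspaceI) (auto simp: killing_add_right killing_scale_right)
  qed (use assms in auto)
  then show "killing x y = 0" by simp
qed

lemma weight_ext: "\<mu> \<in> weights \<Longrightarrow> (\<And>h. h \<in> H \<Longrightarrow> \<mu> h = \<nu> h) \<Longrightarrow> (\<And>x. x \<notin> H \<Longrightarrow> \<nu> x = 0) \<Longrightarrow> \<mu> = \<nu>"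
  using weight_outside by (metis ext)

text \<open>Since all weights vanish at z, ad z is nilpotent on the whole algebra. Thus z is
  orthogonal to H because it commutes with H, and to the other weight spaces by their weights, so it
  lies in the radical of \<kappa>.\<close>

lemma H_center_trivial:
  assumes z: "z \<in> H" "\<And>h. h \<in> H \<Longrightarrow> bracket z h = 0" "\<And>\<mu>. \<mu> \<in> weights \<Longrightarrow> \<mu> z = 0"
  shows "z = 0"
proof (rule killing_eq_zero_weights)
  fix \<mu> y assume \<mu>: "\<mu> \<in> weights" and y: "y \<in> wsp \<mu>"
  show "killing z y = 0"
  proof (cases "\<mu> = 0")
    case True
    then have "y \<in> H" using y wsp_zero by simp
    have "v \<in> gen_eig (bracket z) 0" for v
    proof (rule weight_induct)
      show "wsp \<mu> \<subseteq> gen_eig (bracket z) 0" if "\<mu> \<in> weights" for \<mu>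
        using wspD[OF _ z(1), of _ \<mu>] z(3)[OF that] by auto
    qed (simp add: subspace_gen_eig)
    then show ?thesis
      using \<open>y \<in> H\<close> z(2) by (intro killing_nilpotent) (auto simp: gen_eig_def)
  next
    case False
    then obtain h where "h \<in> H" "\<mu> h \<noteq> 0" using weight_outside[OF \<mu>] by (auto simp: fun_eq_iff)
    then show ?thesis using z(1) H_wsp y by (intro killing_wsp[of z 0 y \<mu> h]) auto
  qed
qed

text \<open>If H is not abelian, the last nonzero term of its lower central series lies in the
  derived algebra. Its elements are central in H and annihilated by every weight, hence
  zero.\<close>

lemma H_abelian: "x \<in> H \<Longrightarrow> y \<in> H \<Longrightarrow> bracket x y = 0"
proof (rule ccontr)
  assume xy: "x \<in> H" "y \<in> H" "bracket x y \<noteq> 0"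
  have ex: "\<exists>n. L n = {0}" using L_trivial by metis
  define n where "n = (LEAST n. L n = {0})"
  have n: "L n = {0}" unfolding n_def using ex by (rule LeastI_ex)
  have "bracket x y \<in> L 1" using bracket_L[of x y 0] xy by simp
  then have "L 1 \<noteq> {0}" "L 0 \<noteq> {0}" using xy by auto
  then have "n \<noteq> 0" "n \<noteq> 1" using n by metis+
  then obtain m where m: "n = Suc (Suc m)" by (metis One_nat_def not0_implies_Suc)
  have "L (Suc m) \<noteq> {0}" using not_less_Least[of "Suc m" "\<lambda>n. L n = {0}"] m n_def by auto
  then obtain z where z: "z \<in> L (Suc m)" "z \<noteq> 0" using subspace_0[OF subspace_L] by blast
  have zH: "z \<in> H" using z L_sub by blast
  have "bracket z h = 0" if "h \<in> H" for h
    using bracket_L[OF that z(1)] n m bracket_anti[of z h] by auto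
  then have "z = 0" using H_center_trivial[OF zH] weight_L[OF _ z(1)] by blast
  then show False using z by simp
qed

lemma root_weight: "\<alpha> \<in> roots H \<Longrightarrow> \<alpha> \<in> weights"
  and root_nonzero: "\<alpha> \<in> roots H \<Longrightarrow> \<alpha> \<noteq> 0"
  by (auto simp: roots_eq)

lemma E_mem: "\<alpha> \<in> roots H \<Longrightarrow> E \<alpha> \<in> root_space H \<alpha>"
  and killing_E: "\<alpha> \<in> roots H \<Longrightarrow> killing (E \<alpha>) (E (- \<alpha>)) = 1"
  using root_vectors by (auto simp: root_vectors_def)

lemma E_wsp: "\<alpha> \<in> roots H \<Longrightarrow> E \<alpha> \<in> wsp \<alpha>"
  using E_mem root_space_wsp by blast

lemma E_nonzero: "\<alpha> \<in> roots H \<Longrightarrow> E \<alpha> \<noteq> 0"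
  using killing_E by force

lemma bracket_E: "\<alpha> \<in> roots H \<Longrightarrow> h \<in> H \<Longrightarrow> bracket h (E \<alpha>) = \<alpha> h *s E \<alpha>"
  using E_mem by (auto simp: root_space_def)

text \<open>If -\<alpha> were no weight, \<open>E \<alpha>\<close> would be orthogonal to all weight
  spaces.\<close>

lemma neg_root: 
  assumes \<alpha>: "\<alpha> \<in> roots H"
  shows "- \<alpha> \<in> roots H"
proof (rule ccontr)
  assume "- \<alpha> \<notin> roots H"
  then have nw: "- \<alpha> \<notin> weights" using root_nonzero[OF \<alpha>] by (auto simp: roots_eq)
  have "E \<alpha> = 0"
  proof (rule killing_eq_zero_weights)
    fix \<mu> y assume \<mu>: "\<mu> \<in> weights" and y: "y \<in> wsp \<mu>"
    have "\<mu> \<noteq> - \<alpha>" using nw \<mu> by auto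
    then obtain h where "h \<in> H" "\<mu> h \<noteq> - \<alpha> h"
      using weight_ext[OF \<mu>, of "- \<alpha>"] weight_outside[OF root_weight[OF \<alpha>]] by auto
    then show "killing (E \<alpha>) y = 0"
      using y E_wsp[OF \<alpha>] by (intro killing_wsp[of _ \<alpha> _ \<mu> h]) (auto simp: add_eq_0_iff)
  qed
  then show False using E_nonzero[OF \<alpha>] by simp
qed

text \<open>The element H_\<alpha> that represents \<alpha> under \<kappa>; it is proportional to
  the usual coroot but not scaled to \<alpha>-value 2.\<close>

definition coroot :: "('g \<Rightarrow> 'f) \<Rightarrow> 'g" where
  "coroot \<alpha> = bracket (E \<alpha>) (E (- \<alpha>))"

lemma coroot_H: "\<alpha> \<in> roots H \<Longrightarrow> coroot \<alpha> \<in> H"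
  using bracket_wsp[OF E_wsp E_wsp[OF neg_root], of \<alpha> \<alpha>] by (simp add: coroot_def wsp_zero)

lemma killing_coroot: "\<alpha> \<in> roots H \<Longrightarrow> h \<in> H \<Longrightarrow> killing (coroot \<alpha>) h = \<alpha> h"
  using bracket_E[OF neg_root, of \<alpha> h] bracket_anti[of "E (- \<alpha>)" h] killing_E[of \<alpha>]
  by (simp add: coroot_def killing_invariant killing_neg killing_scale_right)

text \<open>Let t be \<open>coroot \<alpha>\<close>. If \<alpha>(t) = 0, then all weights with the
  value \<beta>(t) at t form a set stable under shifts by \<alpha>. The trace of ad t there is
  \<beta>(t) times a positive dimension, so every weight vanishes at t. Then t = 0, although
  \<kappa>(t,h) = \<alpha>(h).\<close>

lemma root_coroot_nonzero:
  assumes \<alpha>: "\<alpha> \<in> roots H"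
  shows "\<alpha> (coroot \<alpha>) \<noteq> 0"
proof
  assume z: "\<alpha> (coroot \<alpha>) = 0"
  have "\<beta> (coroot \<alpha>) = 0" if \<beta>: "\<beta> \<in> weights" for \<beta>
  proof -
    let ?S = "{\<mu> \<in> weights. \<mu> (coroot \<alpha>) = \<beta> (coroot \<alpha>)}"
    have "(\<Sum>\<mu>\<in>?S. \<mu> (bracket (E \<alpha>) (E (- \<alpha>))) * of_nat (dim (wsp \<mu>))) = 0"
    proof (rule trace_string)
      show "E \<alpha> \<in> wsp \<alpha>" "E (- \<alpha>) \<in> wsp (- \<alpha>)" using \<alpha> neg_root E_wsp by auto
      show "\<alpha> + \<mu> \<in> ?S" if "\<mu> \<in> ?S" "v \<in> wsp \<mu>" "bracket (E \<alpha>) v \<noteq> 0" for \<mu> v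
        using that z weight_bracket_mem[OF _ root_weight[OF \<alpha>] E_wsp[OF \<alpha>]] by auto
      show "- \<alpha> + \<mu> \<in> ?S" if "\<mu> \<in> ?S" "v \<in> wsp \<mu>" "bracket (E (- \<alpha>)) v \<noteq> 0" for \<mu> v
        using that z weight_bracket_mem[OF _ root_weight[OF neg_root[OF \<alpha>]] E_wsp[OF neg_root[OF
            \<alpha>]], of \<mu> v]
        by simp
    qed auto
    moreover have "(\<Sum>\<mu>\<in>?S. \<mu> (coroot \<alpha>) * of_nat (dim (wsp \<mu>)))
        = (\<Sum>\<mu>\<in>?S. \<beta> (coroot \<alpha>) * of_nat (dim (wsp \<mu>)))"
      by (intro sum.cong) auto
    ultimately have "\<beta> (coroot \<alpha>) * of_nat (\<Sum>\<mu>\<in>?S. dim (wsp \<mu>)) = 0"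
      by (simp add: coroot_def sum_distrib_left)
    moreover have "(\<Sum>\<mu>\<in>?S. dim (wsp \<mu>)) \<ge> dim (wsp \<beta>)"
      using \<beta> finite_weights by (intro member_le_sum) auto
    then have "(\<Sum>\<mu>\<in>?S. dim (wsp \<mu>)) \<noteq> 0" using dim_wsp[OF \<beta>] by linarith
    then have "of_nat (\<Sum>\<mu>\<in>?S. dim (wsp \<mu>)) \<noteq> (0::'f)" unfolding of_nat_eq_0_iff .
    ultimately show ?thesis by (simp only: mult_eq_0_iff simp_thms)
  qed
  then have "coroot \<alpha> = 0"
    using H_abelian[OF coroot_H[OF \<alpha>]] by (rule H_center_trivial[OF coroot_H[OF \<alpha>], rotated])
  then have "\<alpha> h = 0" if "h \<in> H" for h using killing_coroot[OF \<alpha> that] by simp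
  then show False
    using root_nonzero[OF \<alpha>] weight_outside[OF root_weight[OF \<alpha>]] by (auto simp: fun_eq_iff)
qed

lemma coroot_nonzero: "\<alpha> \<in> roots H \<Longrightarrow> coroot \<alpha> \<noteq> 0"
  using root_coroot_nonzero weight_zero root_weight by metis

lemma zero_weight: "0 \<in> weights"
proof -
  obtain \<alpha> where "\<alpha> \<in> roots H" using roots_nonempty by blast
  then show ?thesis using coroot_H[of \<alpha>] coroot_nonzero[of \<alpha>] wsp_zero
    by (intro wsp_weight[of "coroot \<alpha>"]) auto
qed

text \<open>The trace of \<open>ad [E\<^sub>\<alpha>, E\<^sub>-\<^sub>\<alpha>]\<close> vanishes on \<open>span {E\<^sub>\<alpha>} + H + \<Sum>\<^sub>k\<^sub>\<ge>\<^sub>1 g\<^sub>-\<^sub>k\<^sub>\<alpha>\<close>, which leaves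
  room for one
  dimension only in the last sum.\<close>

lemma dim_wsp_neg_root:
  assumes \<alpha>: "\<alpha> \<in> roots H"
  shows "dim (wsp (- \<alpha>)) = 1"
proof -
  note n\<alpha> = neg_root[OF \<alpha>]
  let ?t = "coroot \<alpha>"
  note at = root_coroot_nonzero[OF \<alpha>]
  let ?m = "\<lambda>k. (\<lambda>x. - (of_nat k * \<alpha> x)) :: 'g \<Rightarrow> 'f"
  define S where "S = {\<mu> \<in> weights. \<exists>k\<ge>1. \<mu> = ?m k}"
  \<comment> \<open>The dimension of the weight space of \<alpha> is still unknown, so only the line
    of \<open>E \<alpha>\<close> is taken; it suffices for stability, being the image of H under ad
    \<open>E \<alpha>\<close> together with 0.\<close>
  define V where "V \<mu> = (if \<mu> = \<alpha> then span {E \<alpha>} else wsp \<mu>)" for \<mu>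
  have "\<forall>\<mu>\<in>S. \<exists>k\<ge>1. \<mu> = ?m k" by (auto simp: S_def)
  then obtain k where k: "\<And>\<mu>. \<mu> \<in> S \<Longrightarrow> k \<mu> \<ge> 1 \<and> \<mu> = ?m (k \<mu>)" by metis
  have S0: "0 \<notin> S"
  proof
    assume "0 \<in> S"
    then have "(0::'g \<Rightarrow> 'f) ?t = ?m (k 0) ?t" using k by metis
    then show False using k[OF \<open>0 \<in> S\<close>] at by simp
  qed
  have S\<alpha>: "\<alpha> \<notin> S"
  proof
    assume "\<alpha> \<in> S"
    then have "\<alpha> ?t = ?m (k \<alpha>) ?t" using k by metis
    then have "\<alpha> ?t + of_nat (k \<alpha>) * \<alpha> ?t = 0" unfolding eq_neg_iff_add_eq_0 .
    then have "of_nat (Suc (k \<alpha>)) * \<alpha> ?t = 0" by (simp add: distrib_right)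
    then show False using at by (simp del: of_nat_Suc)
  qed
  have \<alpha>0: "\<alpha> \<noteq> 0" using root_nonzero[OF \<alpha>] .
  let ?I = "insert \<alpha> (insert 0 S)"
  have I: "?I \<subseteq> weights" "finite ?I" "finite S"
    using root_weight[OF \<alpha>] zero_weight finite_subset[OF _ finite_weights, of S] by (auto simp: S_def)
  have subV: "subspace (V \<mu>)" for \<mu> by (simp add: V_def subspace_wsp)
  have Vw: "V \<mu> \<subseteq> wsp \<mu>" for \<mu>
    using span_minimal[of "{E \<alpha>}" "wsp \<alpha>"] E_wsp[OF \<alpha>] subspace_wsp by (simp add: V_def)
  have V0: "V 0 = H" using \<alpha>0 by (auto simp: V_def wsp_zero)
  have VS: "V \<mu> = wsp \<mu>" if "\<mu> \<in> S" for \<mu> using that S\<alpha> by (auto simp: V_def)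
  have dir: "direct_family ?I V"
    using direct_weights[OF I(1)] Vw unfolding direct_family_def by blast
  let ?M = "family_sum ?I V"
  have subM: "subspace ?M" by (intro subspace_family_sum subV)
  have mem: "x \<in> ?M" if "\<mu> \<in> ?I" "x \<in> V \<mu>" for x \<mu>
    using that I subspace_0[OF subV] by (intro family_sum_mem[of _ \<mu>])
  have EM: "bracket (E \<alpha>) x \<in> V \<alpha>" if "x \<in> H" for x
    using bracket_E[OF \<alpha> that] bracket_anti[of "E \<alpha>" x]
    by (simp add: V_def span_neg span_scale span_base)
  have stE: "bracket (E \<alpha>) x \<in> ?M" if mx: "\<mu> \<in> ?I" "x \<in> V \<mu>" for \<mu> x
  proof -
    consider "\<mu> = \<alpha>" | "\<mu> = 0" | "\<mu> \<in> S" using mx by blast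
    then show ?thesis
    proof cases
      case 1
      then obtain c where "x = c *s E \<alpha>" using mx by (auto simp: V_def span_singleton)
      then show ?thesis using subspace_0[OF subM] by (simp add: bracket_scale_right bracket_self)
    next
      case 2
      then show ?thesis using EM mx V0 mem[of \<alpha>] by simp
    next
      case 3
      have x: "x \<in> wsp \<mu>" using mx Vw by blast
      then have b: "bracket (E \<alpha>) x \<in> wsp (\<alpha> + \<mu>)" using bracket_wsp E_wsp[OF \<alpha>] by blast
      show ?thesis
      proof (cases "bracket (E \<alpha>) x = 0 \<or> k \<mu> = 1")
        case True
        then show ?thesis
        proof
          \<comment> \<open>From the weight -\<alpha> the string leads up into H.\<close>
          assume "k \<mu> = 1"
          then have "\<alpha> + \<mu> = 0" using k[OF 3] by (auto simp: fun_eq_iff)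
          then show ?thesis using b V0 mem[of 0] by (simp add: wsp_zero)
        qed (use subspace_0[OF subM] in simp)
      next
        case False
        then have "\<alpha> + \<mu> \<in> weights"
          using x root_weight[OF \<alpha>] E_wsp[OF \<alpha>] 3 by (intro weight_bracket_mem) (auto simp: S_def)
        moreover have "\<alpha> + \<mu> = ?m (k \<mu> - 1)" "k \<mu> - 1 \<ge> 1"
          using k[OF 3] False by (auto simp: fun_eq_iff of_nat_diff algebra_simps)
        ultimately have "\<alpha> + \<mu> \<in> S" by (auto simp: S_def)
        then show ?thesis using b mem[of "\<alpha> + \<mu>"] VS by simp
      qed
    qed
  qed
  have stF: "bracket (E (- \<alpha>)) x \<in> ?M" if mx: "\<mu> \<in> ?I" "x \<in> V \<mu>" for \<mu> x
  proof (cases "bracket (E (- \<alpha>)) x = 0")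
    case True
    then show ?thesis using subspace_0[OF subM] by simp
  next
    case False
    have x: "x \<in> wsp \<mu>" using mx Vw by blast
    have w: "- \<alpha> + \<mu> \<in> weights"
      using x mx I root_weight[OF n\<alpha>] E_wsp[OF n\<alpha>] False by (intro weight_bracket_mem) auto
    have b: "bracket (E (- \<alpha>)) x \<in> wsp (- \<alpha> + \<mu>)" using bracket_wsp E_wsp[OF n\<alpha>] x by blast
    consider "\<mu> = \<alpha>" | "\<mu> = 0" | "\<mu> \<in> S" using mx by blast
    then show ?thesis
    proof cases
      case 1
      then show ?thesis using b V0 mem[of 0] by (simp add: wsp_zero)
    next
      case 2
      then have "- \<alpha> + \<mu> = ?m 1" by (auto simp: fun_eq_iff)
      then have "- \<alpha> + \<mu> \<in> S" using w by (auto simp: S_def)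
      then show ?thesis using b mem[of "- \<alpha> + \<mu>"] VS by simp
    next
      case 3
      then have "- \<alpha> + \<mu> = ?m (Suc (k \<mu>))"
        using k[OF 3] by (auto simp: fun_eq_iff algebra_simps)
      then have "- \<alpha> + \<mu> \<in> S" using w by (auto simp: S_def)
      then show ?thesis using b mem[of "- \<alpha> + \<mu>"] VS by simp
    qed
  qed
  have st: "bracket e v \<in> ?M"
    if e: "\<And>\<mu> x. \<mu> \<in> ?I \<Longrightarrow> x \<in> V \<mu> \<Longrightarrow> bracket e x \<in> ?M" and v: "v \<in> ?M" for e v
  proof -
    obtain s where s: "\<And>i. i \<in> ?I \<Longrightarrow> s i \<in> V i" "v = (\<Sum>i\<in>?I. s i)"
      using v by (rule family_sumE) blast
    show ?thesis unfolding s(2) bracket_sum_right using s(1) e by (intro subspace_sum subM) blast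
  qed
  have "trace_on ?M (bracket ?t) = 0"
    unfolding coroot_def using st stE stF by (intro trace_on_bracket subM) blast+
  moreover have "trace_on ?M (bracket ?t) = (\<Sum>\<mu>\<in>?I. trace_on (V \<mu>) (bracket ?t))"
  proof (rule trace_on_family_sum[OF I(2) subV dir])
    fix \<mu> x assume "\<mu> \<in> ?I" "x \<in> V \<mu>"
    then show "bracket ?t x \<in> V \<mu>"
      using H_stable_wsp[OF coroot_H[OF \<alpha>]] bracket_E[OF \<alpha> coroot_H[OF \<alpha>]]
      by (auto simp: V_def span_singleton bracket_scale_right split: if_splits)
  qed auto
  ultimately have "(\<Sum>\<mu>\<in>?I. trace_on (V \<mu>) (bracket ?t)) = 0" by simp
  moreover have "trace_on (V \<alpha>) (bracket ?t) = \<alpha> ?t"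
  proof -
    have "trace_on (span {E \<alpha>}) (bracket ?t) = \<alpha> ?t * of_nat (dim (span {E \<alpha>}))"
    proof (rule trace_on_single_eigenvalue)
      fix x assume "x \<in> span {E \<alpha>}"
      then obtain c where x: "x = c *s E \<alpha>" by (auto simp: span_singleton)
      show "bracket ?t x \<in> span {E \<alpha>}"
        using x bracket_E[OF \<alpha> coroot_H[OF \<alpha>]] by (auto simp: bracket_scale_right span_singleton)
      have "((\<lambda>x. bracket ?t x - \<alpha> ?t *s x) ^^ 1) x = 0"
        using x bracket_E[OF \<alpha> coroot_H[OF \<alpha>]] by (simp add: bracket_scale_right mult.commute)
      then show "\<exists>n. ((\<lambda>x. bracket ?t x - \<alpha> ?t *s x) ^^ n) x = 0" by blast
    qed auto
    then show ?thesis using E_nonzero[OF \<alpha>] by (simp add: V_def)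
  qed
  moreover have "trace_on (V 0) (bracket ?t) = 0"
    using trace_on_wsp[OF coroot_H[OF \<alpha>], of 0] by (simp add: V0 wsp_zero)
  moreover have "trace_on (V \<mu>) (bracket ?t) = - (\<alpha> ?t * of_nat (k \<mu> * dim (wsp \<mu>)))" if "\<mu> \<in> S" for \<mu>
  proof -
    have "\<mu> ?t = ?m (k \<mu>) ?t" using k[OF that] by metis
    then show ?thesis using trace_on_wsp[OF coroot_H[OF \<alpha>], of \<mu>] VS[OF that] by simp
  qed
  \<comment> \<open>The line of \<open>E \<alpha>\<close> contributes \<alpha>(t), H contributes 0,
    and the weight -k\<alpha> contributes -k \<alpha>(t) times its dimension. So the k-weighted
    dimensions add up to 1, and -\<alpha> already uses up this 1.\<close>
  ultimately have "\<alpha> ?t - \<alpha> ?t * of_nat (\<Sum>\<mu>\<in>S. k \<mu> * dim (wsp \<mu>)) = 0"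
    using I S0 S\<alpha> \<alpha>0 by (simp add: sum_negf sum_distrib_left)
  then have "\<alpha> ?t * (1 - of_nat (\<Sum>\<mu>\<in>S. k \<mu> * dim (wsp \<mu>))) = 0"
    by (simp only: right_diff_distrib mult_1_right)
  then have "of_nat (\<Sum>\<mu>\<in>S. k \<mu> * dim (wsp \<mu>)) = (1::'f)" using at by (simp del: of_nat_sum)
  then have one: "(\<Sum>\<mu>\<in>S. k \<mu> * dim (wsp \<mu>)) = 1" by (metis of_nat_1 of_nat_eq_iff)
  have "- \<alpha> = ?m 1" by (auto simp: fun_eq_iff)
  then have mS: "- \<alpha> \<in> S" using root_weight[OF n\<alpha>] by (auto simp: S_def)
  then have "k (- \<alpha>) * dim (wsp (- \<alpha>)) \<le> 1"
    using member_le_sum[of "- \<alpha>" S "\<lambda>\<mu>. k \<mu> * dim (wsp \<mu>)"] I one by simp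
  moreover have "k (- \<alpha>) \<ge> 1" "dim (wsp (- \<alpha>)) \<ge> 1"
    using k[OF mS] dim_wsp[OF root_weight[OF n\<alpha>]] by auto
  ultimately show ?thesis
    by (metis le_antisym mult.commute mult_le_mono1 nat_mult_1_right order_trans)
qed

lemma dim_wsp_root: "\<alpha> \<in> roots H \<Longrightarrow> dim (wsp \<alpha>) = 1"
  using dim_wsp_neg_root[OF neg_root] by simp

lemma wsp_root:
  assumes \<alpha>: "\<alpha> \<in> roots H"
  shows "wsp \<alpha> = span {E \<alpha>}"
proof -
  have "span {E \<alpha>} \<subseteq> wsp \<alpha>" using E_wsp[OF \<alpha>] subspace_wsp by (intro span_minimal) auto
  moreover have "dim (span {E \<alpha>}) = 1" using E_nonzero[OF \<alpha>] by simp
  ultimately show ?thesis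
    using dim_wsp_root[OF \<alpha>] subspace_wsp subspace_dim_equal[of "span {E \<alpha>}" "wsp \<alpha>"] by simp
qed

lemma root_space_root:
  assumes \<alpha>: "\<alpha> \<in> roots H"
  shows "root_space H \<alpha> = range (\<lambda>c. c *s E \<alpha>)"
proof
  show "root_space H \<alpha> \<subseteq> range (\<lambda>c. c *s E \<alpha>)"
    using root_space_wsp[of \<alpha>] wsp_root[OF \<alpha>] by (auto simp: span_singleton)
  show "range (\<lambda>c. c *s E \<alpha>) \<subseteq> root_space H \<alpha>"
    using bracket_E[OF \<alpha>] by (auto simp: root_space_def bracket_scale_right mult.commute)
qed

text \<open>The vanishing trace, solved for \<beta>(t) with t = \<open>coroot \<alpha>\<close>: up
  to the factor -\<alpha>(t) it is the mean of k over S. The coefficients are kept as integers so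
  that signs can be compared outside the field.\<close>

lemma trace_string_linear:
  assumes \<alpha>: "\<alpha> \<in> roots H" and \<beta>: "\<beta> \<in> weights" and S: "S \<subseteq> weights"
    and k: "\<And>\<mu>. \<mu> \<in> S \<Longrightarrow> \<mu> = (\<lambda>x. \<beta> x + of_int (k \<mu>) * \<alpha> x)"
    and zero: "(\<Sum>\<mu>\<in>S. \<mu> (coroot \<alpha>) * of_nat (dim (wsp \<mu>))) = 0"
  shows "\<beta> (coroot \<alpha>) * of_int (\<Sum>\<mu>\<in>S. int (dim (wsp \<mu>)))
    = - (\<alpha> (coroot \<alpha>) * of_int (\<Sum>\<mu>\<in>S. k \<mu> * int (dim (wsp \<mu>))))"
proof -
  have "\<mu> (coroot \<alpha>) = \<beta> (coroot \<alpha>) + of_int (k \<mu>) * \<alpha> (coroot \<alpha>)" if "\<mu> \<in> S" for \<mu>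
    using fun_cong[OF k[OF that]] .
  then have "(\<Sum>\<mu>\<in>S. (\<beta> (coroot \<alpha>) + of_int (k \<mu>) * \<alpha> (coroot \<alpha>)) * of_nat (dim (wsp \<mu>))) = 0"
    using zero by simp
  then show ?thesis
    by (simp add: sum.distrib sum_distrib_left algebra_simps add_eq_0_iff)
qed

text \<open>If \<open>[E\<^sub>\<alpha>, E\<^sub>\<beta>] = 0\<close>, the trace of \<open>ad [E\<^sub>\<alpha>, E\<^sub>-\<^sub>\<alpha>]\<close> vanishes on the whole \<open>\<alpha>\<close>-string through
  \<open>\<beta>\<close> and
  also on its part below \<open>\<beta>\<close>, hence on the part above \<open>\<beta>\<close>; the mean weights of the two parts differ.\<close>

lemma bracket_E_nonzero:
  assumes \<alpha>: "\<alpha> \<in> roots H" and \<beta>: "\<beta> \<in> roots H" and ab: "\<alpha> + \<beta> \<in> roots H"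
  shows "bracket (E \<alpha>) (E \<beta>) \<noteq> 0"
proof
  assume zero: "bracket (E \<alpha>) (E \<beta>) = 0"
  note n\<alpha> = neg_root[OF \<alpha>]
  let ?t = "coroot \<alpha>"
  note at = root_coroot_nonzero[OF \<alpha>]
  let ?m = "\<lambda>k. (\<lambda>x. \<beta> x + of_int k * \<alpha> x) :: 'g \<Rightarrow> 'f"
  define A where "A = {\<mu> \<in> weights. \<exists>k. \<mu> = ?m k}"
  have "\<forall>\<mu>\<in>A. \<exists>k. \<mu> = ?m k" by (auto simp: A_def)
  then obtain k where k: "\<And>\<mu>. \<mu> \<in> A \<Longrightarrow> \<mu> = ?m (k \<mu>)" by metis
  \<comment> \<open>The position in the string is well defined because \<alpha> does not vanish at
    its own coroot.\<close>
  have kI: "k (?m j) = j" if "?m j \<in> A" for j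
  proof -
    have "?m (k (?m j)) ?t = ?m j ?t" using k[OF that] by metis
    then show ?thesis using at by simp
  qed
  have up: "\<alpha> + \<mu> = ?m (k \<mu> + 1)" and down: "- \<alpha> + \<mu> = ?m (k \<mu> - 1)" if "\<mu> \<in> A" for \<mu>
    using k[OF that] by (auto simp: fun_eq_iff algebra_simps)
  have Aup: "\<alpha> + \<mu> \<in> A" "k (\<alpha> + \<mu>) = k \<mu> + 1" if "\<mu> \<in> A" "\<alpha> + \<mu> \<in> weights" for \<mu>
  proof -
    show "\<alpha> + \<mu> \<in> A" using that up[of \<mu>] unfolding A_def by blast
    then show "k (\<alpha> + \<mu>) = k \<mu> + 1" using up[OF that(1)] kI by metis
  qed
  have Adown: "- \<alpha> + \<mu> \<in> A" "k (- \<alpha> + \<mu>) = k \<mu> - 1" if "\<mu> \<in> A" "- \<alpha> + \<mu> \<in> weights" for \<mu>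
  proof -
    show "- \<alpha> + \<mu> \<in> A" using that down[of \<mu>] unfolding A_def by blast
    then show "k (- \<alpha> + \<mu>) = k \<mu> - 1" using down[OF that(1)] kI by metis
  qed
  have \<beta>m: "\<beta> = ?m 0" by simp
  have \<beta>A: "\<beta> \<in> A" using \<beta>m root_weight[OF \<beta>] unfolding A_def by blast
  have k\<beta>: "k \<beta> = 0" using \<beta>m kI \<beta>A by metis
  define N where "N = {\<mu> \<in> A. k \<mu> \<le> 0}"
  define P where "P = {\<mu> \<in> A. k \<mu> \<ge> 1}"
  have AW: "A \<subseteq> weights" "N \<subseteq> weights" "P \<subseteq> weights" by (auto simp: A_def N_def P_def)
  have fin: "finite N" "finite P" using AW finite_subset finite_weights by blast+
  have up_w: "\<alpha> + \<mu> \<in> weights" if "\<mu> \<in> A" "v \<in> wsp \<mu>" "bracket (E \<alpha>) v \<noteq> 0" for \<mu> v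
    using that AW root_weight[OF \<alpha>] E_wsp[OF \<alpha>] by (intro weight_bracket_mem[of \<mu> \<alpha> "E \<alpha>" v]) auto
  have down_w: "- \<alpha> + \<mu> \<in> weights" if "\<mu> \<in> A" "v \<in> wsp \<mu>" "bracket (E (- \<alpha>)) v \<noteq> 0" for \<mu> v
    using that AW root_weight[OF n\<alpha>] E_wsp[OF n\<alpha>]
    by (intro weight_bracket_mem[of \<mu> "- \<alpha>" "E (- \<alpha>)" v]) auto
  have sA: "(\<Sum>\<mu>\<in>A. \<mu> ?t * of_nat (dim (wsp \<mu>))) = 0"
    unfolding coroot_def using up_w down_w Aup Adown
    by (intro trace_string[OF AW(1) E_wsp[OF \<alpha>] E_wsp[OF n\<alpha>]]) blast+
  have sN: "(\<Sum>\<mu>\<in>N. \<mu> ?t * of_nat (dim (wsp \<mu>))) = 0"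
    unfolding coroot_def
  proof (intro trace_string[OF AW(2) E_wsp[OF \<alpha>] E_wsp[OF n\<alpha>]])
    fix \<mu> v assume v: "\<mu> \<in> N" "v \<in> wsp \<mu>" "bracket (E \<alpha>) v \<noteq> 0"
    have \<mu>: "\<mu> \<in> A" "k \<mu> \<le> 0" using v by (auto simp: N_def)
    \<comment> \<open>The lower part can only be left upwards through \<beta> itself, where the
      weight space is the line of \<open>E \<beta>\<close> and the bracket is zero by
      assumption.\<close>
    have "k \<mu> \<noteq> 0"
    proof
      assume "k \<mu> = 0"
      then have "\<mu> = \<beta>" using k[OF \<mu>(1)] by simp
      then have "v \<in> span {E \<beta>}" using v wsp_root[OF \<beta>] by simp
      then show False using v(3) zero by (auto simp: span_singleton bracket_scale_right)
    qed
    then show "\<alpha> + \<mu> \<in> N" using \<mu> Aup[OF \<mu>(1) up_w[OF \<mu>(1) v(2,3)]] by (simp add: N_def)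
  next
    fix \<mu> v assume v: "\<mu> \<in> N" "v \<in> wsp \<mu>" "bracket (E (- \<alpha>)) v \<noteq> 0"
    have \<mu>: "\<mu> \<in> A" "k \<mu> \<le> 0" using v by (auto simp: N_def)
    show "- \<alpha> + \<mu> \<in> N" using \<mu> Adown[OF \<mu>(1) down_w[OF \<mu>(1) v(2,3)]] by (simp add: N_def)
  qed
  have "A = N \<union> P" "N \<inter> P = {}" by (auto simp: N_def P_def)
  then have sP: "(\<Sum>\<mu>\<in>P. \<mu> ?t * of_nat (dim (wsp \<mu>))) = 0"
    using sA sN fin by (simp add: sum.union_disjoint)
  let ?d = "\<lambda>\<mu>. int (dim (wsp \<mu>))"
  \<comment> \<open>Total dimensions and k-weighted dimensions of the parts up to and above
    \<beta>.\<close>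
  define DN DP KN KP where "DN = (\<Sum>\<mu>\<in>N. ?d \<mu>)" "DP = (\<Sum>\<mu>\<in>P. ?d \<mu>)"
    "KN = (\<Sum>\<mu>\<in>N. k \<mu> * ?d \<mu>)" "KP = (\<Sum>\<mu>\<in>P. k \<mu> * ?d \<mu>)"
  note defs = this
  have "\<beta> ?t * of_int DN = - (\<alpha> ?t * of_int KN)" "\<beta> ?t * of_int DP = - (\<alpha> ?t * of_int KP)"
    unfolding defs
    by (intro trace_string_linear[OF \<alpha> root_weight[OF \<beta>] AW(2) _ sN] k, simp add: N_def)
      (intro trace_string_linear[OF \<alpha> root_weight[OF \<beta>] AW(3) _ sP] k, simp add: P_def)
  then have "\<alpha> ?t * of_int KN = - (\<beta> ?t * of_int DN)" "\<alpha> ?t * of_int KP = - (\<beta> ?t * of_int DP)"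
    by simp_all
  \<comment> \<open>Eliminating \<beta>(t) leaves DN KP = DP KN, an equation between integers. Its
    left side is positive and its right side is not, as k is at most 0 on N and positive on
    P.\<close>
  then have "of_int DN * (\<alpha> ?t * of_int KP) = of_int DP * (\<alpha> ?t * of_int KN)" by simp
  then have "\<alpha> ?t * of_int (DN * KP) = \<alpha> ?t * of_int (DP * KN)"
    by (simp add: mult.left_commute)
  then have "of_int (DN * KP) = (of_int (DP * KN) :: 'f)" using at by (metis mult_left_cancel)
  then have eq: "DN * KP = DP * KN" by (metis of_int_eq_iff)
  have "?d \<beta> \<le> DN" unfolding defs
    using \<beta>A k\<beta> fin by (intro member_le_sum[of _ N ?d]) (auto simp: N_def)
  then have DN: "DN > 0" using dim_wsp[OF root_weight[OF \<beta>]] by linarith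
  have abP: "\<alpha> + \<beta> \<in> P" using Aup[OF \<beta>A root_weight[OF ab]] k\<beta> by (simp add: P_def)
  have "k (\<alpha> + \<beta>) * ?d (\<alpha> + \<beta>) \<le> KP" unfolding defs
    using abP fin by (intro member_le_sum[of _ P "\<lambda>\<mu>. k \<mu> * ?d \<mu>"]) (auto simp: P_def)
  moreover have "k (\<alpha> + \<beta>) * ?d (\<alpha> + \<beta>) > 0"
    using abP dim_wsp[OF root_weight[OF ab]]
      by (auto simp: P_def simp del: dim_eq_0 intro!: mult_pos_pos)
  ultimately have KP: "KP > 0" by linarith
  have "KN \<le> 0" unfolding defs by (intro sum_nonpos mult_nonpos_nonneg) (auto simp: N_def)
  moreover have "DP \<ge> 0" unfolding defs by (intro sum_nonneg) auto
  ultimately have "DP * KN \<le> 0" by (simp add: mult_nonneg_nonpos)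
  then show False using eq DN KP by (metis mult_pos_pos not_less)
qed

end

section \<open>Subspaces complementary to the power series\<close>

lemma power_series_iff: "f \<in> power_series \<longleftrightarrow> (\<forall>n<0. f $$ n = 0)"
proof
  assume "\<forall>n<0. f $$ n = 0"
  then have "f = fps_to_fls (fls_regpart f)" by (intro fls_eqI) auto
  then show "f \<in> power_series" unfolding power_series_def by blast
qed (auto simp: power_series_def)

lemma fls_lower_bound:
  obtains N where "\<And>n. n < - int N \<Longrightarrow> f $$ n = 0"
proof -
  obtain N where N: "\<forall>n>N. f $$ (- int n) = 0" by (rule fls_nth_vanishes_below_natE)
  have "f $$ n = 0" if "n < - int N" for n
    using that N[rule_format, of "nat (- n)"] by auto
  then show thesis using that by blast
qed

context fd_lie_algebra
begin

section \<open>Coefficients and brackets of Laurent series\<close>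

definition monomial :: "nat \<Rightarrow> 'g \<Rightarrow> 'g fls" where
  "monomial k b = fls_shift (int k) (fls_const b)"

lemma monomial_nth [simp]: "monomial k b $$ n = (if n = - int k then b else 0)"
  by (auto simp: monomial_def)

lemma monomial_add: "monomial k (b + c) = monomial k b + monomial k c"
  and monomial_scale: "monomial k (r *s b) = fls_scale r (monomial k b)"
  and monomial_diff: "monomial k (b - c) = monomial k b - monomial k c"
  and monomial_zero [simp]: "monomial k 0 = 0"
  by (auto intro!: fls_eqI simp: fls_nth_sum)

lemma shift_monomial: "fls_shift 1 (monomial k b) = monomial (Suc k) b"
  by (rule fls_eqI) auto

lemma monomial_0: "monomial 0 b = fls_const b"
  by (simp add: monomial_def)

lemma sum_monomial_nth:
  "(\<Sum>k\<le>N. monomial k (c k)) $$ n = (if n \<le> 0 \<and> - int N \<le> n then c (nat (- n)) else 0)"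
proof (cases "n \<le> 0 \<and> - int N \<le> n")
  case True
  then have "(\<Sum>k\<le>N. monomial k (c k)) $$ n = (\<Sum>k\<le>N. if k = nat (- n) then c k else 0)"
    unfolding fls_nth_sum by (intro sum.cong) auto
  then show ?thesis using True by (simp add: nat_le_iff)
next
  case False
  then show ?thesis unfolding fls_nth_sum by (auto intro!: sum.neutral)
qed

lemma inverse_poly_expansion:
  assumes "\<And>n. n > 0 \<Longrightarrow> f $$ n = 0" "\<And>n. n < - int N \<Longrightarrow> f $$ n = 0"
  shows "f = (\<Sum>k\<le>N. monomial k (f $$ (- int k)))"
  by (rule fls_eqI) (use assms in \<open>auto simp: sum_monomial_nth not_le\<close>)

lemma inverse_polys_induct [consumes 1, case_names zero add monomial]:
  assumes f: "f \<in> inverse_polys A"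
    and zero: "P 0" and add: "\<And>f g. P f \<Longrightarrow> P g \<Longrightarrow> P (f + g)"
    and mono: "\<And>k b. b \<in> A \<Longrightarrow> P (monomial k b)"
  shows "P f"
proof -
  obtain N where N: "\<And>n. n < - int N \<Longrightarrow> f $$ n = 0"
    using fls_lower_bound[of f] by blast
  have "P (\<Sum>k\<in>K. monomial k (f $$ (- int k)))" if "finite K" for K
    using that by (induction K) (use zero add mono f in \<open>auto simp: inverse_polys_def\<close>)
  from this[of "{..N}"] show ?thesis
    using inverse_poly_expansion[of f N] N f by (simp add: inverse_polys_def)
qed

lemma monomial_inverse_polys: "0 \<in> A \<Longrightarrow> b \<in> A \<Longrightarrow> monomial k b \<in> inverse_polys A"
  by (auto simp: inverse_polys_def)

lemma subspace_inverse_polys: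
  assumes "subspace A"
  shows "fls.subspace (inverse_polys A)"
  using assms
  by (intro fls.subspaceI) (auto simp: inverse_polys_def subspace_0 subspace_add subspace_scale)

lemma subspace_power_series: "fls.subspace power_series"
  by (rule fls.subspaceI) (auto simp: power_series_iff)

text \<open>The subdegree of a sum is not determined by those of the summands. Arbitrary lower
  bounds give the convolutions a common range, which makes bilinearity a termwise matter.\<close>

lemma fls_bracket_nth_bound:
  assumes "\<And>i. i < a \<Longrightarrow> f $$ i = 0" "\<And>i. i < b \<Longrightarrow> g $$ i = 0"
  shows "fls_bracket f g $$ n = (\<Sum>i=a..n-b. bracket (f $$ i) (g $$ (n - i)))"
proof -
  let ?h = "\<lambda>i. bracket (f $$ i) (g $$ (n - i))"
  let ?I = "{i \<in> {fls_subdegree f..n - fls_subdegree g}. ?h i \<noteq> 0}"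
  let ?J = "{i \<in> {a..n - b}. ?h i \<noteq> 0}"
  have eq: "?I = ?J"
  proof (intro set_eqI)
    fix i
    have "i \<ge> fls_subdegree f \<and> n - i \<ge> fls_subdegree g \<and> i \<ge> a \<and> n - i \<ge> b" if "?h i \<noteq> 0"
    proof -
      have "f $$ i \<noteq> 0" "g $$ (n - i) \<noteq> 0" using that by auto
      then show ?thesis using assms by (metis fls_subdegree_leI not_le)
    qed
    then show "i \<in> ?I \<longleftrightarrow> i \<in> ?J" by auto
  qed
  have "fls_bracket f g $$ n = (\<Sum>i\<in>?I. ?h i)"
    unfolding fls_bracket_nth by (intro sum.mono_neutral_right) auto
  also have "\<dots> = (\<Sum>i\<in>?J. ?h i)" unfolding eq ..
  also have "\<dots> = (\<Sum>i=a..n-b. ?h i)" by (intro sum.mono_neutral_left) auto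
  finally show ?thesis .
qed

lemma fls_bracket_add_left: "fls_bracket (f + f') g = fls_bracket f g + fls_bracket f' g"
proof (rule fls_eqI)
  fix n
  let ?a = "min (fls_subdegree f) (fls_subdegree f')"
  have "fls_bracket (f + f') g $$ n
      = (\<Sum>i=?a..n - fls_subdegree g. bracket ((f + f') $$ i) (g $$ (n - i)))"
    by (rule fls_bracket_nth_bound) auto
  also have "\<dots> = (\<Sum>i=?a..n - fls_subdegree g. bracket (f $$ i) (g $$ (n - i)))
      + (\<Sum>i=?a..n - fls_subdegree g. bracket (f' $$ i) (g $$ (n - i)))"
    by (simp add: bracket_add_left sum.distrib)
  also have "\<dots> = fls_bracket f g $$ n + fls_bracket f' g $$ n"
    by (subst (1 2) fls_bracket_nth_bound[where a = ?a and b = "fls_subdegree g"]) auto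
  finally show "fls_bracket (f + f') g $$ n = (fls_bracket f g + fls_bracket f' g) $$ n" by simp
qed

lemma fls_bracket_add_right: "fls_bracket f (g + g') = fls_bracket f g + fls_bracket f g'"
proof (rule fls_eqI)
  fix n
  let ?b = "min (fls_subdegree g) (fls_subdegree g')"
  have "fls_bracket f (g + g') $$ n
      = (\<Sum>i=fls_subdegree f..n - ?b. bracket (f $$ i) ((g + g') $$ (n - i)))"
    by (rule fls_bracket_nth_bound) auto
  also have "\<dots> = (\<Sum>i=fls_subdegree f..n - ?b. bracket (f $$ i) (g $$ (n - i)))
      + (\<Sum>i=fls_subdegree f..n - ?b. bracket (f $$ i) (g' $$ (n - i)))"
    by (simp add: bracket_add_right sum.distrib)
  also have "\<dots> = fls_bracket f g $$ n + fls_bracket f g' $$ n"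
    by (subst (1 2) fls_bracket_nth_bound[where a = "fls_subdegree f" and b = ?b]) auto
  finally show "fls_bracket f (g + g') $$ n = (fls_bracket f g + fls_bracket f g') $$ n" by simp
qed

lemma fls_bracket_monomial:
  "fls_bracket (monomial k b) (monomial l c) = monomial (k + l) (bracket b c)"
proof (rule fls_eqI)
  fix n
  have "fls_bracket (monomial k b) (monomial l c) $$ n
      = (\<Sum>i=- int k..n - - int l. bracket (monomial k b $$ i) (monomial l c $$ (n - i)))"
    by (rule fls_bracket_nth_bound) auto
  also have "\<dots> = (\<Sum>i=- int k..n + int l. if i = - int k then bracket b (monomial l c $$ (n - i))
      else 0)"
    by (intro sum.cong) auto
  also have "\<dots> = monomial (k + l) (bracket b c) $$ n" by auto
  finally show "fls_bracket (monomial k b) (monomial l c) $$ n = monomial (k + l) (bracket b c) $$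
      n" .
qed

lemma fls_bracket_zero [simp]: "fls_bracket 0 g = 0" "fls_bracket f 0 = 0"
  using fls_bracket_add_left[of 0 0 g] fls_bracket_add_right[of f 0 0] by simp_all

lemma fls_bracket_neg: "fls_bracket (- f) g = - fls_bracket f g" "fls_bracket f (- g) = -
    fls_bracket f g"
  using fls_bracket_add_left[of f "- f" g] fls_bracket_add_right[of f g "- g"]
  by (simp_all add: eq_neg_iff_add_eq_0 add.commute)

lemma fls_bracket_diff: "fls_bracket (f - f') g = fls_bracket f g - fls_bracket f' g"
  "fls_bracket f (g - g') = fls_bracket f g - fls_bracket f g'"
  using fls_bracket_add_left[of f "- f'" g] fls_bracket_add_right[of f g "- g'"]
  by (simp_all add: fls_bracket_neg)

section \<open>The image of x^-1 - \<Phi> on polynomials in x^-1\<close>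

definition twist :: "('g \<Rightarrow> 'g) \<Rightarrow> 'g fls \<Rightarrow> 'g fls" where
  "twist \<Phi> f = fls_shift 1 f - fls_map \<Phi> f"

definition twist_space :: "('g \<Rightarrow> 'g) \<Rightarrow> 'g fls set" where
  "twist_space \<Phi> = twist \<Phi> ` inverse_polys UNIV"

lemma twist_nth: "\<Phi> 0 = 0 \<Longrightarrow> twist \<Phi> f $$ n = f $$ (n + 1) - \<Phi> (f $$ n)"
  by (simp add: twist_def fls_map_nth)

lemma twist_add: "lin \<Phi> \<Longrightarrow> twist \<Phi> (f + g) = twist \<Phi> f + twist \<Phi> g"
  by (rule fls_eqI) (simp add: twist_nth lin_zero lin_add)

lemma twist_scale: "lin \<Phi> \<Longrightarrow> twist \<Phi> (fls_scale c f) = fls_scale c (twist \<Phi> f)"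
  by (rule fls_eqI) (simp add: twist_nth lin_zero lin_scale scale_right_diff_distrib)

lemma twist_zero [simp]: "lin \<Phi> \<Longrightarrow> twist \<Phi> 0 = 0"
  by (rule fls_eqI) (simp add: twist_nth lin_zero)

lemma twist_monomial: "\<Phi> 0 = 0 \<Longrightarrow> twist \<Phi> (monomial k b) = monomial (Suc k) b - monomial k (\<Phi> b)"
  by (rule fls_eqI) (auto simp: twist_nth)

lemma subspace_twist_image:
  assumes "lin \<Phi>" "subspace A"
  shows "fls.subspace (twist \<Phi> ` inverse_polys A)"
proof (rule fls.subspaceI)
  note S = subspace_inverse_polys[OF assms(2)]
  show "0 \<in> twist \<Phi> ` inverse_polys A"
    using fls.subspace_0[OF S] twist_zero[OF assms(1)] by (metis image_eqI)
  fix u v assume "u \<in> twist \<Phi> ` inverse_polys A" "v \<in> twist \<Phi> ` inverse_polys A"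
  then show "u + v \<in> twist \<Phi> ` inverse_polys A"
    using fls.subspace_add[OF S] by (auto simp flip: twist_add[OF assms(1)])
next
  fix c u assume "u \<in> twist \<Phi> ` inverse_polys A"
  then show "fls_scale c u \<in> twist \<Phi> ` inverse_polys A"
    using fls.subspace_scale[OF subspace_inverse_polys[OF assms(2)]]
    by (auto simp flip: twist_scale[OF assms(1)])
qed

lemma subspace_twist_space: "lin \<Phi> \<Longrightarrow> fls.subspace (twist_space \<Phi>)"
  unfolding twist_space_def by (rule subspace_twist_image) auto

lemma twist_monomial_mem: "lin \<Phi> \<Longrightarrow> monomial (Suc k) b - monomial k (\<Phi> b) \<in> twist_space \<Phi>"
  unfolding twist_space_def
  by (intro image_eqI[of _ _ "monomial k b"]) (auto simp: twist_monomial lin_zero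
      monomial_inverse_polys)

lemma twist_space_induct [consumes 2, case_names zero add generator]:
  assumes "f \<in> twist_space \<Phi>" "lin \<Phi>"
    and "P 0" "\<And>f g. P f \<Longrightarrow> P g \<Longrightarrow> P (f + g)"
    and "\<And>k b. P (monomial (Suc k) b - monomial k (\<Phi> b))"
  shows "P f"
proof -
  obtain g where g: "g \<in> inverse_polys UNIV" "f = twist \<Phi> g"
    using assms(1) by (auto simp: twist_space_def)
  have "P (twist \<Phi> g)"
    using g(1) by (induction g rule: inverse_polys_induct)
      (use assms in \<open>auto simp: twist_add twist_monomial lin_zero\<close>)
  then show ?thesis using g by simp
qed

text \<open>Modulo the image of x^-1 - \<Phi>, each factor x^-1 may be traded for \<Phi>; the p
  trades telescope.\<close>

lemma twist_space_power: "lin \<Phi> \<Longrightarrow> monomial (k + p) b - monomial k ((\<Phi> ^^ p) b) \<in> twist_space \<Phi>"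
proof (induction p arbitrary: b)
  case 0
  then show ?case using fls.subspace_0[OF subspace_twist_space] by simp
next
  case (Suc p)
  have "(monomial (Suc (k + p)) b - monomial (k + p) (\<Phi> b))
      + (monomial (k + p) (\<Phi> b) - monomial k ((\<Phi> ^^ p) (\<Phi> b))) \<in> twist_space \<Phi>"
    using Suc twist_monomial_mem by (intro fls.subspace_add subspace_twist_space) auto
  then show ?case by (simp add: funpow_swap1)
qed

lemma twist_space_inverse_polys: "lin \<Phi> \<Longrightarrow> twist_space \<Phi> \<subseteq> inverse_polys UNIV"
  by (auto simp: twist_space_def inverse_polys_def twist_nth lin_zero)

text \<open>Vanishing negative coefficients of (x^-1 - \<Phi>) g say that the coefficient of g at -k
  is \<Phi> of the one at -k - 1. As g has finite depth, the recursion forces g = 0 from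
  below.\<close>

lemma twist_space_inter:
  assumes "lin \<Phi>" "f \<in> twist_space \<Phi>" "f \<in> power_series"
  shows "f = 0"
proof -
  obtain g where g: "g \<in> inverse_polys UNIV" "f = twist \<Phi> g"
    using assms(2) by (auto simp: twist_space_def)
  obtain N where N: "\<And>n. n < - int N \<Longrightarrow> g $$ n = 0"
    using fls_lower_bound[of g] by blast
  have rec: "g $$ (- int k) = \<Phi> (g $$ (- int (Suc k)))" for k
  proof -
    have "twist \<Phi> g $$ (- int (Suc k)) = 0" using assms(3) g by (auto simp: power_series_iff)
    then show ?thesis using assms(1) by (simp add: twist_nth lin_zero)
  qed
  have "g $$ (- int k) = 0" if "k \<le> Suc N" for k
    using that
  proof (induction rule: inc_induct)
    case base
    show ?case by (rule N) simp
  next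
    case (step k)
    then show ?case using rec[of k] assms(1) by (simp add: lin_zero)
  qed
  then have low: "g $$ (- int k) = 0" if "k \<le> Suc N" for k using that .
  have "g $$ n = 0" for n
  proof (cases "n > 0 \<or> n < - int N")
    case True
    then show ?thesis using N[of n] g(1) by (auto simp: inverse_polys_def)
  next
    case False
    then show ?thesis using low[of "nat (- n)"] by (simp add: nat_le_iff)
  qed
  then have "g = 0" by (intro fls_eqI) auto
  then show ?thesis using g assms(1) by simp
qed

lemma complementary_twist_space:
  assumes "lin \<Phi>"
  shows "complementary power_series (twist_space \<Phi>)"
  unfolding complementary_def
proof
  let ?T = "{u + v |u v. u \<in> power_series \<and> v \<in> twist_space \<Phi>}"
  note P = subspace_power_series and W = subspace_twist_space[OF assms]
  have "f \<in> ?T" for f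
  proof -
    obtain N where N: "\<And>n. n < - int N \<Longrightarrow> f $$ n = 0"
      using fls_lower_bound[of f] by blast
    let ?m = "\<lambda>k. monomial k (f $$ (- int k))"
    \<comment> \<open>Every x^-k c of the polar part is replaced by the constant \<Phi>^k c modulo
      the twisted space, so the difference from f has no pole.\<close>
    let ?v = "\<Sum>k\<le>N. ?m k - monomial 0 ((\<Phi> ^^ k) (f $$ (- int k)))"
    have "?v \<in> twist_space \<Phi>"
      using twist_space_power[OF assms, of 0] by (intro fls.subspace_sum W) auto
    moreover have "(\<Sum>k\<le>N. monomial 0 ((\<Phi> ^^ k) (f $$ (- int k)))) $$ n = 0" if "n < 0" for n
      using that by (simp add: fls_nth_sum)
    then have "f - ?v \<in> power_series"
      using N by (auto simp: power_series_iff sum_subtractf sum_monomial_nth)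
    ultimately show ?thesis by (intro CollectI exI[of _ "f - ?v"] exI[of _ ?v]) auto
  qed
  then show "?T = UNIV" by auto
  show "power_series \<inter> twist_space \<Phi> = {0}"
    using twist_space_inter[OF assms] fls.subspace_0[OF P] fls.subspace_0[OF W] by auto
qed

text \<open>The reduction of x^(-k-1) b to a constant produces \<Phi>^(k+1) b; these powers are the
  source of the geometric series in the solution.\<close>

lemma assoc_elem_twist_space:
  assumes "lin \<Phi>"
  shows "assoc_elem (twist_space \<Phi>) k b = monomial (Suc k) b - monomial 0 ((\<Phi> ^^ Suc k) b)"
  unfolding assoc_elem_def
proof (rule the_equality)
  have m: "fls_shift (int k + 1) (fls_const b) = monomial (Suc k) b"
    by (simp add: monomial_def add.commute)
  let ?w = "monomial (Suc k) b - monomial 0 ((\<Phi> ^^ Suc k) b)"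
  show *: "?w \<in> twist_space \<Phi> \<and> ?w - fls_shift (int k + 1) (fls_const b) \<in> power_series"
    using twist_space_power[OF assms, of 0 "Suc k"] unfolding m by (auto simp: power_series_iff)
  fix w assume w: "w \<in> twist_space \<Phi> \<and> w - fls_shift (int k + 1) (fls_const b) \<in> power_series"
  have "w - ?w \<in> twist_space \<Phi>"
    using w * fls.subspace_diff[OF subspace_twist_space[OF assms]] by blast
  moreover have "w - ?w \<in> power_series" using w * by (auto simp: power_series_iff)
  ultimately show "w = ?w" using twist_space_inter[OF assms] by force
qed

definition nijenhuis :: "('g \<Rightarrow> 'g) \<Rightarrow> bool" where
  "nijenhuis \<Phi> \<longleftrightarrow> (\<forall>b c. bracket (\<Phi> b) (\<Phi> c)
     = \<Phi> (bracket (\<Phi> b) c + bracket b (\<Phi> c)) - \<Phi> (\<Phi> (bracket b c)))"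

text \<open>Reducing the two higher powers of x^-1 by x^-1 -> \<Phi> leaves the torsion of \<Phi> as
  the sole remainder, at exponent -(k + l).\<close>

lemma bracket_generators:
  "fls_bracket (monomial (Suc k) b - monomial k (\<Phi> b)) (monomial (Suc l) c - monomial l (\<Phi> c))
   = (monomial (k + l + 2) (bracket b c) - monomial (k + l) ((\<Phi> ^^ 2) (bracket b c)))
     - (monomial (Suc (k + l)) (bracket (\<Phi> b) c + bracket b (\<Phi> c))
        - monomial (k + l) (\<Phi> (bracket (\<Phi> b) c + bracket b (\<Phi> c))))
     + monomial (k + l) (bracket (\<Phi> b) (\<Phi> c)
        - (\<Phi> (bracket (\<Phi> b) c + bracket b (\<Phi> c)) - \<Phi> (\<Phi> (bracket b c))))"
  by (simp add: fls_bracket_diff fls_bracket_monomial monomial_add monomial_diff numeral_2_eq_2)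

lemma bracket_generators_remainder:
  assumes "lin \<Phi>"
  shows "fls_bracket (monomial (Suc k) b - monomial k (\<Phi> b)) (monomial (Suc l) c - monomial l (\<Phi> c))
    - monomial (k + l) (bracket (\<Phi> b) (\<Phi> c)
        - (\<Phi> (bracket (\<Phi> b) c + bracket b (\<Phi> c)) - \<Phi> (\<Phi> (bracket b c)))) \<in> twist_space \<Phi>"
  unfolding bracket_generators add_diff_cancel_right'
  using assms by (intro fls.subspace_diff subspace_twist_space twist_space_power twist_monomial_mem)

lemma twist_space_bracket:
  assumes lin: "lin \<Phi>" and nij: "nijenhuis \<Phi>" and u: "u \<in> twist_space \<Phi>" and v: "v \<in> twist_space \<Phi>"
  shows "fls_bracket u v \<in> twist_space \<Phi>"
  using u lin
proof (induction u rule: twist_space_induct)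
  case zero
  then show ?case using fls.subspace_0[OF subspace_twist_space[OF lin]] by simp
next
  case (add f g)
  then show ?case by (simp add: fls_bracket_add_left fls.subspace_add[OF subspace_twist_space[OF
      lin]])
next
  case (generator k b)
  show ?case using v lin
  proof (induction v rule: twist_space_induct)
    case zero
    then show ?case using fls.subspace_0[OF subspace_twist_space[OF lin]] by simp
  next
    case (add f g)
    then show ?case by (simp add: fls_bracket_add_right fls.subspace_add[OF
        subspace_twist_space[OF lin]])
  next
    case (generator l c)
    then show ?case
      using bracket_generators_remainder[OF lin, of k b l c] nij
      by (simp add: nijenhuis_def)
  qed
qed

lemma regular_twist_space:
  assumes lin: "lin \<Phi>" and nij: "nijenhuis \<Phi>"
    and eq: "\<And>h x. h \<in> H \<Longrightarrow> \<Phi> (bracket h x) = bracket h (\<Phi> x)"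
  shows "regular_type0 H (twist_space \<Phi>)"
  unfolding regular_type0_def
proof (intro conjI ballI)
  note S = subspace_twist_space[OF lin]
  show "fls_shift 1 w \<in> twist_space \<Phi>" if "w \<in> twist_space \<Phi>" for w
    using that lin
  proof (induction w rule: twist_space_induct)
    case (generator k b)
    then show ?case using twist_monomial_mem[OF lin, of "Suc k" b] by (simp add: shift_monomial)
  qed (auto simp: fls.subspace_0[OF S] fls.subspace_add[OF S])
  show "fls_bracket (fls_const h) w \<in> twist_space \<Phi>" if "w \<in> twist_space \<Phi>" "h \<in> H" for h w
    using that(1) lin
  proof (induction w rule: twist_space_induct)
    case (generator k b)
    then show ?case
      using twist_monomial_mem[OF lin, of k "bracket h b"] eq[OF that(2)]
      by (simp add: fls_bracket_diff fls_bracket_monomial flip: monomial_0)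
  qed (auto simp: fls.subspace_0[OF S] fls.subspace_add[OF S] fls_bracket_add_right)
qed (use assms in \<open>auto simp: subspace_twist_space complementary_twist_space
      twist_space_bracket dest: twist_space_inverse_polys[THEN subsetD]\<close>)

lemma regular_is_twist_space:
  assumes W: "regular_type0 H W"
  obtains \<Phi> where "lin \<Phi>" "nijenhuis \<Phi>" "\<And>h x. h \<in> H \<Longrightarrow> \<Phi> (bracket h x) = bracket h (\<Phi> x)"
    "W = twist_space \<Phi>"
proof -
  have S: "fls.subspace W" and br: "\<And>u v. u \<in> W \<Longrightarrow> v \<in> W \<Longrightarrow> fls_bracket u v \<in> W"
    and compl: "complementary power_series W" and sh: "\<And>w. w \<in> W \<Longrightarrow> fls_shift 1 w \<in> W"
    and hW: "\<And>h w. h \<in> H \<Longrightarrow> w \<in> W \<Longrightarrow> fls_bracket (fls_const h) w \<in> W"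
    and inv: "W \<subseteq> inverse_polys UNIV"
    using W by (auto simp: regular_type0_def)
  have inter: "f = 0" if "f \<in> W" "f \<in> power_series" for f
    using compl that by (auto simp: complementary_def)
  have const0: "b = 0" if "monomial 0 b \<in> W" for b
  proof -
    have "monomial 0 b = 0" using that by (intro inter) (auto simp: power_series_iff)
    then have "monomial 0 b $$ 0 = 0" by simp
    then show ?thesis by simp
  qed
  \<comment> \<open>The component of x^-1 b in W differs from x^-1 b by a power series and contains
    no positive powers of x, so the difference is constant.\<close>
  have "\<exists>c. monomial 1 b - monomial 0 c \<in> W" for b
  proof -
    have "monomial 1 b \<in> {u + v |u v. u \<in> power_series \<and> v \<in> W}"
      using compl by (auto simp: complementary_def)
    then obtain u v where uv: "u \<in> power_series" "v \<in> W" "monomial 1 b = u + v" by auto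
    have "v = monomial 1 b - monomial 0 (u $$ 0)"
    proof (rule fls_eqI)
      fix n
      have "v $$ n = monomial 1 b $$ n - u $$ n" using uv(3)
        by (metis add_diff_cancel_left' fls_plus_nth)
      moreover have "u $$ n = 0" if "n < 0" using uv(1) that by (simp add: power_series_iff)
      moreover have "v $$ n = 0" if "n > 0" using uv(2) inv that by (auto simp: inverse_polys_def)
      ultimately show "v $$ n = (monomial 1 b - monomial 0 (u $$ 0)) $$ n"
        by (cases n "0::int" rule: linorder_cases) auto
    qed
    then show ?thesis using uv(2) by blast
  qed
  then obtain \<Phi> where \<Phi>: "\<And>b. monomial 1 b - monomial 0 (\<Phi> b) \<in> W" by metis
  \<comment> \<open>Uniqueness of the constant turns closure properties of W into identities for
    \<Phi>: linearity and compatibility with ad H follow by exhibiting suitable elements of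
    W.\<close>
  have uniq: "\<Phi> b = c" if "monomial 1 b - monomial 0 c \<in> W" for b c
  proof -
    have "(monomial 1 b - monomial 0 c) - (monomial 1 b - monomial 0 (\<Phi> b)) \<in> W"
      using fls.subspace_diff[OF S] that \<Phi> by blast
    then have "monomial 0 (\<Phi> b - c) \<in> W" by (simp add: monomial_diff)
    then show ?thesis using const0 by force
  qed
  have lin: "lin \<Phi>"
  proof (rule linI)
    fix x y
    have "(monomial 1 x - monomial 0 (\<Phi> x)) + (monomial 1 y - monomial 0 (\<Phi> y)) \<in> W"
      using fls.subspace_add[OF S] \<Phi> by blast
    also have "(monomial 1 x - monomial 0 (\<Phi> x)) + (monomial 1 y - monomial 0 (\<Phi> y))
        = monomial 1 (x + y) - monomial 0 (\<Phi> x + \<Phi> y)"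
      by (simp add: monomial_add)
    finally show "\<Phi> (x + y) = \<Phi> x + \<Phi> y" by (rule uniq)
  next
    fix c x
    have "fls_scale c (monomial 1 x - monomial 0 (\<Phi> x)) \<in> W"
      by (intro fls.subspace_scale S \<Phi>)
    then have "monomial 1 (c *s x) - monomial 0 (c *s \<Phi> x) \<in> W"
      by (simp add: monomial_scale fls.scale_right_diff_distrib)
    then show "\<Phi> (c *s x) = c *s \<Phi> x" by (rule uniq)
  qed
  have eq: "\<Phi> (bracket h x) = bracket h (\<Phi> x)" if "h \<in> H" for h x
  proof (rule uniq)
    show "monomial 1 (bracket h x) - monomial 0 (bracket h (\<Phi> x)) \<in> W"
      using hW[OF that \<Phi>[of x]]
      by (simp add: fls_bracket_diff fls_bracket_monomial flip: monomial_0)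
  qed
  have gen: "monomial (Suc k) b - monomial k (\<Phi> b) \<in> W" for k b
  proof (induction k)
    case (Suc k)
    then show ?case using sh[OF Suc] by (simp add: shift_monomial)
  qed (use \<Phi> in simp)
  have sub: "twist_space \<Phi> \<subseteq> W"
  proof
    fix f assume "f \<in> twist_space \<Phi>"
    then show "f \<in> W" using lin
      by (induction rule: twist_space_induct) (auto simp: fls.subspace_0[OF S] fls.subspace_add[OF
          S] gen)
  qed
  have "W \<subseteq> twist_space \<Phi>"
  proof
    fix w assume w: "w \<in> W"
    have "w \<in> {u + v |u v. u \<in> power_series \<and> v \<in> twist_space \<Phi>}"
      using complementary_twist_space[OF lin] by (auto simp: complementary_def)
    then obtain u v where uv: "u \<in> power_series" "v \<in> twist_space \<Phi>" "w = u + v" by auto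
    have "w - v \<in> W" using w uv(2) sub fls.subspace_diff[OF S] by blast
    then have "u = 0" using uv by (intro inter) auto
    then show "w \<in> twist_space \<Phi>" using uv by simp
  qed
  then have WT: "W = twist_space \<Phi>" using sub by auto
  have "nijenhuis \<Phi>" unfolding nijenhuis_def
  proof (intro allI)
    fix b c
    let ?r = "bracket (\<Phi> b) (\<Phi> c)
        - (\<Phi> (bracket (\<Phi> b) c + bracket b (\<Phi> c)) - \<Phi> (\<Phi> (bracket b c)))"
    \<comment> \<open>For two generators with k = l = 0 the remainder is the constant torsion, which
      lies in W and must vanish.\<close>
    let ?p = "fls_bracket (monomial (Suc 0) b - monomial 0 (\<Phi> b)) (monomial (Suc 0) c - monomial 0
        (\<Phi> c))"
    have "?p - (?p - monomial (0 + 0) ?r) \<in> W"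
      using bracket_generators_remainder[OF lin, of 0 b 0 c] sub gen[of 0] br
        fls.subspace_diff[OF S] by blast
    then have "monomial 0 ?r \<in> W" by simp
    then show "bracket (\<Phi> b) (\<Phi> c)
        = \<Phi> (bracket (\<Phi> b) c + bracket b (\<Phi> c)) - \<Phi> (\<Phi> (bracket b c))"
      using const0 by force
  qed
  then show thesis using that lin eq WT by blast
qed

end

section \<open>The root space decomposition\<close>

context simple_lie_algebra_data
begin

lemma finite_roots: "finite (roots H)"
  using finite_weights by (simp add: roots_eq)

lemma weights_eq: "weights = insert 0 (roots H)"
  using zero_weight by (auto simp: roots_eq)

lemma zero_not_root: "0 \<notin> roots H"
  by (simp add: roots_eq)

lemma killing_E_E:
  assumes \<alpha>: "\<alpha> \<in> roots H" and \<beta>: "\<beta> \<in> roots H" and ne: "\<beta> \<noteq> - \<alpha>"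
  shows "killing (E \<alpha>) (E \<beta>) = 0"
proof -
  have "\<exists>h\<in>H. \<beta> h \<noteq> - \<alpha> h"
    using ne weight_ext[OF root_weight[OF \<beta>], of "- \<alpha>"] weight_outside[OF root_weight[OF \<alpha>]] by auto
  then obtain h where "h \<in> H" "\<alpha> h + \<beta> h \<noteq> 0" by (auto simp: add_eq_0_iff)
  then show ?thesis using E_wsp \<alpha> \<beta> by (intro killing_wsp[of _ \<alpha> _ \<beta> h])
qed

lemma killing_H_E:
  assumes h: "h \<in> H" and \<alpha>: "\<alpha> \<in> roots H"
  shows "killing h (E \<alpha>) = 0"
proof -
  obtain k where "k \<in> H" "\<alpha> k \<noteq> 0"
    using root_nonzero[OF \<alpha>] weight_outside[OF root_weight[OF \<alpha>]] by (auto simp: fun_eq_iff)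
  then show ?thesis using E_wsp[OF \<alpha>] h H_wsp by (intro killing_wsp[of _ 0 _ \<alpha> k]) auto
qed

definition coef :: "('g \<Rightarrow> 'f) \<Rightarrow> 'g \<Rightarrow> 'f" where
  "coef \<alpha> x = killing x (E (- \<alpha>))"

text \<open>An explicit formula, visibly linear, for the projection that \<open>cartan_proj\<close>
  specifies by a description. The coefficient along \<open>E \<alpha>\<close> is read off by pairing
  with \<open>E (- \<alpha>)\<close>.\<close>

definition hproj :: "'g \<Rightarrow> 'g" where
  "hproj x = x - (\<Sum>\<alpha>\<in>roots H. coef \<alpha> x *s E \<alpha>)"

lemma coef_add: "coef \<alpha> (x + y) = coef \<alpha> x + coef \<alpha> y"
  and coef_scale: "coef \<alpha> (c *s x) = c * coef \<alpha> x"
  and coef_sum: "coef \<alpha> (\<Sum>i\<in>I. f i) = (\<Sum>i\<in>I. coef \<alpha> (f i))"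
  by (simp_all add: coef_def killing_add_left killing_scale_left killing_sum)

lemma coef_E: "\<alpha> \<in> roots H \<Longrightarrow> \<beta> \<in> roots H \<Longrightarrow> coef \<alpha> (E \<beta>) = (if \<beta> = \<alpha> then 1 else 0)"
  using killing_E_E[of \<beta> "- \<alpha>"] neg_root killing_E by (auto simp: coef_def)

lemma coef_H: "h \<in> H \<Longrightarrow> \<alpha> \<in> roots H \<Longrightarrow> coef \<alpha> h = 0"
  by (simp add: coef_def killing_H_E neg_root)

lemma lin_hproj: "lin hproj"
  by (rule linI) (auto simp: hproj_def coef_add coef_scale scale_left_distrib sum.distrib
      scale_right_diff_distrib scale_sum_right)

lemma hproj_id: "h \<in> H \<Longrightarrow> hproj h = h"
  by (simp add: hproj_def coef_H)

lemma hproj_E: "\<alpha> \<in> roots H \<Longrightarrow> hproj (E \<alpha>) = 0"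
proof -
  assume \<alpha>: "\<alpha> \<in> roots H"
  have "(\<Sum>\<beta>\<in>roots H. coef \<beta> (E \<alpha>) *s E \<beta>) = (\<Sum>\<beta>\<in>roots H. if \<beta> = \<alpha> then E \<alpha> else 0)"
    using \<alpha> by (intro sum.cong) (auto simp: coef_E)
  then show ?thesis using \<alpha> finite_roots by (simp add: hproj_def)
qed

lemma hproj_decomposition: "x = hproj x + (\<Sum>\<alpha>\<in>roots H. coef \<alpha> x *s E \<alpha>)"
  by (simp add: hproj_def)

lemma hproj_H: "hproj x \<in> H"
proof -
  have "x \<in> {x. hproj x \<in> H}"
  proof (rule weight_induct)
    show "subspace {x. hproj x \<in> H}"
      using lin_hproj subspace_H
      by (intro subspaceI) (auto simp: lin_add lin_scale lin_zero subspace_0 subspace_add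
          subspace_scale)
    show "wsp \<mu> \<subseteq> {x. hproj x \<in> H}" if \<mu>: "\<mu> \<in> weights" for \<mu>
    proof (cases "\<mu> = 0")
      case True
      then show ?thesis by (auto simp: wsp_zero hproj_id)
    next
      case False
      then have "\<mu> \<in> roots H" using \<mu> by (simp add: weights_eq)
      then show ?thesis
        using hproj_E lin_scale[OF lin_hproj] subspace_0[OF subspace_H]
        by (auto simp: wsp_root span_singleton)
    qed
  qed
  then show ?thesis by simp
qed

lemma root_basis_induct:
  assumes "subspace U" "H \<subseteq> U" "\<And>\<alpha>. \<alpha> \<in> roots H \<Longrightarrow> E \<alpha> \<in> U"
  shows "x \<in> U"
  using assms hproj_H by (subst hproj_decomposition) (auto intro!: subspace_add subspace_sum
      subspace_scale)

lemma cartan_proj_eq: "cartan_proj H x = hproj x"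
  unfolding cartan_proj_def
proof (rule the_equality)
  have "x - hproj x = (\<Sum>\<alpha>\<in>roots H. coef \<alpha> x *s E \<alpha>)" by (simp add: hproj_def)
  also have "\<dots> \<in> span (\<Union>\<alpha>\<in>roots H. root_space H \<alpha>)"
    using E_mem by (intro span_sum span_scale span_base) auto
  finally show "hproj x \<in> H \<and> x - hproj x \<in> span (\<Union>\<alpha>\<in>roots H. root_space H \<alpha>)"
    using hproj_H by simp
  fix h assume h: "h \<in> H \<and> x - h \<in> span (\<Union>\<alpha>\<in>roots H. root_space H \<alpha>)"
  have "subspace {y. hproj y = 0}"
    using lin_hproj by (intro subspaceI) (auto simp: lin_add lin_scale lin_zero)
  moreover have "hproj y = 0" if "\<alpha> \<in> roots H" "y \<in> root_space H \<alpha>" for \<alpha> y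
    using that root_space_root hproj_E lin_scale[OF lin_hproj] by auto
  ultimately have "span (\<Union>\<alpha>\<in>roots H. root_space H \<alpha>) \<subseteq> {y. hproj y = 0}"
    by (intro span_minimal) auto
  then have "hproj (x - h) = 0" using h by auto
  then show "h = hproj x" using h by (simp add: lin_diff[OF lin_hproj] hproj_id)
qed

lemma bracket_E_E_cases:
  assumes "\<alpha> \<in> roots H" "\<beta> \<in> roots H"
  obtains "bracket (E \<alpha>) (E \<beta>) = 0"
  | "\<beta> = - \<alpha>"
  | c where "\<alpha> + \<beta> \<in> roots H" "bracket (E \<alpha>) (E \<beta>) = c *s E (\<alpha> + \<beta>)"
proof -
  have w: "bracket (E \<alpha>) (E \<beta>) \<in> wsp (\<alpha> + \<beta>)" using assms E_wsp bracket_wsp by blast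
  consider "\<alpha> + \<beta> = 0" | "\<alpha> + \<beta> \<in> roots H" | "\<alpha> + \<beta> \<notin> weights" by (auto simp: weights_eq)
  then show thesis
  proof cases
    case 1
    then show thesis using that(2) by (simp add: eq_neg_iff_add_eq_0 add.commute)
  next
    case 2
    then show thesis using w that(3) wsp_root[OF 2] by (auto simp: span_singleton)
  next
    case 3
    then show thesis
      using weight_bracket_mem[OF root_weight[OF assms(2)] root_weight[OF assms(1)] E_wsp[OF
          assms(1)] E_wsp[OF assms(2)]] that(1)
      by blast
  qed
qed

section \<open>Equivariant maps without Nijenhuis torsion\<close>

definition torsion :: "('g \<Rightarrow> 'g) \<Rightarrow> 'g \<Rightarrow> 'g \<Rightarrow> 'g" where
  "torsion \<Phi> b c = bracket (\<Phi> b) (\<Phi> c) - \<Phi> (bracket (\<Phi> b) c + bracket b (\<Phi> c)) + \<Phi> (\<Phi> (bracket b c))"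

lemma nijenhuis_torsion: "nijenhuis \<Phi> \<longleftrightarrow> (\<forall>b c. torsion \<Phi> b c = 0)"
  by (simp add: nijenhuis_def torsion_def algebra_simps add_eq_0_iff2 eq_neg_iff_add_eq_0)

lemma lin_torsion: "lin \<Phi> \<Longrightarrow> lin (torsion \<Phi> b)"
  by (rule linI) (simp_all add: torsion_def lin_add lin_scale bracket_add_right bracket_scale_right
      algebra_simps)

lemma torsion_anti: "lin \<Phi> \<Longrightarrow> torsion \<Phi> b c = - torsion \<Phi> c b"
  using bracket_anti[of b c] bracket_anti[of "\<Phi> b" c] bracket_anti[of b "\<Phi> c"] bracket_anti[of "\<Phi>
      b" "\<Phi> c"]
  by (simp add: torsion_def lin_add lin_neg lin_diff)

lemma torsion_E_E:
  assumes "lin \<Phi>" "\<Phi> (E \<alpha>) = a *s E \<alpha>" "\<Phi> (E \<beta>) = b *s E \<beta>"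
  shows "torsion \<Phi> (E \<alpha>) (E \<beta>) = op_minus \<Phi> a (op_minus \<Phi> b (bracket (E \<alpha>) (E \<beta>)))"
  using assms
  by (simp add: torsion_def op_minus_def bracket_scale_left bracket_scale_right lin_add lin_diff
      lin_scale
      algebra_simps)

lemma op_minus_E:
  assumes "lin \<Phi>" "\<Phi> (E \<gamma>) = g *s E \<gamma>"
  shows "op_minus \<Phi> a (op_minus \<Phi> b (c *s E \<gamma>)) = ((g - a) * (g - b) * c) *s E \<gamma>"
  using assms by (simp add: op_minus_def lin_scale lin_diff algebra_simps)

text \<open>The torsion is bilinear and antisymmetric, so H and the root vectors suffice as
  arguments. Pairs involving H are harmless because \<Phi> is scalar on root lines and H is abelian;
  \<open>sum\<close> and \<open>opp\<close> treat two root vectors.\<close>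

lemma nijenhuisI:
  assumes lin: "lin \<Phi>" and H: "\<And>h. h \<in> H \<Longrightarrow> \<Phi> h \<in> H"
    and E: "\<And>\<alpha>. \<alpha> \<in> roots H \<Longrightarrow> \<Phi> (E \<alpha>) = A \<alpha> *s E \<alpha>"
    and sum: "\<And>\<alpha> \<beta>. \<alpha> \<in> roots H \<Longrightarrow> \<beta> \<in> roots H \<Longrightarrow> \<alpha> + \<beta> \<in> roots H
      \<Longrightarrow> A (\<alpha> + \<beta>) = A \<alpha> \<or> A (\<alpha> + \<beta>) = A \<beta>"
    and opp: "\<And>\<alpha>. \<alpha> \<in> roots H
      \<Longrightarrow> op_minus \<Phi> (A \<alpha>) (op_minus \<Phi> (A (- \<alpha>)) (bracket (E \<alpha>) (E (- \<alpha>)))) = 0"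
  shows "nijenhuis \<Phi>"
proof -
  have sub: "subspace {c. torsion \<Phi> b c = 0}" for b
    using lin_torsion[OF lin, of b] by (intro subspaceI) (auto simp: lin_add lin_scale lin_zero)
  have HH: "torsion \<Phi> h h' = 0" if "h \<in> H" "h' \<in> H" for h h'
    using that H H_abelian lin by (simp add: torsion_def lin_zero)
  have HE: "torsion \<Phi> h (E \<alpha>) = 0" if "h \<in> H" "\<alpha> \<in> roots H" for h \<alpha>
    using that bracket_E[OF that(2)] H lin E[OF that(2)]
    by (simp add: torsion_def bracket_scale_right lin_add lin_scale algebra_simps)
  have EE: "torsion \<Phi> (E \<alpha>) (E \<beta>) = 0" if ab: "\<alpha> \<in> roots H" "\<beta> \<in> roots H" for \<alpha> \<beta>
  proof (cases rule: bracket_E_E_cases[OF ab])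
    case 1
    then show ?thesis using torsion_E_E[OF lin E[OF ab(1)] E[OF ab(2)]] lin
      by (simp add: op_minus_def lin_zero)
  next
    case 2
    then show ?thesis using torsion_E_E[OF lin E[OF ab(1)] E[OF ab(2)]] opp[OF ab(1)]
      by (simp del: uminus_apply)
  next
    case (3 c)
    then show ?thesis
      using torsion_E_E[OF lin E[OF ab(1)] E[OF ab(2)]] op_minus_E[OF lin E[OF 3(1)]] sum[OF ab 3(1)]
      by (auto simp del: plus_fun_apply)
  qed
  have Hc: "torsion \<Phi> h c = 0" if "h \<in> H" for h c
    using root_basis_induct[OF sub[of h], of c] HH HE that by blast
  have Ec: "torsion \<Phi> (E \<alpha>) c = 0" if "\<alpha> \<in> roots H" for \<alpha> c
    using root_basis_induct[OF sub[of "E \<alpha>"], of c] EE that HE torsion_anti[OF lin, of "E \<alpha>"] by auto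
  have "torsion \<Phi> c b = 0" for b c
    using root_basis_induct[OF sub[of c], of b] Hc Ec torsion_anti[OF lin, of c] by auto
  then show ?thesis by (simp add: nijenhuis_torsion)
qed

text \<open>The torsion is the product of the two eigenvalue differences with the structure constant
  c. That c is nonzero is what \<open>bracket_E_nonzero\<close> contributes.\<close>

lemma nijenhuis_sum_roots:
  assumes lin: "lin \<Phi>" and nij: "nijenhuis \<Phi>"
    and E: "\<And>\<alpha>. \<alpha> \<in> roots H \<Longrightarrow> \<Phi> (E \<alpha>) = A \<alpha> *s E \<alpha>"
    and ab: "\<alpha> \<in> roots H" "\<beta> \<in> roots H" "\<alpha> + \<beta> \<in> roots H"
  shows "A (\<alpha> + \<beta>) = A \<alpha> \<or> A (\<alpha> + \<beta>) = A \<beta>"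
proof -
  have nz: "bracket (E \<alpha>) (E \<beta>) \<noteq> 0" by (rule bracket_E_nonzero[OF ab])
  show ?thesis
  proof (cases rule: bracket_E_E_cases[OF ab(1,2)])
    case 1
    then show ?thesis using nz by simp
  next
    case 2
    then show ?thesis using ab(3) zero_not_root by simp
  next
    case (3 c)
    then have "((A (\<alpha> + \<beta>) - A \<alpha>) * (A (\<alpha> + \<beta>) - A \<beta>) * c) *s E (\<alpha> + \<beta>) = 0"
      using torsion_E_E[OF lin E[OF ab(1)] E[OF ab(2)]] op_minus_E[OF lin E[OF ab(3)]] nij
      by (simp add: nijenhuis_torsion del: plus_fun_apply)
    moreover have "c \<noteq> 0" using nz 3 by auto
    ultimately show ?thesis using E_nonzero[OF ab(3)] by simp
  qed
qed

text \<open>\<Phi> h commutes with H, hence normalises it.\<close>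

lemma equivariant_H:
  assumes "lin \<Phi>" "\<And>h x. h \<in> H \<Longrightarrow> \<Phi> (bracket h x) = bracket h (\<Phi> x)" "h \<in> H"
  shows "\<Phi> h \<in> H"
proof (rule normalizer_H)
  fix k assume "k \<in> H"
  then have "bracket k (\<Phi> h) = 0" using assms H_abelian lin_zero by metis
  then show "bracket k (\<Phi> h) \<in> H" using subspace_0[OF subspace_H] by simp
qed

lemma equivariant_E:
  assumes "lin \<Phi>" "\<And>h x. h \<in> H \<Longrightarrow> \<Phi> (bracket h x) = bracket h (\<Phi> x)" "\<alpha> \<in> roots H"
  shows "\<exists>a. \<Phi> (E \<alpha>) = a *s E \<alpha>"
proof -
  have "bracket h (\<Phi> (E \<alpha>)) = \<alpha> h *s \<Phi> (E \<alpha>)" if "h \<in> H" for h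
    using assms(2)[OF that, of "E \<alpha>"] bracket_E[OF assms(3) that] lin_scale[OF assms(1)] by simp
  then have "\<Phi> (E \<alpha>) \<in> root_space H \<alpha>" by (simp add: root_space_def)
  then show ?thesis using root_space_root[OF assms(3)] by auto
qed

lemma equivariantI:
  assumes lin: "lin \<Phi>" and H: "\<And>h. h \<in> H \<Longrightarrow> \<Phi> h \<in> H"
    and E: "\<And>\<alpha>. \<alpha> \<in> roots H \<Longrightarrow> \<Phi> (E \<alpha>) = A \<alpha> *s E \<alpha>" and h: "h \<in> H"
  shows "\<Phi> (bracket h x) = bracket h (\<Phi> x)"
proof -
  have "x \<in> {x. \<Phi> (bracket h x) = bracket h (\<Phi> x)}"
  proof (rule root_basis_induct)
    show "subspace {x. \<Phi> (bracket h x) = bracket h (\<Phi> x)}"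
      using lin by (intro subspaceI)
        (auto simp: lin_add lin_scale lin_zero bracket_add_right bracket_scale_right)
    show "H \<subseteq> {x. \<Phi> (bracket h x) = bracket h (\<Phi> x)}"
      using H h H_abelian lin by (auto simp: lin_zero)
    show "E \<alpha> \<in> {x. \<Phi> (bracket h x) = bracket h (\<Phi> x)}" if "\<alpha> \<in> roots H" for \<alpha>
      using that E bracket_E[OF that h] lin by (simp add: lin_scale bracket_scale_right mult.commute)
  qed
  then show ?thesis by simp
qed

text \<open>The block-diagonal extension of \<phi>, scalar A \<alpha> on the root line of
  \<alpha>.\<close>

definition extend_map :: "('g \<Rightarrow> 'g) \<Rightarrow> (('g \<Rightarrow> 'f) \<Rightarrow> 'f) \<Rightarrow> 'g \<Rightarrow> 'g" where
  "extend_map \<phi> A x = \<phi> (hproj x) + (\<Sum>\<alpha>\<in>roots H. (A \<alpha> * coef \<alpha> x) *s E \<alpha>)"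

lemma lin_extend_map: "endo_on H \<phi> \<Longrightarrow> lin (extend_map \<phi> A)"
  using hproj_H
  by (intro linI) (auto simp: extend_map_def endo_on_def lin_add[OF lin_hproj] lin_scale[OF lin_hproj]
      coef_add coef_scale scale_right_distrib scale_left_distrib distrib_left sum.distrib
          scale_sum_right
      mult.left_commute)

lemma extend_map_H: "h \<in> H \<Longrightarrow> extend_map \<phi> A h = \<phi> h"
  by (simp add: extend_map_def hproj_id coef_H)

lemma endo_on_zero: "endo_on H \<phi> \<Longrightarrow> \<phi> 0 = 0"
  using subspace_0[OF subspace_H] unfolding endo_on_def by (metis scale_zero_left)

lemma extend_map_E:
  assumes "endo_on H \<phi>" "\<alpha> \<in> roots H"
  shows "extend_map \<phi> A (E \<alpha>) = A \<alpha> *s E \<alpha>"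
proof -
  have "(\<Sum>\<beta>\<in>roots H. (A \<beta> * coef \<beta> (E \<alpha>)) *s E \<beta>) = (\<Sum>\<beta>\<in>roots H. if \<beta> = \<alpha> then A \<alpha> *s E \<alpha> else 0)"
    using assms by (intro sum.cong) (auto simp: coef_E)
  then show ?thesis
    using assms finite_roots by (simp add: extend_map_def hproj_E endo_on_zero)
qed

section \<open>The direct sum\<close>

lemma partition_root: "regular_partition H n D \<Longrightarrow> i \<in> {1..n} \<Longrightarrow> \<alpha> \<in> D i \<Longrightarrow> \<alpha> \<in> roots H"
  by (auto simp: regular_partition_def)

lemma partition_index:
  assumes "regular_partition H n D" "\<alpha> \<in> roots H"
  obtains i where "i \<in> {1..n}" "\<alpha> \<in> D i"
  using assms unfolding regular_partition_def by blast

lemma partition_unique: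
  "regular_partition H n D \<Longrightarrow> i \<in> {1..n} \<Longrightarrow> j \<in> {1..n} \<Longrightarrow> \<alpha> \<in> D i \<Longrightarrow> \<alpha> \<in> D j \<Longrightarrow> i = j"
  unfolding regular_partition_def disjoint_family_on_def by blast

lemma finite_summand_index:
  assumes "regular_partition H n D"
  shows "finite (summand_index n D)"
proof -
  have "finite (D i)" if "i \<in> {1..n}" for i
    using partition_root[OF assms that] finite_roots by (meson finite_subset subsetI)
  then show ?thesis unfolding summand_index_def
    by (intro finite.insertI finite_imageI finite_SigmaI) auto
qed

lemma summand_indexI: "i \<in> {1..n} \<Longrightarrow> \<alpha> \<in> D i \<Longrightarrow> Some (i, \<alpha>) \<in> summand_index n D"
  by (auto simp: summand_index_def)

lemma summand_index_cases:
  assumes "t \<in> summand_index n D"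
  obtains "t = None" | i \<alpha> where "t = Some (i, \<alpha>)" "i \<in> {1..n}" "\<alpha> \<in> D i"
  using assms by (auto simp: summand_index_def)

lemma twist_cong: "(\<And>n. \<Phi> (f $$ n) = \<Psi> (f $$ n)) \<Longrightarrow> twist \<Phi> f = twist \<Psi> f"
  by (simp add: twist_def fls_map_def)

lemma W_root_twist:
  assumes "\<And>x. x \<in> root_space H \<alpha> \<Longrightarrow> \<Phi> x = a *s x"
  shows "W_root H a \<alpha> = twist \<Phi> ` inverse_polys (root_space H \<alpha>)"
proof -
  have "fls_shift 1 f - fls_scale a f = twist \<Phi> f" if "f \<in> inverse_polys (root_space H \<alpha>)" for f
    unfolding fls_scale_def twist_def[symmetric]
    using that assms by (intro twist_cong) (auto simp: inverse_polys_def)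
  then show ?thesis by (force simp: W_root_def)
qed

lemma subspace_root_space: "subspace (root_space H \<alpha>)"
  by (rule subspaceI) (auto simp: root_space_def bracket_add_right bracket_scale_right
      scale_right_distrib mult.commute)

context
  fixes n D a \<phi> \<Phi>
  assumes part: "regular_partition H n D"
    and lin\<Phi>: "lin \<Phi>" and \<Phi>H: "\<And>h. h \<in> H \<Longrightarrow> \<Phi> h = \<phi> h" and \<phi>H: "\<And>h. h \<in> H \<Longrightarrow> \<phi> h \<in> H"
    and \<Phi>E: "\<And>i \<alpha>. i \<in> {1..n} \<Longrightarrow> \<alpha> \<in> D i \<Longrightarrow> \<Phi> (E \<alpha>) = a i *s E \<alpha>"
begin

lemma \<Phi>_root_space:
  assumes "i \<in> {1..n}" "\<alpha> \<in> D i" "x \<in> root_space H \<alpha>"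
  shows "\<Phi> x = a i *s x"
proof -
  obtain c where "x = c *s E \<alpha>" using assms root_space_root partition_root[OF part] by blast
  then show ?thesis using \<Phi>E[OF assms(1,2)] lin_scale[OF lin\<Phi>] by (simp add: mult.commute)
qed

lemma W_cartan_generator: "h \<in> H \<Longrightarrow> monomial (Suc k) h - monomial k (\<Phi> h) \<in> W_cartan H \<phi>"
  unfolding W_cartan_def
  by (intro fls.span_base CollectI exI[of _ h] exI[of _ k]) (auto simp: monomial_def \<Phi>H intro:
      fls_eqI)

lemma W_cartan_minimal:
  assumes "fls.subspace U" "\<And>h k. h \<in> H \<Longrightarrow> monomial (Suc k) h - monomial k (\<Phi> h) \<in> U"
  shows "W_cartan H \<phi> \<subseteq> U"
  unfolding W_cartan_def
proof (rule fls.span_minimal[OF _ assms(1)], safe)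
  fix h k assume h: "h \<in> H"
  have "fls_shift (int k) (fls_shift 1 (fls_const h) - fls_const (\<phi> h)) = monomial (Suc k) h -
      monomial k (\<Phi> h)"
    using h by (auto intro!: fls_eqI simp: \<Phi>H)
  then show "fls_shift (int k) (fls_shift 1 (fls_const h) - fls_const (\<phi> h)) \<in> U"
    using assms(2)[OF h] by simp
qed

lemma subspace_summand:
  assumes "t \<in> summand_index n D"
  shows "fls.subspace (summand H a \<phi> t)"
  using assms
proof (cases rule: summand_index_cases)
  case 1
  then show ?thesis by (simp add: summand_def W_cartan_def)
next
  case (2 i \<alpha>)
  then show ?thesis
    using W_root_twist[of \<alpha> \<Phi> "a i"] \<Phi>_root_space subspace_twist_image[OF lin\<Phi> subspace_root_space]
    by (simp add: summand_def)
qed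

text \<open>Each summand is the part of the twisted space with coefficients in H or in one root
  space. Conversely, the vectors b whose generators all lie in the sum form a subspace containing H
  and the root vectors.\<close>

lemma W_sum_eq: "W_sum H n D a \<phi> = twist_space \<Phi>"
proof
  note T = subspace_twist_space[OF lin\<Phi>]
  have "summand H a \<phi> t \<subseteq> twist_space \<Phi>" if "t \<in> summand_index n D" for t
    using that
  proof (cases rule: summand_index_cases)
    case 1
    then show ?thesis using W_cartan_minimal[OF T] twist_monomial_mem[OF lin\<Phi>]
      by (simp add: summand_def)
  next
    case (2 i \<alpha>)
    then show ?thesis
      using W_root_twist[of \<alpha> \<Phi> "a i"] \<Phi>_root_space
        by (auto simp: summand_def twist_space_def inverse_polys_def)
  qed
  then show "W_sum H n D a \<phi> \<subseteq> twist_space \<Phi>"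
    unfolding W_sum_def using T by (auto elim!: family_sumE intro!: fls.subspace_sum)
  have S: "fls.subspace (W_sum H n D a \<phi>)"
    unfolding W_sum_def using subspace_summand by (rule fls.subspace_family_sum)
  have mem: "w \<in> W_sum H n D a \<phi>" if "t \<in> summand_index n D" "w \<in> summand H a \<phi> t" for t w
    unfolding W_sum_def using that finite_summand_index[OF part] subspace_summand fls.subspace_0
    by (intro family_sum_mem[of _ t]) blast+
  let ?U = "{b. \<forall>k. monomial (Suc k) b - monomial k (\<Phi> b) \<in> W_sum H n D a \<phi>}"
  have gen: "b \<in> ?U" for b
  proof (rule root_basis_induct)
    show "subspace ?U"
    proof (rule subspaceI)
      show "0 \<in> ?U"
        using fls.subspace_0[OF S] lin\<Phi> by (simp add: lin_zero)
      fix x y assume "x \<in> ?U" "y \<in> ?U"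
      then have "(monomial (Suc k) x - monomial k (\<Phi> x)) + (monomial (Suc k) y - monomial k (\<Phi> y))
          \<in> W_sum H n D a \<phi>" for k
        using fls.subspace_add[OF S] by blast
      then show "x + y \<in> ?U"
        using lin\<Phi> by (simp add: lin_add monomial_add algebra_simps)
    next
      fix c x assume "x \<in> ?U"
      then have "fls_scale c (monomial (Suc k) x - monomial k (\<Phi> x)) \<in> W_sum H n D a \<phi>" for k
        using fls.subspace_scale[OF S] by blast
      then show "c *s x \<in> ?U"
        using lin\<Phi> by (simp add: lin_scale monomial_scale fls.scale_right_diff_distrib)
    qed
    show "H \<subseteq> ?U"
      using mem[of None] W_cartan_generator by (auto simp: summand_index_def summand_def)
    fix \<alpha> assume \<alpha>: "\<alpha> \<in> roots H"
    obtain i where i: "i \<in> {1..n}" "\<alpha> \<in> D i" by (rule partition_index[OF part \<alpha>])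
    have "monomial (Suc k) (E \<alpha>) - monomial k (\<Phi> (E \<alpha>)) \<in> W_root H (a i) \<alpha>" for k
    proof -
      have "monomial k (E \<alpha>) \<in> inverse_polys (root_space H \<alpha>)"
        using E_mem[OF \<alpha>] subspace_0[OF subspace_root_space] by (intro monomial_inverse_polys)
      then have "twist \<Phi> (monomial k (E \<alpha>)) \<in> W_root H (a i) \<alpha>"
        using W_root_twist[of \<alpha> \<Phi> "a i"] \<Phi>_root_space[OF i] by blast
      then show ?thesis using lin\<Phi> by (simp add: twist_monomial lin_zero)
    qed
    then show "E \<alpha> \<in> ?U"
      using mem[OF summand_indexI[where D = D, OF i]] by (auto simp: summand_def)
  qed
  show "twist_space \<Phi> \<subseteq> W_sum H n D a \<phi>"
  proof
    fix f assume "f \<in> twist_space \<Phi>"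
    then show "f \<in> W_sum H n D a \<phi>" using lin\<Phi>
      by (induction rule: twist_space_induct)
        (use gen in \<open>auto simp: fls.subspace_0[OF S] fls.subspace_add[OF S]\<close>)
  qed
qed

lemma summand_coeff:
  assumes "t \<in> summand_index n D" "f \<in> summand H a \<phi> t"
  shows "t = None \<Longrightarrow> f $$ m \<in> H"
    and "t = Some (i, \<alpha>) \<Longrightarrow> f $$ m \<in> root_space H \<alpha>"
proof -
  assume t: "t = None"
  have "fls.subspace {f. \<forall>m. f $$ m \<in> H}"
    using subspace_H by (intro fls.subspaceI) (auto simp: subspace_0 subspace_add subspace_scale)
  then have "W_cartan H \<phi> \<subseteq> {f. \<forall>m. f $$ m \<in> H}"
    using \<Phi>H \<phi>H subspace_H by (intro W_cartan_minimal) (auto simp: subspace_0 subspace_neg)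
  then show "f $$ m \<in> H" using assms t by (auto simp: summand_def)
next
  assume t: "t = Some (i, \<alpha>)"
  then show "f $$ m \<in> root_space H \<alpha>"
    using assms subspace_root_space[of \<alpha>]
    by (auto simp: summand_def W_root_def inverse_polys_def intro!: subspace_diff subspace_scale)
qed

text \<open>Coefficientwise pairing with \<open>E (- \<alpha>)\<close> isolates the summand of
  \<alpha>, since a root belongs to one part only. What then remains of the relation is the Cartan
  summand.\<close>

lemma direct_W_sum: "W_sum_direct H n D a \<phi>"
  unfolding W_sum_direct_def direct_family_def
proof (intro allI impI, elim conjE)
  let ?I = "summand_index n D"
  note fin = finite_summand_index[OF part]
  fix s assume s: "\<forall>t\<in>?I. s t \<in> summand H a \<phi> t" and z: "(\<Sum>t\<in>?I. s t) = 0"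
  have zn: "(\<Sum>t\<in>?I. s t $$ m) = 0" for m using z by (metis fls_nth_sum fls_zero_nth)
  have rt: "s (Some (i, \<alpha>)) = 0" if i: "i \<in> {1..n}" "\<alpha> \<in> D i" for i \<alpha>
  proof (rule fls_eqI)
    fix m
    have \<alpha>: "\<alpha> \<in> roots H" using partition_root[OF part i] .
    have t: "Some (i, \<alpha>) \<in> ?I" using summand_indexI[where D = D, OF i] .
    have "coef \<alpha> (s u $$ m) = 0" if u: "u \<in> ?I - {Some (i, \<alpha>)}" for u
    proof -
      have uI: "u \<in> ?I" and su: "s u \<in> summand H a \<phi> u" using u s by auto
      from uI show ?thesis
      proof (cases rule: summand_index_cases)
        case 1
        then show ?thesis using summand_coeff(1)[OF uI su] coef_H \<alpha> by blast
      next
        case (2 j \<beta>)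
        have \<beta>: "\<beta> \<in> roots H" using partition_root[OF part 2(2,3)] .
        have "\<beta> \<noteq> \<alpha>" using u 2 partition_unique[OF part i(1) 2(2) i(2)] by auto
        moreover obtain c where "s u $$ m = c *s E \<beta>"
          using summand_coeff(2)[OF uI su 2(1)] root_space_root[OF \<beta>] by blast
        ultimately show ?thesis using coef_E[OF \<alpha> \<beta>] by (simp add: coef_scale)
      qed
    qed
    then have "(\<Sum>u\<in>?I. coef \<alpha> (s u $$ m)) = coef \<alpha> (s (Some (i, \<alpha>)) $$ m)"
      using fin t by (simp add: sum.remove[OF fin t])
    then have c0: "coef \<alpha> (s (Some (i, \<alpha>)) $$ m) = 0"
      using zn[of m] by (simp flip: coef_sum) (simp add: coef_def)
    obtain c where c: "s (Some (i, \<alpha>)) $$ m = c *s E \<alpha>"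
      using summand_coeff(2)[OF t _ refl] s t root_space_root[OF \<alpha>] by blast
    then have "c = 0" using c0 coef_E[OF \<alpha> \<alpha>] by (simp add: coef_scale)
    then show "s (Some (i, \<alpha>)) $$ m = 0 $$ m" using c by simp
  qed
  have N: "None \<in> ?I" by (simp add: summand_index_def)
  have "(\<Sum>u\<in>?I - {None}. s u) = 0"
    by (rule sum.neutral) (auto simp: summand_index_def rt)
  then have "s None = 0" using z by (simp add: sum.remove[OF fin N])
  then show "\<forall>t\<in>?I. s t = 0" using rt by (auto simp: summand_index_def)
qed

end

end

context simple_lie_algebra_data
begin

lemma op_minus_twice_cong:
  assumes "lin \<Phi>" "endo_on H \<phi>" "\<And>h. h \<in> H \<Longrightarrow> \<Phi> h = \<phi> h" "h \<in> H"
  shows "op_minus \<Phi> a (op_minus \<Phi> b h) = op_minus \<phi> a (op_minus \<phi> b h)"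
proof -
  have "\<phi> h - b *s h \<in> H"
    using assms subspace_H by (auto simp: endo_on_def intro!: subspace_diff subspace_scale)
  then show ?thesis using assms by (simp add: op_minus_def)
qed

lemma regular_decomposition:
  assumes "regular_type0 H W"
  shows "\<exists>n D a \<phi>. regular_partition H n D \<and> endo_on H \<phi> \<and> compatible E n D a \<phi>
    \<and> W_sum_direct H n D a \<phi> \<and> W = W_sum H n D a \<phi>"
proof -
  obtain \<Phi> where lin: "lin \<Phi>" and nij: "nijenhuis \<Phi>"
    and eq: "\<And>h x. h \<in> H \<Longrightarrow> \<Phi> (bracket h x) = bracket h (\<Phi> x)" and W: "W = twist_space \<Phi>"
    using regular_is_twist_space[OF assms] by blast
  have \<Phi>H: "\<Phi> h \<in> H" if "h \<in> H" for h using equivariant_H[OF lin eq that] .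
  obtain A where A: "\<And>\<alpha>. \<alpha> \<in> roots H \<Longrightarrow> \<Phi> (E \<alpha>) = A \<alpha> *s E \<alpha>"
    using equivariant_E[OF lin eq] by metis
  \<comment> \<open>The parts are numbered by the distinct eigenvalues of \<Phi> on root vectors; f
    runs through these values and supplies the constants.\<close>
  obtain f where f: "bij_betw f {1..card (A ` roots H)} (A ` roots H)"
    using ex_bij_betw_nat_finite_1[of "A ` roots H"] finite_roots by blast
  define n where "n = card (A ` roots H)"
  define D where "D i = {\<alpha> \<in> roots H. A \<alpha> = f i}" for i
  have inj: "inj_on f {1..n}" and img: "f ` {1..n} = A ` roots H"
    using f by (auto simp: bij_betw_def n_def)
  have sum: "A (\<alpha> + \<beta>) = A \<alpha> \<or> A (\<alpha> + \<beta>) = A \<beta>"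
    if "\<alpha> \<in> roots H" "\<beta> \<in> roots H" "\<alpha> + \<beta> \<in> roots H" for \<alpha> \<beta>
    using nijenhuis_sum_roots[OF lin nij A that] .
  have part: "regular_partition H n D"
    unfolding regular_partition_def
  proof (intro conjI ballI)
    show "(\<Union>i\<in>{1..n}. D i) = roots H"
    proof
      show "roots H \<subseteq> (\<Union>i\<in>{1..n}. D i)"
      proof
        fix \<alpha> assume \<alpha>: "\<alpha> \<in> roots H"
        then have "A \<alpha> \<in> f ` {1..n}" using img by auto
        then show "\<alpha> \<in> (\<Union>i\<in>{1..n}. D i)" using \<alpha> unfolding D_def by blast
      qed
    qed (auto simp: D_def)
    show "disjoint_family_on D {1..n}"
      using inj unfolding disjoint_family_on_def D_def inj_on_def by fastforce
    show "D i \<noteq> {}" if "i \<in> {1..n}" for i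
    proof -
      have "f i \<in> A ` roots H" using that img by blast
      then show ?thesis unfolding D_def by auto
    qed
    show cl: "closed_roots H (D i \<union> D j)" for i j
      unfolding closed_roots_def
    proof (intro conjI ballI impI)
      show "D i \<union> D j \<subseteq> roots H" by (auto simp: D_def)
      fix \<alpha> \<beta> assume ab: "\<alpha> \<in> D i \<union> D j" "\<beta> \<in> D i \<union> D j" "\<alpha> + \<beta> \<in> roots H"
      then have "A (\<alpha> + \<beta>) = A \<alpha> \<or> A (\<alpha> + \<beta>) = A \<beta>" by (intro sum) (auto simp: D_def)
      then show "\<alpha> + \<beta> \<in> D i \<union> D j" using ab unfolding D_def by auto
    qed
    show "closed_roots H (D i)" for i using cl[of i i] by simp
  qed
  have \<Phi>E: "\<Phi> (E \<alpha>) = f i *s E \<alpha>" if "i \<in> {1..n}" "\<alpha> \<in> D i" for i \<alpha>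
    using that A by (auto simp: D_def)
  have endo: "endo_on H \<Phi>" using lin \<Phi>H by (auto simp: endo_on_def lin_add lin_scale)
  have comp: "compatible E n D f \<Phi>" unfolding compatible_def
  proof (intro ballI impI)
    fix i j \<alpha> assume ij: "i \<in> {1..n}" "j \<in> {1..n}" "\<alpha> \<in> D i" "- \<alpha> \<in> D j"
    show "op_minus \<Phi> (f i) (op_minus \<Phi> (f j) (bracket (E \<alpha>) (E (- \<alpha>)))) = 0"
      using torsion_E_E[OF lin \<Phi>E[OF ij(1,3)] \<Phi>E[OF ij(2,4)]] nij
      by (simp add: nijenhuis_torsion del: uminus_apply)
  qed
  have "W_sum H n D f \<Phi> = twist_space \<Phi>" "W_sum_direct H n D f \<Phi>"
    by (rule W_sum_eq[OF part lin refl \<Phi>H \<Phi>E] direct_W_sum[OF part lin refl \<Phi>H \<Phi>E]; assumption)+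
  then show ?thesis using part endo comp W by blast
qed

text \<open>The constants of different parts may coincide, so a part need not be a level set. The
  eigenvalue at a root is therefore taken from the index of its part, and closedness of a union of
  two parts becomes the sum condition on eigenvalues.\<close>

lemma extend_partition_map:
  assumes part: "regular_partition H n D" and endo: "endo_on H \<phi>" and comp: "compatible E n D a \<phi>"
  obtains \<Phi> where "lin \<Phi>" "nijenhuis \<Phi>" "\<And>h. h \<in> H \<Longrightarrow> \<Phi> h = \<phi> h" "\<And>h. h \<in> H \<Longrightarrow> \<phi> h \<in> H"
    "\<And>i \<alpha>. i \<in> {1..n} \<Longrightarrow> \<alpha> \<in> D i \<Longrightarrow> \<Phi> (E \<alpha>) = a i *s E \<alpha>"
    "\<And>h x. h \<in> H \<Longrightarrow> \<Phi> (bracket h x) = bracket h (\<Phi> x)"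
proof -
  have "\<forall>\<alpha>\<in>roots H. \<exists>i. i \<in> {1..n} \<and> \<alpha> \<in> D i"
    using part unfolding regular_partition_def by blast
  then obtain I where I: "\<And>\<alpha>. \<alpha> \<in> roots H \<Longrightarrow> I \<alpha> \<in> {1..n} \<and> \<alpha> \<in> D (I \<alpha>)"
    by metis
  define A where "A \<alpha> = a (I \<alpha>)" for \<alpha>
  have AD: "A \<alpha> = a i" if "i \<in> {1..n}" "\<alpha> \<in> D i" for i \<alpha>
    using I[OF partition_root[OF part that]] partition_unique[OF part _ that(1) _ that(2)]
      by (auto simp: A_def)
  define \<Phi> where "\<Phi> = extend_map \<phi> A"
  have lin: "lin \<Phi>" unfolding \<Phi>_def by (rule lin_extend_map[OF endo])
  have \<Phi>H: "\<Phi> h = \<phi> h" if "h \<in> H" for h unfolding \<Phi>_def by (rule extend_map_H[OF that])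
  have \<phi>H: "\<phi> h \<in> H" if "h \<in> H" for h using endo that by (simp add: endo_on_def)
  have \<Phi>A: "\<Phi> (E \<alpha>) = A \<alpha> *s E \<alpha>" if "\<alpha> \<in> roots H" for \<alpha>
    unfolding \<Phi>_def by (rule extend_map_E[OF endo that])
  have "nijenhuis \<Phi>"
  proof (rule nijenhuisI[OF lin _ \<Phi>A])
    show "\<Phi> h \<in> H" if "h \<in> H" for h using that \<Phi>H \<phi>H by simp
    show "A (\<alpha> + \<beta>) = A \<alpha> \<or> A (\<alpha> + \<beta>) = A \<beta>"
      if ab: "\<alpha> \<in> roots H" "\<beta> \<in> roots H" "\<alpha> + \<beta> \<in> roots H" for \<alpha> \<beta>
    proof -
      have "closed_roots H (D (I \<alpha>) \<union> D (I \<beta>))"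
        using part I ab unfolding regular_partition_def by blast
      then have "\<alpha> + \<beta> \<in> D (I \<alpha>) \<union> D (I \<beta>)"
        using I ab unfolding closed_roots_def by blast
      then have "A (\<alpha> + \<beta>) = a (I \<alpha>) \<or> A (\<alpha> + \<beta>) = a (I \<beta>)" using AD I ab by blast
      then show ?thesis unfolding A_def .
    qed
    show "op_minus \<Phi> (A \<alpha>) (op_minus \<Phi> (A (- \<alpha>)) (bracket (E \<alpha>) (E (- \<alpha>)))) = 0"
      if \<alpha>: "\<alpha> \<in> roots H" for \<alpha>
    proof -
      have "op_minus \<phi> (a (I \<alpha>)) (op_minus \<phi> (a (I (- \<alpha>))) (bracket (E \<alpha>) (E (- \<alpha>)))) = 0"
        using comp I[OF \<alpha>] I[OF neg_root[OF \<alpha>]] unfolding compatible_def by blast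
      then show ?thesis
        using op_minus_twice_cong[OF lin endo \<Phi>H coroot_H[OF \<alpha>, unfolded coroot_def]]
        by (simp only: A_def)
    qed
  qed
  moreover have "\<Phi> (bracket h x) = bracket h (\<Phi> x)" if "h \<in> H" for h x
    using equivariantI[OF lin _ \<Phi>A that] \<Phi>H \<phi>H by simp
  ultimately show thesis
    using that[of \<Phi>] lin \<Phi>H \<phi>H \<Phi>A AD partition_root[OF part] by metis
qed

end

section \<open>The Casimir element\<close>

lemma sum_fun_apply: "(\<Sum>i\<in>I. f i) x = (\<Sum>i\<in>I. f i x)"
  for f :: "'i \<Rightarrow> 'x \<Rightarrow> 'y::comm_monoid_add"
  by (induction I rule: infinite_finite_induct) auto

context fd_lie_algebra
begin

lemma functional_hom: "functional scale \<xi> \<Longrightarrow> module_hom scale (*) \<xi>"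
  by (simp add: linear_iff_module_hom)

lemmas functional_add = module_hom.add [OF functional_hom]
  and functional_scale = module_hom.scale [OF functional_hom]
  and functional_zero = module_hom.zero [OF functional_hom]
  and functional_neg = module_hom.neg [OF functional_hom]
  and functional_diff = module_hom.diff [OF functional_hom]
  and functional_sum = module_hom.sum [OF functional_hom]

lemma functional_comp: "functional scale \<xi> \<Longrightarrow> lin S \<Longrightarrow> functional scale (\<lambda>x. \<xi> (S x))"
  using Vector_Spaces.linear_compose[of scale scale S "(*)" \<xi>] by (simp add: comp_def)

lemma orthonormal_expansion:
  assumes B: "orthonormal_basis B"
  shows "(\<Sum>b\<in>B. killing x b *s b) = x"
proof -
  have fin: "finite B" and ind: "independent B" and sp: "span B = UNIV"
    and on: "\<And>b c. b \<in> B \<Longrightarrow> c \<in> B \<Longrightarrow> killing b c = (if b = c then 1 else 0)"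
    using B by (auto simp: orthonormal_basis_def)
  let ?r = "representation B x"
  have x: "x = (\<Sum>c\<in>B. ?r c *s c)" using sum_representation_eq[of B x B] fin ind sp by simp
  have "killing x b = ?r b" if b: "b \<in> B" for b
  proof -
    have "killing x b = (\<Sum>c\<in>B. ?r c * killing c b)"
      by (subst x) (simp add: killing_sum killing_scale_left)
    also have "\<dots> = (\<Sum>c\<in>B. if c = b then ?r b else 0)"
      using on b by (intro sum.cong) auto
    finally show ?thesis using fin b by simp
  qed
  then show ?thesis using x by simp
qed

lemma functional_orthonormal:
  assumes "orthonormal_basis B" "functional scale F"
  shows "(\<Sum>b\<in>B. killing x b * F b) = F x"
proof -
  have "(\<Sum>b\<in>B. killing x b * F b) = F (\<Sum>b\<in>B. killing x b *s b)"
    using assms(2) by (simp add: functional_sum functional_scale)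
  then show ?thesis using orthonormal_expansion[OF assms(1)] by simp
qed

text \<open>Invariance of \<Omega> under w acting on both legs, tested against F and G: the bracket
  passes from the second leg to the first. It amounts to \<kappa>([u,w],t) = \<kappa>([w,t],u) after
  expanding in the orthonormal basis.\<close>

lemma casimir_invariant:
  assumes B: "orthonormal_basis B" and F: "functional scale F" and G: "functional scale G"
  shows "(\<Sum>u\<in>B. F u * G (bracket u w)) = (\<Sum>u\<in>B. F (bracket w u) * G u)"
proof -
  have "(\<Sum>u\<in>B. F u * G (bracket u w)) = (\<Sum>u\<in>B. \<Sum>t\<in>B. F u * (killing (bracket u w) t * G t))"
    using functional_orthonormal[OF B G] by (simp flip: sum_distrib_left)
  also have "\<dots> = (\<Sum>u\<in>B. \<Sum>t\<in>B. killing (bracket w t) u * F u * G t)"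
  proof (intro sum.cong refl)
    fix u t
    have "killing (bracket u w) t = killing (bracket w t) u"
      by (simp add: killing_invariant killing_commute[of u])
    then show "F u * (killing (bracket u w) t * G t) = killing (bracket w t) u * F u * G t" by simp
  qed
  also have "\<dots> = (\<Sum>t\<in>B. \<Sum>u\<in>B. killing (bracket w t) u * F u * G t)" by (rule sum.swap)
  also have "\<dots> = (\<Sum>t\<in>B. F (bracket w t) * G t)"
    using functional_orthonormal[OF B F] by (simp flip: sum_distrib_right)
  finally show ?thesis .
qed

lemma assoc_solution_nth:
  assumes "lin \<Phi>"
  shows "assoc_solution B (twist_space \<Phi>) $ k $$ n
    = (if n = - int k - 1 then casimir B else 0)
      - (if n = 0 then (\<Sum>b\<in>B. tensor scale ((\<Phi> ^^ Suc k) b) b) else 0)"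
proof -
  have t0: "tensor scale 0 v = 0" for v
    using tensor_add_left[of 0 0 v] by simp
  have neg: "tensor scale (- u) v = - tensor scale u v" for u v
    using tensor_add_left[of u "- u" v] by (simp add: t0 eq_neg_iff_add_eq_0 add.commute)
  have "assoc_solution B (twist_space \<Phi>) $ k $$ n
      = (\<Sum>b\<in>B. tensor scale ((monomial (Suc k) b - monomial 0 ((\<Phi> ^^ Suc k) b)) $$ n) b)"
    by (simp add: assoc_solution_def fls_nth_sum fls_map_nth t0 assoc_elem_twist_space[OF assms]
        del: monomial_nth funpow.simps)
  also have "\<dots> = (if n = - int k - 1 then casimir B else 0)
      - (if n = 0 then (\<Sum>b\<in>B. tensor scale ((\<Phi> ^^ Suc k) b) b) else 0)"
    by (auto simp: casimir_def neg t0 sum_negf simp del: funpow.simps)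
  finally show ?thesis .
qed

end

context simple_lie_algebra_data
begin

text \<open>\<Omega> is its Cartan component plus the sum of \<open>E \<alpha>\<close> tensor
  \<open>E (- \<alpha>)\<close>. Each leg is split in turn, the orthonormal sum contracting against
  \<kappa>.\<close>

lemma casimir_decomposition:
  assumes B: "orthonormal_basis B" and F: "functional scale F" and G: "functional scale G"
  shows "(\<Sum>b\<in>B. F b * G b)
    = (\<Sum>b\<in>B. F (hproj b) * G (hproj b)) + (\<Sum>\<alpha>\<in>roots H. F (E \<alpha>) * G (E (- \<alpha>)))"
proof -
  let ?G = "\<lambda>b. G (hproj b)"
  have G': "functional scale ?G" using functional_comp[OF G lin_hproj] .
  have eF: "F b = F (hproj b) + (\<Sum>\<alpha>\<in>roots H. coef \<alpha> b * F (E \<alpha>))" for b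
    by (subst hproj_decomposition) (simp add: functional_add[OF F] functional_sum[OF F]
        functional_scale[OF F])
  have eG: "G b = ?G b + (\<Sum>\<alpha>\<in>roots H. killing (E \<alpha>) b * G (E (- \<alpha>)))" for b
  proof -
    have "G b = ?G b + (\<Sum>\<alpha>\<in>roots H. coef \<alpha> b * G (E \<alpha>))"
      by (subst hproj_decomposition) (simp add: functional_add[OF G] functional_sum[OF G]
          functional_scale[OF G])
    \<comment> \<open>Reindexing by -\<alpha> makes the coefficient of \<open>E (- \<alpha>)\<close>
      a pairing with \<open>E \<alpha>\<close>, as the contraction requires.\<close>
    also have "(\<Sum>\<alpha>\<in>roots H. coef \<alpha> b * G (E \<alpha>)) = (\<Sum>\<alpha>\<in>roots H. coef (- \<alpha>) b * G (E (- \<alpha>)))"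
      using neg_root by (intro sum.reindex_bij_witness[of _ uminus uminus]) auto
    finally show ?thesis by (simp add: coef_def killing_commute)
  qed
  have "(\<Sum>b\<in>B. F b * G b) = (\<Sum>b\<in>B. F b * ?G b)
      + (\<Sum>b\<in>B. \<Sum>\<alpha>\<in>roots H. killing (E \<alpha>) b * F b * G (E (- \<alpha>)))"
    by (subst eG) (simp add: distrib_left sum.distrib sum_distrib_left mult_ac)
  also have "(\<Sum>b\<in>B. \<Sum>\<alpha>\<in>roots H. killing (E \<alpha>) b * F b * G (E (- \<alpha>)))
      = (\<Sum>\<alpha>\<in>roots H. F (E \<alpha>) * G (E (- \<alpha>)))"
    by (subst sum.swap) (simp add: functional_orthonormal[OF B F] flip: sum_distrib_right)
  also have "(\<Sum>b\<in>B. F b * ?G b) = (\<Sum>b\<in>B. F (hproj b) * ?G b)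
      + (\<Sum>b\<in>B. \<Sum>\<alpha>\<in>roots H. killing (E (- \<alpha>)) b * ?G b * F (E \<alpha>))"
    by (subst eF) (simp add: distrib_left sum.distrib sum_distrib_left coef_def killing_commute
        mult_ac)
  also have "(\<Sum>b\<in>B. \<Sum>\<alpha>\<in>roots H. killing (E (- \<alpha>)) b * ?G b * F (E \<alpha>))
      = (\<Sum>\<alpha>\<in>roots H. ?G (E (- \<alpha>)) * F (E \<alpha>))"
    by (subst sum.swap) (simp add: functional_orthonormal[OF B G'] flip: sum_distrib_right)
  also have "\<dots> = 0"
    using hproj_E neg_root by (intro sum.neutral) (simp add: functional_zero[OF G])
  finally show ?thesis by (simp only: add_0_right)
qed

lemma tensor_map_sum_apply:
  assumes "functional scale \<xi>" "functional scale \<eta>" "lin S" "lin T"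
  shows "tensor_map scale S T (\<Sum>b\<in>B. tensor scale (u b) (v b)) \<xi> \<eta> = (\<Sum>b\<in>B. \<xi> (S (u b)) * \<eta> (T (v
      b)))"
  using assms functional_comp[OF assms(1,3)] functional_comp[OF assms(2,4)]
  by (simp add: tensor_map_def sum_fun_apply tensor_def comp_def)

text \<open>The coefficient of y^k is a pole term minus \<Phi>^(k+1) applied to the first leg of
  \<Omega>. On the Cartan component this is \<phi>^(k+1), on the i-th part the scalar a_i^(k+1),
  matching the two kinds of geometric series.\<close>

lemma assoc_solution_formula:
  assumes part: "regular_partition H n D"
    and lin: "lin \<Phi>" and \<Phi>H: "\<And>h. h \<in> H \<Longrightarrow> \<Phi> h = \<phi> h" and \<phi>H: "\<And>h. h \<in> H \<Longrightarrow> \<phi> h \<in> H"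
    and \<Phi>E: "\<And>i \<alpha>. i \<in> {1..n} \<Longrightarrow> \<alpha> \<in> D i \<Longrightarrow> \<Phi> (E \<alpha>) = a i *s E \<alpha>"
    and B: "orthonormal_basis B"
  shows "assoc_solution B (twist_space \<Phi>) = r_formula H E B n D a \<phi>"
proof (rule fps_ext, rule fls_eqI, rule ext, rule ext)
  fix k :: nat and m :: int and \<xi> \<eta> :: "'g \<Rightarrow> 'f"
  let ?p = "Suc k"
  have cp: "cartan_proj H = hproj" by (simp add: fun_eq_iff cartan_proj_eq)
  have \<Phi>p: "(\<Phi> ^^ j) h = (\<phi> ^^ j) h \<and> (\<phi> ^^ j) h \<in> H" if "h \<in> H" for h j
    by (induction j) (use that \<Phi>H \<phi>H in auto)
  have lhs: "(assoc_solution B (twist_space \<Phi>) $ k $$ m) \<xi> \<eta>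
    = (if m = - int k - 1 then casimir B \<xi> \<eta> else 0)
      - (if m = 0 then (\<Sum>b\<in>B. tensor scale ((\<Phi> ^^ ?p) b) b \<xi> \<eta>) else 0)"
    unfolding assoc_solution_nth[OF lin] by (simp add: sum_fun_apply)
  have ts0: "tensor_scale 0 t = 0" for t :: "('f, 'g) tensor2"
    by (simp add: tensor_scale_def fun_eq_iff)
  have r1: "(series_times inv_x_minus_y (casimir B) $ k $$ m) \<xi> \<eta>
      = (if m = - int k - 1 then casimir B \<xi> \<eta> else 0)"
    by (simp add: series_times_def fls_map_nth ts0 inv_x_minus_y_nth) (auto simp: tensor_scale_def)
  have r2: "(cartan_term H B \<phi> $ k $$ m) \<xi> \<eta>
      = (if m = 0 then tensor_map scale (op_geom_frac \<phi> $ k \<circ> hproj) id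
          (tensor_map scale hproj hproj (casimir B)) \<xi> \<eta> else 0)"
    by (simp add: cartan_term_def casimir_cartan_def cp)
  have r3: "(series_times (geom_frac (a i)) (casimir_part E (D i)) $ k $$ m) \<xi> \<eta>
      = (if m = 0 then - (a i ^ ?p) * casimir_part E (D i) \<xi> \<eta> else 0)" for i
    by (simp add: series_times_def fls_map_nth ts0 geom_frac_nth) (auto simp: tensor_scale_def)
  have rhs: "(r_formula H E B n D a \<phi> $ k $$ m) \<xi> \<eta>
    = (if m = - int k - 1 then casimir B \<xi> \<eta> else 0)
      + (if m = 0 then tensor_map scale (op_geom_frac \<phi> $ k \<circ> hproj) id
          (tensor_map scale hproj hproj (casimir B)) \<xi> \<eta>
        - (\<Sum>i\<in>{1..n}. a i ^ ?p * casimir_part E (D i) \<xi> \<eta>) else 0)"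
    unfolding r_formula_def
    by (simp add: fps_sum_nth fls_nth_sum sum_fun_apply r1 r2 r3 sum_negf del: power_Suc)
  have "(\<Sum>b\<in>B. tensor scale ((\<Phi> ^^ ?p) b) b \<xi> \<eta>)
      = - tensor_map scale (op_geom_frac \<phi> $ k \<circ> hproj) id (tensor_map scale hproj hproj (casimir
          B)) \<xi> \<eta>
        + (\<Sum>i\<in>{1..n}. a i ^ ?p * casimir_part E (D i) \<xi> \<eta>)"
  proof (cases "functional scale \<xi> \<and> functional scale \<eta>")
    \<comment> \<open>On nonlinear arguments all tensors are zero by convention.\<close>
    case False
    then have "tensor scale u v \<xi> \<eta> = 0" for u v :: 'g by (auto simp: tensor_def)
    moreover have "tensor_map scale S T t \<xi> \<eta> = 0" for S T :: "'g \<Rightarrow> 'g" and t using False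
      by (auto simp: tensor_map_def)
    ultimately show ?thesis by (simp add: casimir_part_def sum_fun_apply)
  next
    case True
    then have \<xi>: "functional scale \<xi>" and \<eta>: "functional scale \<eta>" by auto
    let ?F = "\<lambda>x. \<xi> ((\<Phi> ^^ ?p) x)"
    have F: "functional scale ?F" by (rule functional_comp[OF \<xi> lin_funpow[OF lin]])
    \<comment> \<open>\<phi> is controlled on H only; after projection its powers may be replaced by
      those of \<Phi>, which is linear everywhere.\<close>
    have og: "op_geom_frac \<phi> $ k \<circ> hproj = (\<lambda>x. - (\<Phi> ^^ ?p) (hproj x))"
      using \<Phi>p[OF hproj_H] by (simp add: op_geom_frac_def fun_eq_iff del: funpow.simps)
    have lin_og: "lin (\<lambda>x. - (\<Phi> ^^ ?p) (hproj x))"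
      using lin_funpow[OF lin, of ?p] lin_hproj
        by (intro linI) (simp_all add: lin_add lin_scale del: funpow.simps)
    have hp2: "hproj (hproj x) = hproj x" for x by (simp add: hproj_id hproj_H)
    have tm: "tensor_map scale (op_geom_frac \<phi> $ k \<circ> hproj) id (tensor_map scale hproj hproj
        (casimir B)) \<xi> \<eta>
        = - (\<Sum>b\<in>B. ?F (hproj b) * \<eta> (hproj b))"
      unfolding og casimir_def
      using \<xi> \<eta> functional_comp[OF \<xi> lin_og]
        tensor_map_sum_apply[OF functional_comp[OF \<xi> lin_og] \<eta> lin_hproj lin_hproj, of "\<lambda>b. b"
            "\<lambda>b. b" B]
      by (simp add: tensor_map_def[of scale "\<lambda>x. - (\<Phi> ^^ ?p) (hproj x)" id] comp_def hp2
          functional_neg[OF \<xi>] sum_negf del: funpow.simps)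
    have \<Phi>Ep: "(\<Phi> ^^ j) (E \<alpha>) = (a i ^ j) *s E \<alpha>" if "i \<in> {1..n}" "\<alpha> \<in> D i" for i \<alpha> j
      by (induction j) (use \<Phi>E[OF that] lin in \<open>simp_all add: lin_scale mult.commute\<close>)
    have UD: "roots H = (\<Union>i\<in>{1..n}. D i)" using part by (simp add: regular_partition_def)
    have "(\<Sum>\<alpha>\<in>roots H. ?F (E \<alpha>) * \<eta> (E (- \<alpha>)))
        = (\<Sum>i\<in>{1..n}. \<Sum>\<alpha>\<in>D i. ?F (E \<alpha>) * \<eta> (E (- \<alpha>)))"
      unfolding UD
      using finite_roots part unfolding UD regular_partition_def disjoint_family_on_def
      by (intro sum.UNION_disjoint) auto
    also have "\<dots> = (\<Sum>i\<in>{1..n}. a i ^ ?p * casimir_part E (D i) \<xi> \<eta>)"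
      using \<xi> \<eta>
      by (intro sum.cong refl)
        (simp add: casimir_part_def sum_fun_apply tensor_def \<Phi>Ep functional_scale[OF \<xi>]
          sum_distrib_left mult.assoc del: funpow.simps power_Suc)
    finally have parts: "(\<Sum>\<alpha>\<in>roots H. ?F (E \<alpha>) * \<eta> (E (- \<alpha>)))
        = (\<Sum>i\<in>{1..n}. a i ^ ?p * casimir_part E (D i) \<xi> \<eta>)" .
    have "(\<Sum>b\<in>B. tensor scale ((\<Phi> ^^ ?p) b) b \<xi> \<eta>) = (\<Sum>b\<in>B. ?F b * \<eta> b)"
      using \<xi> \<eta> by (simp add: tensor_def)
    also have "\<dots> = (\<Sum>b\<in>B. ?F (hproj b) * \<eta> (hproj b))
        + (\<Sum>\<alpha>\<in>roots H. ?F (E \<alpha>) * \<eta> (E (- \<alpha>)))"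
      by (rule casimir_decomposition[OF B F \<eta>])
    finally show ?thesis unfolding tm parts by simp
  qed
  then show "(assoc_solution B (twist_space \<Phi>) $ k $$ m) \<xi> \<eta> = (r_formula H E B n D a \<phi> $ k $$ m) \<xi> \<eta>"
    unfolding lhs rhs by simp
qed

end

section \<open>The Yang--Baxter equation\<close>

subsection \<open>Series in the second and third variable\<close>

definition emb :: "'f::field series3 \<Rightarrow> 'f series3 fract" where
  "emb s = Fract s 1"

lemma emb_add: "emb (s + t) = emb s + emb t"
  and emb_diff: "emb (s - t) = emb s - emb t"
  and emb_mult: "emb (s * t) = emb s * emb t"
  and emb_neg: "emb (- s) = - emb s"
  and emb_zero: "emb 0 = 0"
  by (simp_all add: emb_def Zero_fract_def)

lemma emb_sum: "emb (\<Sum>i\<in>I. f i) = (\<Sum>i\<in>I. emb (f i))"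
  by (induction I rule: infinite_finite_induct) (auto simp: emb_zero emb_add)

lemma emb_eq_zero_iff: "emb s = 0 \<longleftrightarrow> s = 0"
  by (simp add: emb_def Zero_fract_def eq_fract)

definition const_series :: "'f::field \<Rightarrow> 'f series3" where
  "const_series c = fps_const (fps_const (fps_const c))"

lemma const3_emb: "const3 c = emb (const_series c)"
  by (simp add: const3_def emb_def const_series_def)

definition series_x2 :: "(nat \<Rightarrow> 'f::field) \<Rightarrow> 'f series3" where
  "series_x2 f = fps_const (Abs_fps (\<lambda>m. fps_const (f m)))"

definition series_x3 :: "(nat \<Rightarrow> 'f::field) \<Rightarrow> 'f series3" where
  "series_x3 f = Abs_fps (\<lambda>n. fps_const (fps_const (f n)))"

definition series_x23 :: "(nat \<Rightarrow> nat \<Rightarrow> 'f::field) \<Rightarrow> 'f series3" where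
  "series_x23 f = Abs_fps (\<lambda>n. Abs_fps (\<lambda>m. fps_const (f m n)))"

lemma series_x2_nth: "series_x2 f $ n $ m $ l = (if n = 0 \<and> l = 0 then f m else 0)"
  and series_x3_nth: "series_x3 f $ n $ m $ l = (if m = 0 \<and> l = 0 then f n else 0)"
  and series_x23_nth: "series_x23 h $ n $ m $ l = (if l = 0 then h m n else 0)"
  and const_series_nth: "const_series c $ n $ m $ l = (if n = 0 \<and> m = 0 \<and> l = 0 then c else 0)"
  by (auto simp: series_x2_def series_x3_def series_x23_def const_series_def)

lemma series3_eqI: "(\<And>n m l. f $ n $ m $ l = g $ n $ m $ l) \<Longrightarrow> f = g"
  for f g :: "'f::field series3"
  by (auto simp: fps_eq_iff)

lemma coord_mult_nth:
  "(coord 1 * f) $ n $ m $ l = (if l = 0 then 0 else f $ n $ m $ (l - 1))"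
  "(coord 2 * f) $ n $ m $ l = (if m = 0 then 0 else f $ n $ (m - 1) $ l)"
  "(coord 3 * f) $ n $ m $ l = (if n = 0 then 0 else f $ (n - 1) $ m $ l)"
  by (auto simp: coord_def)

lemma coord_diff_nonzero: "coord 1 - coord 2 \<noteq> (0 :: 'f::field series3)"
  "coord 1 - coord 3 \<noteq> (0 :: 'f series3)" "coord 2 - coord 3 \<noteq> (0 :: 'f series3)"
  "coord 3 - coord 2 \<noteq> (0 :: 'f series3)"
proof -
  have "(coord 1 :: 'f series3) $ 0 $ 0 $ 1 \<noteq> coord 2 $ 0 $ 0 $ 1" by (simp add: coord_def)
  moreover have "(coord 1 :: 'f series3) $ 0 $ 0 $ 1 \<noteq> coord 3 $ 0 $ 0 $ 1" by (simp add: coord_def)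
  moreover have "(coord 2 :: 'f series3) $ 0 $ 1 $ 0 \<noteq> coord 3 $ 0 $ 1 $ 0" by (simp add: coord_def)
  ultimately show "coord 1 - coord 2 \<noteq> (0 :: 'f::field series3)"
    "coord 1 - coord 3 \<noteq> (0 :: 'f series3)" "coord 2 - coord 3 \<noteq> (0 :: 'f series3)"
    "coord 3 - coord 2 \<noteq> (0 :: 'f series3)"
    by force+
qed

lemma series_x2_mult_series_x3: "series_x2 f * series_x3 g = series_x23 (\<lambda>m n. f m * g n)"
proof (rule series3_eqI)
  fix n m l
  have "(series_x2 f * series_x3 g) $ n = Abs_fps (\<lambda>m. fps_const (f m)) * fps_const (fps_const (g n))"
    by (simp add: series_x2_def series_x3_def)
  then have "(series_x2 f * series_x3 g) $ n $ m = fps_const (f m) * fps_const (g n)"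
    by simp
  then show "(series_x2 f * series_x3 g) $ n $ m $ l = series_x23 (\<lambda>m n. f m * g n) $ n $ m $ l"
    by (auto simp: series_x23_nth)
qed

lemma const_series_mult:
  "const_series c * const_series d = const_series (c * d)"
  "const_series c * series_x2 f = series_x2 (\<lambda>k. c * f k)"
  "const_series c * series_x3 f = series_x3 (\<lambda>k. c * f k)"
  "const_series c * series_x23 h = series_x23 (\<lambda>m n. c * h m n)"
proof -
  have "(const_series c * t) $ n $ m $ l = c * t $ n $ m $ l" for t n m l
    by (simp add: const_series_def)
  then show "const_series c * const_series d = const_series (c * d)"
    "const_series c * series_x2 f = series_x2 (\<lambda>k. c * f k)"
    "const_series c * series_x3 f = series_x3 (\<lambda>k. c * f k)"
    "const_series c * series_x23 h = series_x23 (\<lambda>m n. c * h m n)"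
    by (auto intro!: series3_eqI simp: const_series_nth series_x2_nth series_x3_nth series_x23_nth)
qed

lemma series_sum:
  "(\<Sum>i\<in>I. const_series (c i)) = const_series (\<Sum>i\<in>I. c i)"
  "(\<Sum>i\<in>I. series_x2 (f i)) = series_x2 (\<lambda>k. \<Sum>i\<in>I. f i k)"
  "(\<Sum>i\<in>I. series_x3 (f i)) = series_x3 (\<lambda>k. \<Sum>i\<in>I. f i k)"
  "(\<Sum>i\<in>I. series_x23 (h i)) = series_x23 (\<lambda>m n. \<Sum>i\<in>I. h i m n)"
  by (rule series3_eqI,
      auto simp: fps_sum_nth const_series_nth series_x2_nth series_x3_nth series_x23_nth intro!:
          sum.neutral)+

lemma series_neg:
  "const_series (- c) = - const_series c" "series_x2 (\<lambda>k. - f k) = - series_x2 f"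
  "series_x3 (\<lambda>k. - f k) = - series_x3 f" "series_x23 (\<lambda>m n. - h m n) = - series_x23 h"
  by (rule series3_eqI, simp add: const_series_nth series_x2_nth series_x3_nth series_x23_nth)+

lemma series_x23_add: "series_x23 (\<lambda>m n. g m n + h m n) = series_x23 g + series_x23 h"
  by (rule series3_eqI) (simp add: series_x23_nth)

text \<open>The divided difference of the one-variable series with coefficients s(k + 1). Its
  constant term cancels, so the quotient begins with s(2).\<close>

lemma series_x2_diff_series_x3:
  "series_x2 (\<lambda>k. s (Suc k)) - series_x3 (\<lambda>k. s (Suc k))
    = (coord 2 - coord 3) * series_x23 (\<lambda>m n. s (m + n + 2))"
proof (rule series3_eqI)
  fix n m l
  show "(series_x2 (\<lambda>k. s (Suc k)) - series_x3 (\<lambda>k. s (Suc k))) $ n $ m $ l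
    = ((coord 2 - coord 3) * series_x23 (\<lambda>m n. s (m + n + 2))) $ n $ m $ l"
    unfolding left_diff_distrib fps_sub_nth coord_mult_nth series_x2_nth series_x3_nth series_x23_nth
    by (cases m; cases n) auto
qed

text \<open>The components of the associated solution have this form, with \<open>\<omega>\<^sub>p = (\<xi> \<circ> \<Phi>\<^sup>p \<otimes> \<eta>) \<Omega>\<close>.\<close>

definition entry :: "(nat \<Rightarrow> 'f::field) \<Rightarrow> 'f fls fps" where
  "entry \<omega> = Abs_fps (\<lambda>k. fls_shift (int k + 1) (fls_const (\<omega> 0)) - fls_const (\<omega> (Suc k)))"

text \<open>The polar parts telescope under multiplication by x - y down to \<omega> 0; the
  constants leave one term in x^0 and one in x^1.\<close>

lemma x_minus_y_entry:
  "(x_minus_y * entry \<omega>) $ k $$ n = (if n = 0 then \<omega> k else 0) - (if n = 1 then \<omega> (Suc k) else 0)"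
proof -
  have "(x_minus_y * entry \<omega>) $ k = fls_X * entry \<omega> $ k - (if k = 0 then 0 else entry \<omega> $ (k - 1))"
    by (simp add: x_minus_y_def left_diff_distrib)
  then show ?thesis
    by (cases k) (auto simp: entry_def fls_X_times_conv_shift)
qed

lemma x_minus_y_entry_power_series: "(x_minus_y * entry \<omega>) $ k \<in> power_series"
  by (auto simp: power_series_iff x_minus_y_entry)

text \<open>The four ordered pairs of variables that occur in the equation. The regular part depends
  on the second variable alone.\<close>

lemma eval3_entry:
  fixes \<omega> :: "nat \<Rightarrow> 'f::field"
  shows "eval3 1 2 (entry \<omega>)
      = const3 (\<omega> 0) / (emb (coord 1) - emb (coord 2)) - emb (series_x2 (\<lambda>k. \<omega> (Suc k)))" (is ?a)
    and "eval3 1 3 (entry \<omega>)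
      = const3 (\<omega> 0) / (emb (coord 1) - emb (coord 3)) - emb (series_x3 (\<lambda>k. \<omega> (Suc k)))" (is ?b)
    and "eval3 2 3 (entry \<omega>)
      = const3 (\<omega> 0) / (emb (coord 2) - emb (coord 3)) - emb (series_x3 (\<lambda>k. \<omega> (Suc k)))" (is ?c)
    and "eval3 3 2 (entry \<omega>)
      = const3 (\<omega> 0) / (emb (coord 3) - emb (coord 2)) - emb (series_x2 (\<lambda>k. \<omega> (Suc k)))" (is ?d)
proof -
  note nths = place_def Let_def x_minus_y_entry left_diff_distrib fps_sub_nth coord_mult_nth
    const_series_nth series_x2_nth series_x3_nth fps_nth_Abs_fps
  have *: "eval3 i j (entry \<omega>) = const3 (\<omega> 0) / (emb (coord i) - emb (coord j)) - emb t"
    if nz: "coord i - coord j \<noteq> (0 :: 'f series3)"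
      and pl: "place i j (x_minus_y * entry \<omega>) = const_series (\<omega> 0) - (coord i - coord j) * t"
        for i j t
  proof -
    have "eval3 i j (entry \<omega>) = emb (const_series (\<omega> 0) - (coord i - coord j) * t) / emb (coord i
        - coord j)"
      unfolding eval3_def pl by (simp add: emb_def)
    then show ?thesis
      using nz emb_eq_zero_iff[of "coord i - coord j :: 'f series3"]
      by (simp add: emb_diff emb_mult const3_emb diff_divide_distrib)
  qed
  show ?a
  proof (rule *[OF coord_diff_nonzero(1)], rule series3_eqI)
    fix n m l
    show "place 1 2 (x_minus_y * entry \<omega>) $ n $ m $ l
      = (const_series (\<omega> 0) - (coord 1 - coord 2) * series_x2 (\<lambda>k. \<omega> (Suc k))) $ n $ m $ l"
      unfolding nths by (cases n; cases m; cases l) simp_all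
  qed
  show ?b
  proof (rule *[OF coord_diff_nonzero(2)], rule series3_eqI)
    fix n m l
    show "place 1 3 (x_minus_y * entry \<omega>) $ n $ m $ l
      = (const_series (\<omega> 0) - (coord 1 - coord 3) * series_x3 (\<lambda>k. \<omega> (Suc k))) $ n $ m $ l"
      unfolding nths by (cases n; cases m; cases l) simp_all
  qed
  show ?c
  proof (rule *[OF coord_diff_nonzero(3)], rule series3_eqI)
    fix n m l
    show "place 2 3 (x_minus_y * entry \<omega>) $ n $ m $ l
      = (const_series (\<omega> 0) - (coord 2 - coord 3) * series_x3 (\<lambda>k. \<omega> (Suc k))) $ n $ m $ l"
      unfolding nths by (cases n; cases m; cases l) simp_all
  qed
  show ?d
  proof (rule *[OF coord_diff_nonzero(4)], rule series3_eqI)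
    fix n m l
    show "place 3 2 (x_minus_y * entry \<omega>) $ n $ m $ l
      = (const_series (\<omega> 0) - (coord 3 - coord 2) * series_x2 (\<lambda>k. \<omega> (Suc k))) $ n $ m $ l"
      unfolding nths by (cases n; cases m; cases l) simp_all
  qed
qed

lemma sum_entry_products:
  fixes I :: "'b set" and J :: "'c set" and \<kappa> :: "'b \<Rightarrow> 'c \<Rightarrow> 'f::field" and f :: "'b \<Rightarrow> nat \<Rightarrow> 'f"
      and g :: "'c \<Rightarrow> nat \<Rightarrow> 'f"
  defines "X \<equiv> \<lambda>p q. \<Sum>b\<in>I. \<Sum>c\<in>J. \<kappa> b c * f b p * g c q"
  shows "(\<Sum>b\<in>I. \<Sum>c\<in>J. const3 (\<kappa> b c)
      * (const3 (f b 0) / d - emb (series_x2 (\<lambda>k. f b (Suc k))))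
      * (const3 (g c 0) / e - emb (series_x3 (\<lambda>k. g c (Suc k)))))
    = const3 (X 0 0) / (d * e) - emb (series_x3 (\<lambda>k. X 0 (Suc k))) / d
      - emb (series_x2 (\<lambda>k. X (Suc k) 0)) / e + emb (series_x23 (\<lambda>m n. X (Suc m) (Suc n)))"
proof -
  have "const3 (\<kappa> b c) * (const3 (f b 0) / d - emb (series_x2 (\<lambda>k. f b (Suc k))))
        * (const3 (g c 0) / e - emb (series_x3 (\<lambda>k. g c (Suc k))))
      = const3 (\<kappa> b c * f b 0 * g c 0) / (d * e)
        - emb (series_x3 (\<lambda>k. \<kappa> b c * f b 0 * g c (Suc k))) / d
        - emb (series_x2 (\<lambda>k. \<kappa> b c * f b (Suc k) * g c 0)) / e
        + emb (series_x23 (\<lambda>m n. \<kappa> b c * f b (Suc m) * g c (Suc n)))" for b c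
  proof -
    have "const3 (\<kappa> b c * f b 0 * g c 0) = const3 (\<kappa> b c) * const3 (f b 0) * const3 (g c 0)"
      by (simp add: const3_emb flip: const_series_mult emb_mult)
    moreover have "emb (series_x3 (\<lambda>k. \<kappa> b c * f b 0 * g c (Suc k)))
        = const3 (\<kappa> b c) * const3 (f b 0) * emb (series_x3 (\<lambda>k. g c (Suc k)))"
      by (simp add: const3_emb const_series_mult mult.assoc flip: emb_mult)
    moreover have "emb (series_x2 (\<lambda>k. \<kappa> b c * f b (Suc k) * g c 0))
        = const3 (\<kappa> b c) * emb (series_x2 (\<lambda>k. f b (Suc k))) * const3 (g c 0)"
      by (simp add: const3_emb const_series_mult mult_ac flip: emb_mult)
    moreover have "emb (series_x23 (\<lambda>m n. \<kappa> b c * f b (Suc m) * g c (Suc n)))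
        = const3 (\<kappa> b c) * emb (series_x2 (\<lambda>k. f b (Suc k))) * emb (series_x3 (\<lambda>k. g c (Suc k)))"
      by (simp add: const3_emb const_series_mult series_x2_mult_series_x3 mult.assoc flip: emb_mult)
    ultimately show ?thesis
      by (simp add: algebra_simps diff_divide_distrib add_divide_distrib)
  qed
  then show ?thesis
    by (simp add: X_def sum.distrib sum_subtractf const3_emb emb_sum
        flip: sum_divide_distrib series_sum)
qed

text \<open>A product of two entries sorted by poles. In all three brackets of the equation the
  first factor has its regular part in x2 and the second in x3, so only the denominators d and e
  vary; p counts powers of \<Phi> in the first factor and q in the second.\<close>

definition products :: "(nat \<Rightarrow> nat \<Rightarrow> 'f::field) \<Rightarrow> 'f series3 fract \<Rightarrow> 'f series3 fract \<Rightarrow> 'f series3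
    fract"
  where "products X d e = const3 (X 0 0) / (d * e) - emb (series_x3 (\<lambda>k. X 0 (Suc k))) / d
      - emb (series_x2 (\<lambda>k. X (Suc k) 0)) / e + emb (series_x23 (\<lambda>m n. X (Suc m) (Suc n)))"

lemma sum_eval3_products:
  "(\<Sum>b\<in>I. \<Sum>c\<in>J. const3 (\<kappa> b c) * eval3 1 2 (entry (f b)) * eval3 1 3 (entry (g c)))
    = products (\<lambda>p q. \<Sum>b\<in>I. \<Sum>c\<in>J. \<kappa> b c * f b p * g c q)
        (emb (coord 1) - emb (coord 2)) (emb (coord 1) - emb (coord 3))"
  "(\<Sum>b\<in>I. \<Sum>c\<in>J. const3 (\<kappa> b c) * eval3 1 2 (entry (f b)) * eval3 2 3 (entry (g c)))
    = products (\<lambda>p q. \<Sum>b\<in>I. \<Sum>c\<in>J. \<kappa> b c * f b p * g c q)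
        (emb (coord 1) - emb (coord 2)) (emb (coord 2) - emb (coord 3))"
  "(\<Sum>b\<in>I. \<Sum>c\<in>J. const3 (\<kappa> b c) * eval3 3 2 (entry (f b)) * eval3 1 3 (entry (g c)))
    = products (\<lambda>p q. \<Sum>b\<in>I. \<Sum>c\<in>J. \<kappa> b c * f b p * g c q)
        (emb (coord 3) - emb (coord 2)) (emb (coord 1) - emb (coord 3))"
  unfolding eval3_entry products_def by (rule sum_entry_products)+

subsection \<open>Solutions from Nijenhuis operators\<close>

context fd_lie_algebra
begin

lemma nijenhuis_power_left:
  assumes lin: "lin \<Phi>" and nij: "nijenhuis \<Phi>"
  shows "bracket ((\<Phi> ^^ p) b) (\<Phi> c)
    = (\<Phi> ^^ p) (bracket b (\<Phi> c)) + \<Phi> (bracket ((\<Phi> ^^ p) b) c) - (\<Phi> ^^ Suc p) (bracket b c)"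
proof (induction p)
  case (Suc p)
  have "bracket (\<Phi> ((\<Phi> ^^ p) b)) (\<Phi> c)
      = \<Phi> (bracket (\<Phi> ((\<Phi> ^^ p) b)) c + bracket ((\<Phi> ^^ p) b) (\<Phi> c)) - \<Phi> (\<Phi> (bracket ((\<Phi> ^^ p) b) c))"
    using nij by (simp add: nijenhuis_def)
  then show ?case using Suc lin by (simp add: lin_add lin_diff)
qed simp

text \<open>Vanishing of the mixed torsion of two powers of \<Phi>, solved for the bracket of the
  images. Raising q by one uses the case of a single \<Phi> on the right.\<close>

lemma nijenhuis_power:
  assumes lin: "lin \<Phi>" and nij: "nijenhuis \<Phi>"
  shows "bracket ((\<Phi> ^^ p) b) ((\<Phi> ^^ q) c)
    = (\<Phi> ^^ p) (bracket b ((\<Phi> ^^ q) c)) + (\<Phi> ^^ q) (bracket ((\<Phi> ^^ p) b) c) - (\<Phi> ^^ (p + q))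
        (bracket b c)"
proof (induction q)
  case (Suc q)
  have "bracket ((\<Phi> ^^ p) b) (\<Phi> ((\<Phi> ^^ q) c))
      = (\<Phi> ^^ p) (bracket b (\<Phi> ((\<Phi> ^^ q) c))) + \<Phi> (bracket ((\<Phi> ^^ p) b) ((\<Phi> ^^ q) c))
        - (\<Phi> ^^ Suc p) (bracket b ((\<Phi> ^^ q) c))"
    by (rule nijenhuis_power_left[OF lin nij])
  then show ?case using Suc lin by (simp add: lin_add lin_diff)
qed simp

lemma functional_dual_basis: "functional scale (dual_basis b)"
  by (rule linear_representation) (simp_all add: independent_Basis span_Basis)

lemma dual_basis_sum:
  assumes "functional scale F"
  shows "(\<Sum>b\<in>Basis. dual_basis b x * F b) = F x"
proof -
  have "(\<Sum>b\<in>Basis. dual_basis b x * F b) = F (\<Sum>b\<in>Basis. dual_basis b x *s b)"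
    using assms by (simp add: functional_sum functional_scale)
  also have "(\<Sum>b\<in>Basis. dual_basis b x *s b) = x"
    by (rule sum_representation_eq) (simp_all add: independent_Basis span_Basis finite_Basis)
  finally show ?thesis .
qed

lemma component_solution:
  assumes lin: "lin \<Phi>" and "functional scale \<xi>" "functional scale \<eta>"
  shows "component (assoc_solution B (twist_space \<Phi>)) \<xi> \<eta> = entry (\<lambda>p. \<Sum>b\<in>B. \<xi> ((\<Phi> ^^ p) b) * \<eta> b)"
proof (rule fps_ext, rule fls_eqI)
  fix k n
  have "component (assoc_solution B (twist_space \<Phi>)) \<xi> \<eta> $ k $$ n
      = (assoc_solution B (twist_space \<Phi>) $ k $$ n) \<xi> \<eta>"
    by (simp add: component_def fls_map_nth)
  also have "\<dots> = entry (\<lambda>p. \<Sum>b\<in>B. \<xi> ((\<Phi> ^^ p) b) * \<eta> b) $ k $$ n"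
    unfolding assoc_solution_nth[OF lin] using assms(2,3)
    by (auto simp: entry_def casimir_def sum_fun_apply tensor_def)
  finally show "component (assoc_solution B (twist_space \<Phi>)) \<xi> \<eta> $ k $$ n
      = entry (\<lambda>p. \<Sum>b\<in>B. \<xi> ((\<Phi> ^^ p) b) * \<eta> b) $ k $$ n" .
qed

text \<open>Contracting with the dual basis eliminates \<open>Basis\<close> and puts the two legs
  sharing a slot directly into the bracket.\<close>

lemma bracket_functional_sum:
  assumes F: "functional scale F"
  shows "(\<Sum>b\<in>Basis. \<Sum>c\<in>Basis. F (bracket b c) * (\<Sum>u\<in>B. dual_basis b (S u) * G u)
        * (\<Sum>v\<in>B. dual_basis c (T v) * K v))
    = (\<Sum>u\<in>B. \<Sum>v\<in>B. F (bracket (S u) (T v)) * G u * K v)"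
proof -
  have lr: "functional scale (\<lambda>c. F (bracket w c))" and ll: "functional scale (\<lambda>b. F (bracket b
      w))" for w
  proof -
    have "lin (\<lambda>b. bracket b w)" by (rule linI) (simp_all add: bracket_add_left bracket_scale_left)
    then show "functional scale (\<lambda>c. F (bracket w c))" "functional scale (\<lambda>b. F (bracket b w))"
      by (auto intro: functional_comp[OF F])
  qed
  have "(\<Sum>b\<in>Basis. \<Sum>c\<in>Basis. F (bracket b c) * (\<Sum>u\<in>B. dual_basis b (S u) * G u)
        * (\<Sum>v\<in>B. dual_basis c (T v) * K v))
      = (\<Sum>b\<in>Basis. \<Sum>c\<in>Basis. \<Sum>u\<in>B. \<Sum>v\<in>B.
          dual_basis b (S u) * (dual_basis c (T v) * F (bracket b c)) * (G u * K v))"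
    by (simp add: sum_distrib_left sum_distrib_right mult_ac)
  also have "\<dots> = (\<Sum>b\<in>Basis. \<Sum>u\<in>B. \<Sum>v\<in>B. \<Sum>c\<in>Basis.
          dual_basis b (S u) * (dual_basis c (T v) * F (bracket b c)) * (G u * K v))"
    by (subst sum.swap, subst (2) sum.swap) simp
  also have "\<dots> = (\<Sum>b\<in>Basis. \<Sum>u\<in>B. \<Sum>v\<in>B. dual_basis b (S u) * F (bracket b (T v)) * (G u * K v))"
    using dual_basis_sum[OF lr] by (simp flip: sum_distrib_left sum_distrib_right)
  also have "\<dots> = (\<Sum>u\<in>B. \<Sum>v\<in>B. \<Sum>b\<in>Basis. dual_basis b (S u) * F (bracket b (T v)) * (G u * K v))"
    by (subst sum.swap, subst (2) sum.swap) simp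
  also have "\<dots> = (\<Sum>u\<in>B. \<Sum>v\<in>B. F (bracket (S u) (T v)) * (G u * K v))"
    using dual_basis_sum[OF ll] by (simp flip: sum_distrib_right)
  finally show ?thesis by (simp add: mult.assoc)
qed

lemma gcybe_nijenhuis:
  assumes lin: "lin \<Phi>" and nij: "nijenhuis \<Phi>" and B: "orthonormal_basis B"
  shows "gcybe (assoc_solution B (twist_space \<Phi>))"
  unfolding gcybe_def
proof (intro conjI allI impI)
  let ?r = "assoc_solution B (twist_space \<Phi>)"
  show "(x_minus_y * component ?r \<xi> \<eta>) $ k \<in> power_series"
    if "functional scale \<xi> \<and> functional scale \<eta>" for \<xi> \<eta> k
    using that by (simp add: component_solution[OF lin] x_minus_y_entry_power_series)
  fix \<xi> \<eta> \<zeta> assume "functional scale \<xi> \<and> functional scale \<eta> \<and> functional scale \<zeta>"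
  then have \<xi>: "functional scale \<xi>" and \<eta>: "functional scale \<eta>" and \<zeta>: "functional scale \<zeta>" by auto
  let ?S1 = "(\<Sum>b\<in>Basis. \<Sum>c\<in>Basis. const3 (\<xi> (bracket b c))
      * eval3 1 2 (component ?r (dual_basis b) \<eta>) * eval3 1 3 (component ?r (dual_basis c) \<zeta>))"
  let ?S2 = "(\<Sum>b\<in>Basis. \<Sum>c\<in>Basis. const3 (\<eta> (bracket b c))
      * eval3 1 2 (component ?r \<xi> (dual_basis b)) * eval3 2 3 (component ?r (dual_basis c) \<zeta>))"
  let ?S3 = "(\<Sum>b\<in>Basis. \<Sum>c\<in>Basis. const3 (\<zeta> (bracket b c))
      * eval3 3 2 (component ?r (dual_basis b) \<eta>) * eval3 1 3 (component ?r \<xi> (dual_basis c)))"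
  note comp = component_solution[OF lin, of _ _ B]
  let ?x = "\<lambda>i. emb (coord i) :: 'f series3 fract"
  \<comment> \<open>A common form for the three terms: the bracket sits in the slot of \<xi>, and
    \<eta>, \<zeta> see bare basis vectors.\<close>
  define P where "P w = (\<Sum>u\<in>B. \<Sum>v\<in>B. \<xi> (w u v) * \<eta> u * \<zeta> v)" for w
  define X where "X p q = P (\<lambda>u v. bracket ((\<Phi> ^^ p) u) ((\<Phi> ^^ q) v))" for p q
  define Y where "Y p q = - P (\<lambda>u v. (\<Phi> ^^ p) (bracket u ((\<Phi> ^^ q) v)))" for p q
  define Z where "Z p q = - P (\<lambda>u v. (\<Phi> ^^ q) (bracket ((\<Phi> ^^ p) u) v))" for p q
  define s where "s p = P (\<lambda>u v. (\<Phi> ^^ p) (bracket u v))" for p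
  have fp: "functional scale (\<lambda>x. F ((\<Phi> ^^ p) x))" if "functional scale F" for F p
    using that lin_funpow[OF lin] by (rule functional_comp)
  have T1: "?S1 = products X (?x 1 - ?x 2) (?x 1 - ?x 3)"
    unfolding comp[OF functional_dual_basis \<eta>] comp[OF functional_dual_basis \<zeta>] 
      sum_eval3_products bracket_functional_sum[OF \<xi>] X_def P_def ..
  have T2: "?S2 = products Y (?x 1 - ?x 2) (?x 2 - ?x 3)"
  proof -
    have *: "(\<Sum>b\<in>Basis. \<Sum>c\<in>Basis. \<eta> (bracket b c) * (\<Sum>u\<in>B. \<xi> ((\<Phi> ^^ p) u) * dual_basis b u)
        * (\<Sum>v\<in>B. dual_basis c ((\<Phi> ^^ q) v) * \<zeta> v)) = Y p q" for p q
    proof -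
      have "(\<Sum>b\<in>Basis. \<Sum>c\<in>Basis. \<eta> (bracket b c) * (\<Sum>u\<in>B. \<xi> ((\<Phi> ^^ p) u) * dual_basis b u)
            * (\<Sum>v\<in>B. dual_basis c ((\<Phi> ^^ q) v) * \<zeta> v))
          = (\<Sum>b\<in>Basis. \<Sum>c\<in>Basis. \<eta> (bracket b c) * (\<Sum>u\<in>B. dual_basis b u * \<xi> ((\<Phi> ^^ p) u))
            * (\<Sum>v\<in>B. dual_basis c ((\<Phi> ^^ q) v) * \<zeta> v))"
        by (simp add: mult.commute)
      also have "\<dots> = (\<Sum>u\<in>B. \<Sum>v\<in>B. \<eta> (bracket u ((\<Phi> ^^ q) v)) * \<xi> ((\<Phi> ^^ p) u) * \<zeta> v)"
        by (rule bracket_functional_sum[OF \<eta>, where S = "\<lambda>u. u"])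
      also have "\<dots> = (\<Sum>v\<in>B. \<Sum>u\<in>B. \<xi> ((\<Phi> ^^ p) u) * \<eta> (bracket u ((\<Phi> ^^ q) v)) * \<zeta> v)"
        by (subst sum.swap) (simp add: mult.commute)
      \<comment> \<open>Invariance of \<Omega> carries the bracket from the slot of \<eta> to that
        of \<xi>; restoring the order in the bracket gives the sign in Y.\<close>
      also have "\<dots> = (\<Sum>v\<in>B. \<Sum>u\<in>B. \<xi> ((\<Phi> ^^ p) (bracket ((\<Phi> ^^ q) v) u)) * \<eta> u * \<zeta> v)"
        using casimir_invariant[OF B fp[OF \<xi>] \<eta>] by (simp flip: sum_distrib_right)
      also have "\<dots> = (\<Sum>v\<in>B. \<Sum>u\<in>B. - (\<xi> ((\<Phi> ^^ p) (bracket u ((\<Phi> ^^ q) v))) * \<eta> u * \<zeta> v))"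
        by (subst bracket_anti) (simp add: lin_neg[OF lin_funpow[OF lin]] functional_neg[OF \<xi>])
      also have "\<dots> = Y p q" unfolding Y_def P_def by (subst sum.swap) (simp add: sum_negf)
      finally show ?thesis .
    qed
    show ?thesis
      unfolding comp[OF \<xi> functional_dual_basis] comp[OF functional_dual_basis \<zeta>]
        sum_eval3_products * ..
  qed
  have T3: "?S3 = products Z (?x 3 - ?x 2) (?x 1 - ?x 3)"
  proof -
    have *: "(\<Sum>b\<in>Basis. \<Sum>c\<in>Basis. \<zeta> (bracket b c) * (\<Sum>u\<in>B. dual_basis b ((\<Phi> ^^ p) u) * \<eta> u)
        * (\<Sum>v\<in>B. \<xi> ((\<Phi> ^^ q) v) * dual_basis c v)) = Z p q" for p q
    proof -
      have "(\<Sum>b\<in>Basis. \<Sum>c\<in>Basis. \<zeta> (bracket b c) * (\<Sum>u\<in>B. dual_basis b ((\<Phi> ^^ p) u) * \<eta> u)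
            * (\<Sum>v\<in>B. \<xi> ((\<Phi> ^^ q) v) * dual_basis c v))
          = (\<Sum>b\<in>Basis. \<Sum>c\<in>Basis. \<zeta> (bracket b c) * (\<Sum>u\<in>B. dual_basis b ((\<Phi> ^^ p) u) * \<eta> u)
            * (\<Sum>v\<in>B. dual_basis c v * \<xi> ((\<Phi> ^^ q) v)))"
        by (simp add: mult.commute)
      also have "\<dots> = (\<Sum>u\<in>B. \<Sum>v\<in>B. \<zeta> (bracket ((\<Phi> ^^ p) u) v) * \<eta> u * \<xi> ((\<Phi> ^^ q) v))"
        by (rule bracket_functional_sum[OF \<zeta>, where T = "\<lambda>v. v"])
      also have "\<dots> = (\<Sum>u\<in>B. \<Sum>v\<in>B. \<xi> ((\<Phi> ^^ q) v) * - \<zeta> (bracket v ((\<Phi> ^^ p) u)) * \<eta> u)"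
        by (subst bracket_anti) (simp add: functional_neg[OF \<zeta>] mult_ac)
      also have "\<dots> = (\<Sum>u\<in>B. - ((\<Sum>v\<in>B. \<xi> ((\<Phi> ^^ q) v) * \<zeta> (bracket v ((\<Phi> ^^ p) u))) * \<eta> u))"
        by (simp add: sum_negf sum_distrib_right)
      \<comment> \<open>The same transfer from the slot of \<zeta>, this time in the variable
        v.\<close>
      also have "\<dots> = (\<Sum>u\<in>B. - ((\<Sum>v\<in>B. \<xi> ((\<Phi> ^^ q) (bracket ((\<Phi> ^^ p) u) v)) * \<zeta> v) * \<eta> u))"
        using casimir_invariant[OF B fp[OF \<xi>] \<zeta>] by simp
      also have "\<dots> = Z p q"
        unfolding Z_def P_def by (simp add: sum_negf sum_distrib_left mult_ac)
      finally show ?thesis .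
    qed
    show ?thesis
      unfolding comp[OF functional_dual_basis \<eta>] comp[OF \<xi> functional_dual_basis]
        sum_eval3_products * ..
  qed
  have P_add: "P (\<lambda>u v. w u v + z u v) = P w + P z" and P_diff: "P (\<lambda>u v. w u v - z u v) = P w - P z"
    for w z :: "'g \<Rightarrow> 'g \<Rightarrow> 'g"
    by (simp_all add: P_def functional_add[OF \<xi>] functional_diff[OF \<xi>] distrib_right left_diff_distrib
        sum.distrib sum_subtractf)
  have XYZ: "X p q + Y p q + Z p q = - s (p + q)" for p q
    unfolding X_def Y_def Z_def s_def
    by (subst nijenhuis_power[OF lin nij]) (simp add: P_add P_diff)
  \<comment> \<open>These boundary values cancel the poles along x1 - x2 and x1 - x3 between the
    brackets; along x2 - x3 only s survives.\<close>
  have lin_terms: "Y 0 q = - X 0 q" "Z p 0 = - X p 0" "Y p 0 = - s p" "Z 0 q = - s q" "X 0 0 = s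
      0" for p q
    by (simp_all add: X_def Y_def Z_def s_def)
  have quad: "emb (series_x23 (\<lambda>m n. X (Suc m) (Suc n))) + emb (series_x23 (\<lambda>m n. Y (Suc m) (Suc n)))
      + emb (series_x23 (\<lambda>m n. Z (Suc m) (Suc n))) = - emb (series_x23 (\<lambda>m n. s (m + n + 2)))"
    using XYZ[of "Suc _" "Suc _"] by (simp flip: emb_add series_x23_add add: emb_neg series_neg)
  have diff: "emb (series_x2 (\<lambda>k. s (Suc k))) - emb (series_x3 (\<lambda>k. s (Suc k)))
      = (?x 2 - ?x 3) * emb (series_x23 (\<lambda>m n. s (m + n + 2)))"
    by (simp only: series_x2_diff_series_x3 flip: emb_diff emb_mult)
  have nz: "?x 1 - ?x 2 \<noteq> 0" "?x 1 - ?x 3 \<noteq> 0" "?x 2 - ?x 3 \<noteq> 0" "?x 3 - ?x 2 \<noteq> 0"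
    using coord_diff_nonzero[where ?'f = 'f]
      by (simp_all only: emb_diff[symmetric] emb_eq_zero_iff) auto
  define x12 x13 x23 where "x12 = ?x 1 - ?x 2" "x13 = ?x 1 - ?x 3" "x23 = ?x 2 - ?x 3"
  have x32: "?x 3 - ?x 2 = - x23" and x13': "x13 = x12 + x23" by (simp_all add: x12_x13_x23_def)
  note nz' = nz[folded x12_x13_x23_def]
  have "products X x12 x13 + products Y x12 x23 + products Z (- x23) x13 = 0"
  proof -
    have "products X x12 x13 + products Y x12 x23 + products Z (- x23) x13
        = const3 (s 0) * (1 / (x12 * x13) - 1 / (x12 * x23) + 1 / (x23 * x13))
          + (emb (series_x2 (\<lambda>k. s (Suc k))) - emb (series_x3 (\<lambda>k. s (Suc k)))) / x23
          + (emb (series_x23 (\<lambda>m n. X (Suc m) (Suc n))) + emb (series_x23 (\<lambda>m n. Y (Suc m) (Suc n)))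
              + emb (series_x23 (\<lambda>m n. Z (Suc m) (Suc n))))"
      by (simp add: products_def lin_terms const3_emb series_neg emb_neg algebra_simps
          diff_divide_distrib
          add_divide_distrib)
    \<comment> \<open>The partial-fraction identity behind the solution \<Omega>/(x - y); it reduces
      to x13 = x12 + x23.\<close>
    also have "1 / (x12 * x13) - 1 / (x12 * x23) + 1 / (x23 * x13) = 0"
    proof -
      have "1 / (x12 * x13) - 1 / (x12 * x23) + 1 / (x23 * x13) = (x12 + x23 - x13) / (x12 * x13 *
          x23)"
        using nz'(1,2,3) by (simp add: diff_divide_distrib add_divide_distrib)
      then show ?thesis by (simp add: x13')
    qed
    finally show ?thesis unfolding quad diff using nz' by (simp add: x12_x13_x23_def(3)[symmetric])
  qed
  then show "?S1 + ?S2 + ?S3 = 0"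
    unfolding T1 T2 T3 by (simp add: x12_x13_x23_def)
qed

end

theorem theoremA:
  fixes scale :: "'f::{alg_closed_field, field_char_0} \<Rightarrow> 'g::ab_group_add \<Rightarrow> 'g"
    and bracket :: "'g \<Rightarrow> 'g \<Rightarrow> 'g"
    and Basis H :: "'g set"
    and E :: "('g \<Rightarrow> 'f) \<Rightarrow> 'g"
  assumes "simple_lie_algebra_data scale bracket Basis H E"
  shows
    "(\<forall>W. lie_algebra.regular_type0 scale bracket H W \<longrightarrow>
        (\<exists>n D a \<phi>. lie_algebra.regular_partition scale bracket H n D
           \<and> lie_algebra.endo_on scale H \<phi>
           \<and> fd_lie_algebra.compatible scale bracket E n D a \<phi>
           \<and> lie_algebra.W_sum_direct scale bracket H n D a \<phi>
           \<and> W = lie_algebra.W_sum scale bracket H n D a \<phi>))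
     \<and> (\<forall>n D a \<phi>. lie_algebra.regular_partition scale bracket H n D
           \<and> lie_algebra.endo_on scale H \<phi>
           \<and> fd_lie_algebra.compatible scale bracket E n D a \<phi> \<longrightarrow>
             lie_algebra.W_sum_direct scale bracket H n D a \<phi>
           \<and> lie_algebra.regular_type0 scale bracket H (lie_algebra.W_sum scale bracket H n D a \<phi>)
           \<and> (\<forall>B. fd_lie_algebra.orthonormal_basis scale bracket Basis B \<longrightarrow>
                fd_lie_algebra.assoc_solution scale B (lie_algebra.W_sum scale bracket H n D a \<phi>)
                = fd_lie_algebra.r_formula scale bracket H E B n D a \<phi>
              \<and> fd_lie_algebra.gcybe scale bracket Basis
                  (fd_lie_algebra.assoc_solution scale B
                    (lie_algebra.W_sum scale bracket H n D a \<phi>))))"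
proof -
  interpret simple_lie_algebra_data scale bracket Basis H E by fact
  show ?thesis
  proof (intro conjI allI impI)
    fix W assume "regular_type0 H W"
    then show "\<exists>n D a \<phi>. regular_partition H n D \<and> endo_on H \<phi> \<and> compatible E n D a \<phi>
        \<and> W_sum_direct H n D a \<phi> \<and> W = W_sum H n D a \<phi>"
      by (rule regular_decomposition)
  next
    fix n D a \<phi> assume "regular_partition H n D \<and> endo_on H \<phi> \<and> compatible E n D a \<phi>"
    then have part: "regular_partition H n D"
      and endo: "endo_on H \<phi>" and comp: "compatible E n D a \<phi>" by auto
    from extend_partition_map[OF part endo comp] obtain \<Phi> where
      lin: "lin \<Phi>" and nij: "nijenhuis \<Phi>" and \<Phi>H: "\<And>h. h \<in> H \<Longrightarrow> \<Phi> h = \<phi> h"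
      and \<phi>H: "\<And>h. h \<in> H \<Longrightarrow> \<phi> h \<in> H"
      and \<Phi>E: "\<And>i \<alpha>. i \<in> {1..n} \<Longrightarrow> \<alpha> \<in> D i \<Longrightarrow> \<Phi> (E \<alpha>) = scale (a i) (E \<alpha>)"
      and eq: "\<And>h x. h \<in> H \<Longrightarrow> \<Phi> (bracket h x) = bracket h (\<Phi> x)"
      by blast
    have W: "W_sum H n D a \<phi> = twist_space \<Phi>"
      by (rule W_sum_eq[OF part lin \<Phi>H \<phi>H \<Phi>E])
    show "W_sum_direct H n D a \<phi>"
      by (rule direct_W_sum[OF part lin \<Phi>H \<phi>H \<Phi>E])
    show "regular_type0 H (W_sum H n D a \<phi>)"
      unfolding W by (rule regular_twist_space[OF lin nij eq])
    fix B assume B: "orthonormal_basis B"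
    show "assoc_solution B (W_sum H n D a \<phi>) = r_formula H E B n D a \<phi>"
      unfolding W by (rule assoc_solution_formula[OF part lin \<Phi>H \<phi>H \<Phi>E B])
    show "gcybe (assoc_solution B (W_sum H n D a \<phi>))"
      unfolding W by (rule gcybe_nijenhuis[OF lin nij B])
  qed
qed

end
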